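(* Work in $ZF+DC$. If every Turing invariant set of reals has the perfect set property, then every set of reals has the perfect set property.
   Context: Reals are elements of $2^{\omega}$. A set $A\subseteq 2^{\omega}$ is Turing invariant if whenever $x\in A$ and $y$ is Turing equivalent to $x$ ($x\le_T y$ and $y\le_T x$), then $y\in A$. A set of reals has the perfect set property if it is either countable or contains a nonempty perfect (closed, no isolated points) subset. *)

theory Defs
  imports Main
begin

text \<open>
  HOL proves the axiom of choice, hence the existence of (Turing invariant) sets of reals
  without the perfect set property; the implication stated about HOL's own sets of reals
  would hold for a trivial reason. Therefore ZF + DC is rendered as a first-order theory in the
  language of set theory, and the theorem is stated about an arbitrary model of that theory. All
  quantifiers in the definitions below range over elements of the model. HOL sets of elements
  of the model occur only as notation for classes that are first-order definable from
  parameters; they are never quantified over.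
\<close>

text \<open>First-order formulas in the language of set theory, with de Bruijn indices.\<close>

datatype fm =
    Member nat nat
  | Equal nat nat
  | Neg fm
  | And fm fm
  | Forall fm

primrec sat :: "('v \<Rightarrow> 'v \<Rightarrow> bool) \<Rightarrow> (nat \<Rightarrow> 'v) \<Rightarrow> fm \<Rightarrow> bool" where
  "sat mem env (Member i j) \<longleftrightarrow> mem (env i) (env j)"
| "sat mem env (Equal i j) \<longleftrightarrow> env i = env j"
| "sat mem env (Neg \<phi>) \<longleftrightarrow> \<not> sat mem env \<phi>"
| "sat mem env (And \<phi> \<psi>) \<longleftrightarrow> sat mem env \<phi> \<and> sat mem env \<psi>"
| "sat mem env (Forall \<phi>) \<longleftrightarrow> (\<forall>x. sat mem (case_nat x env) \<phi>)"

locale membership =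
  fixes mem :: "'v \<Rightarrow> 'v \<Rightarrow> bool"
begin

definition elts :: "'v \<Rightarrow> 'v set" where
  "elts a = {x. mem x a}"

text \<open>
  The definite descriptions below denote what they should in models of ZF; see the lemmas at
  the end of this theory.
\<close>

definition zero :: 'v where
  "zero = (THE z. elts z = {})"

definition upair :: "'v \<Rightarrow> 'v \<Rightarrow> 'v" where
  "upair a b = (THE z. elts z = {a, b})"

definition opair :: "'v \<Rightarrow> 'v \<Rightarrow> 'v" where
  "opair a b = upair (upair a a) (upair a b)"

definition triple :: "'v \<Rightarrow> 'v \<Rightarrow> 'v \<Rightarrow> 'v" where
  "triple a b c = opair a (opair b c)"

definition succ :: "'v \<Rightarrow> 'v" where
  "succ a = (THE z. elts z = insert a (elts a))"

definition one :: 'v where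
  "one = succ zero"

definition two :: 'v where
  "two = succ one"

definition is_inductive :: "'v \<Rightarrow> bool" where
  "is_inductive i \<longleftrightarrow> zero \<in> elts i \<and> (\<forall>x\<in>elts i. succ x \<in> elts i)"

definition omega :: 'v where
  "omega = (THE w. is_inductive w \<and> (\<forall>i. is_inductive i \<longrightarrow> elts w \<subseteq> elts i))"

definition func :: "'v \<Rightarrow> 'v set \<Rightarrow> 'v set \<Rightarrow> bool" where
  "func f A B \<longleftrightarrow>
     elts f \<subseteq> {opair x y | x y. x \<in> A \<and> y \<in> B} \<and>
     (\<forall>x\<in>A. \<exists>!y. opair x y \<in> elts f)"

definition app :: "'v \<Rightarrow> 'v \<Rightarrow> 'v" where
  "app f x = (THE y. opair x y \<in> elts f)"

definition countable_set :: "'v \<Rightarrow> bool" where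
  "countable_set a \<longleftrightarrow>
     (\<exists>f. func f (elts a) (elts omega) \<and>
          (\<forall>x\<in>elts a. \<forall>y\<in>elts a. app f x = app f y \<longrightarrow> x = y))"


subsection \<open>The Cantor space\<close>

definition is_real :: "'v \<Rightarrow> bool" where
  "is_real x \<longleftrightarrow> func x (elts omega) (elts two)"

definition set_of_reals :: "'v \<Rightarrow> bool" where
  "set_of_reals a \<longleftrightarrow> (\<forall>x\<in>elts a. is_real x)"

text \<open>The basic open neighbourhood of \<open>x\<close> given by its restriction to \<open>n\<close>.\<close>

definition nbhd :: "'v \<Rightarrow> 'v \<Rightarrow> 'v set" where
  "nbhd x n = {y. is_real y \<and> (\<forall>k\<in>elts n. app y k = app x k)}"

definition closed_set :: "'v \<Rightarrow> bool" where
  "closed_set c \<longleftrightarrow>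
     set_of_reals c \<and>
     (\<forall>x. is_real x \<and> x \<notin> elts c \<longrightarrow> (\<exists>n\<in>elts omega. nbhd x n \<inter> elts c = {}))"

definition isolated_point :: "'v \<Rightarrow> 'v \<Rightarrow> bool" where
  "isolated_point x a \<longleftrightarrow> x \<in> elts a \<and> (\<exists>n\<in>elts omega. nbhd x n \<inter> elts a = {x})"

definition perfect_set :: "'v \<Rightarrow> bool" where
  "perfect_set p \<longleftrightarrow> closed_set p \<and> (\<forall>x. \<not> isolated_point x p)"

definition perfect_set_property :: "'v \<Rightarrow> bool" where
  "perfect_set_property a \<longleftrightarrow>
     countable_set a \<or> (\<exists>p. perfect_set p \<and> elts p \<noteq> {} \<and> elts p \<subseteq> elts a)"


subsection \<open>Oracle Turing machines and Turing reducibility\<close>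

text \<open>
  A machine has the states \<open>{0,\<dots>,k-1}\<close> and the tape alphabet \<open>{0,\<dots>,s-1}\<close>, where \<open>k \<ge> 3\<close>,
  \<open>s \<ge> 2\<close>, and \<open>0\<close> is the blank symbol. State \<open>2\<close> is initial; states \<open>0\<close> and \<open>1\<close> are halting and
  double as the output bit. There is a one-way infinite work tape and a read-only oracle tape
  carrying the oracle; the head scans the same cell of both. Given the state, the oracle bit
  and the work tape symbol under the head, the table \<open>d\<close> yields the new state, the symbol to be
  written and the move (\<open>0\<close> left, \<open>1\<close> right; moving left from cell \<open>0\<close> has no effect).
\<close>

definition oracle_machine :: "'v \<Rightarrow> 'v \<Rightarrow> 'v \<Rightarrow> bool" where
  "oracle_machine k s d \<longleftrightarrow>
     k \<in> elts omega \<and> s \<in> elts omega \<and> two \<in> elts k \<and> one \<in> elts s \<and>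
     func d {triple q b a | q b a. q \<in> elts k \<and> b \<in> elts two \<and> a \<in> elts s}
            {triple q a v | q a v. q \<in> elts k \<and> a \<in> elts s \<and> v \<in> elts two}"

text \<open>A configuration consists of the state, the head position and the work tape.\<close>

definition configs :: "'v \<Rightarrow> 'v \<Rightarrow> 'v set" where
  "configs k s =
     {triple q h t | q h t. q \<in> elts k \<and> h \<in> elts omega \<and> func t (elts omega) (elts s)}"

text \<open>The input \<open>n\<close> is given in unary on the work tape.\<close>

definition initial_config :: "'v \<Rightarrow> 'v \<Rightarrow> bool" where
  "initial_config n u \<longleftrightarrow>
     (\<exists>t. u = triple two zero t \<and>
          (\<forall>j\<in>elts omega. app t j = (if j \<in> elts n then one else zero)))"

definition step :: "'v \<Rightarrow> 'v \<Rightarrow> 'v \<Rightarrow> 'v \<Rightarrow> bool" where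
  "step d y u u' \<longleftrightarrow>
     (\<exists>q h t q' h' t' a v.
        u = triple q h t \<and> u' = triple q' h' t' \<and>
        q \<notin> elts two \<and>
        app d (triple q (app y h) (app t h)) = triple q' a v \<and>
        (\<forall>j\<in>elts omega. app t' j = (if j = h then a else app t j)) \<and>
        (v = one \<longrightarrow> h' = succ h) \<and>
        (v = zero \<longrightarrow> h = succ h' \<or> h = zero \<and> h' = zero))"

text \<open>The machine halts on input \<open>n\<close> with oracle \<open>y\<close> and output \<open>r\<close>.\<close>

definition machine_output :: "'v \<Rightarrow> 'v \<Rightarrow> 'v \<Rightarrow> 'v \<Rightarrow> 'v \<Rightarrow> 'v \<Rightarrow> bool" where
  "machine_output k s d y n r \<longleftrightarrow>
     r \<in> elts two \<and>
     (\<exists>m\<in>elts omega. \<exists>c.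
        func c (elts (succ m)) (configs k s) \<and>
        initial_config n (app c zero) \<and>
        (\<forall>i\<in>elts m. step d y (app c i) (app c (succ i))) \<and>
        (\<exists>h t. app c m = triple r h t))"

definition turing_le :: "'v \<Rightarrow> 'v \<Rightarrow> bool" where
  "turing_le x y \<longleftrightarrow>
     is_real x \<and> is_real y \<and>
     (\<exists>k s d. oracle_machine k s d \<and>
        (\<forall>n\<in>elts omega. machine_output k s d y n (app x n)))"

definition turing_equiv :: "'v \<Rightarrow> 'v \<Rightarrow> bool" where
  "turing_equiv x y \<longleftrightarrow> turing_le x y \<and> turing_le y x"

definition turing_invariant :: "'v \<Rightarrow> bool" where
  "turing_invariant a \<longleftrightarrow> (\<forall>x\<in>elts a. \<forall>y. turing_equiv y x \<longrightarrow> y \<in> elts a)"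

end


subsection \<open>Models of ZF + DC\<close>

locale zf_dc = membership mem for mem :: "'v \<Rightarrow> 'v \<Rightarrow> bool" +
  assumes extensionality: "elts a = elts b \<Longrightarrow> a = b"
    and foundation: "elts a \<noteq> {} \<Longrightarrow> \<exists>x\<in>elts a. elts x \<inter> elts a = {}"
    and pairing: "\<exists>c. elts c = {a, b}"
    and union: "\<exists>b. elts b = (\<Union>x\<in>elts a. elts x)"
    and power_set: "\<exists>b. elts b = {x. elts x \<subseteq> elts a}"
    and infinity:
      "\<exists>i. (\<exists>z\<in>elts i. elts z = {}) \<and>
           (\<forall>x\<in>elts i. \<exists>y\<in>elts i. elts y = insert x (elts x))"
    and separation:
      "\<exists>b. elts b = {x \<in> elts a. sat mem (case_nat x env) \<phi>}"
    and replacement: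
      "(\<And>x. x \<in> elts a \<Longrightarrow> \<exists>!y. sat mem (case_nat x (case_nat y env)) \<phi>) \<Longrightarrow>
       \<exists>b. elts b = {y. \<exists>x\<in>elts a. sat mem (case_nat x (case_nat y env)) \<phi>}"
    and dependent_choice:
      "elts a \<noteq> {} \<Longrightarrow> (\<And>x. x \<in> elts a \<Longrightarrow> \<exists>y\<in>elts a. opair x y \<in> elts r) \<Longrightarrow>
       \<exists>f. func f (elts omega) (elts a) \<and>
           (\<forall>n\<in>elts omega. opair (app f n) (app f (succ n)) \<in> elts r)"
begin

lemma the_elts: "elts a = X \<Longrightarrow> elts (THE z. elts z = X) = X"
  by (rule theI2[where a = a]) (auto intro: extensionality)

lemma elts_zero: "elts zero = {}"
proof -
  obtain z where "elts z = {}" using infinity by blast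
  then show ?thesis unfolding zero_def by (rule the_elts)
qed

lemma elts_upair: "elts (upair a b) = {a, b}"
  unfolding upair_def using pairing[of a b] the_elts by blast

lemma opair_inject: "opair a b = opair c d \<longleftrightarrow> a = c \<and> b = d"
proof
  assume "opair a b = opair c d"
  then have "elts ` elts (opair a b) = elts ` elts (opair c d)"
    by simp
  then have "{{a}, {a, b}} = {{c}, {c, d}}"
    by (simp add: opair_def elts_upair)
  then show "a = c \<and> b = d"
    by (metis doubleton_eq_iff insert_absorb2)
qed simp

lemma elts_succ: "elts (succ a) = insert a (elts a)"
proof -
  obtain c where c: "elts c = (\<Union>x\<in>elts (upair a (upair a a)). elts x)"
    using union by blast
  then have "elts c = insert a (elts a)"
    by (auto simp: elts_upair)
  then show ?thesis unfolding succ_def by (rule the_elts)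
qed

lemma omega:
  "is_inductive omega" "\<And>i. is_inductive i \<Longrightarrow> elts omega \<subseteq> elts i"
proof -
  define imp where "imp = (\<lambda>\<phi> \<psi>. Neg (And \<phi> (Neg \<psi>)))"
  define ex where "ex = (\<lambda>\<phi>. Neg (Forall (Neg \<phi>)))"
  have imp: "sat mem e (imp \<phi> \<psi>) \<longleftrightarrow> (sat mem e \<phi> \<longrightarrow> sat mem e \<psi>)" for e \<phi> \<psi>
    by (simp add: imp_def)
  have ex: "sat mem e (ex \<phi>) \<longleftrightarrow> (\<exists>x. sat mem (case_nat x e) \<phi>)" for e \<phi>
    by (simp add: ex_def)
  define sucfm where
    "sucfm = And (Forall (imp (Member 0 1) (imp (Neg (Member 0 2)) (Equal 0 2))))
                 (And (Forall (imp (Member 0 2) (Member 0 1))) (Member 1 0))"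
  define indfm where
    "indfm = And (ex (And (Member 0 1) (Forall (Neg (Member 0 1)))))
                 (Forall (imp (Member 0 1) (ex (And (Member 0 2) sucfm))))"
  define natfm where "natfm = Forall (imp indfm (Member 1 0))"
  have zero_iff: "(\<forall>w. \<not> mem w z) \<longleftrightarrow> z = zero" for z
    using elts_zero extensionality[of z zero] by (auto simp: elts_def)
  have sucfm: "sat mem (case_nat y (case_nat x e)) sucfm \<longleftrightarrow> y = succ x" for x y e
  proof -
    have "sat mem (case_nat y (case_nat x e)) sucfm \<longleftrightarrow> elts y = insert x (elts x)"
      by (auto simp: sucfm_def imp elts_def numeral_2_eq_2)
    also have "\<dots> \<longleftrightarrow> y = succ x"
      using elts_succ[of x] extensionality[of y "succ x"] by auto
    finally show ?thesis .
  qed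
  have indfm: "sat mem (case_nat i e) indfm \<longleftrightarrow> is_inductive i" for i e
    by (simp add: indfm_def imp ex sucfm zero_iff is_inductive_def elts_def numeral_2_eq_2)
  have natfm: "sat mem (case_nat x e) natfm \<longleftrightarrow> (\<forall>i. is_inductive i \<longrightarrow> x \<in> elts i)" for x e
    by (simp add: natfm_def imp indfm elts_def)
  obtain i z where z: "z \<in> elts i" "elts z = {}"
    and suc: "\<And>x. x \<in> elts i \<Longrightarrow> \<exists>y\<in>elts i. elts y = insert x (elts x)"
    using infinity by blast
  have "z = zero"
    by (rule extensionality) (simp add: z elts_zero)
  moreover have "succ x \<in> elts i" if "x \<in> elts i" for x
  proof -
    obtain y where y: "y \<in> elts i" "elts y = insert x (elts x)"
      using suc[OF \<open>x \<in> elts i\<close>] by blast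
    then have "y = succ x"
      by (intro extensionality) (simp add: elts_succ)
    with y show ?thesis by simp
  qed
  ultimately have i: "is_inductive i"
    using z by (simp add: is_inductive_def)
  obtain w where "elts w = {x \<in> elts i. sat mem (case_nat x (\<lambda>_. i)) natfm}"
    using separation by blast
  then have w: "elts w = {x. \<forall>i. is_inductive i \<longrightarrow> x \<in> elts i}"
    unfolding natfm using i by blast
  have ind: "is_inductive w"
    unfolding is_inductive_def w by (auto simp: is_inductive_def)
  have least: "elts w \<subseteq> elts i" if "is_inductive i" for i
    unfolding w using that by blast
  have "omega = w"
    unfolding omega_def
  proof (rule the_equality)
    show "is_inductive w \<and> (\<forall>i. is_inductive i \<longrightarrow> elts w \<subseteq> elts i)"
      using ind least by blast
  next
    fix v assume v: "is_inductive v \<and> (\<forall>i. is_inductive i \<longrightarrow> elts v \<subseteq> elts i)"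
    show "v = w"
      by (rule extensionality) (use v ind least in blast)
  qed
  then show "is_inductive omega" "\<And>i. is_inductive i \<Longrightarrow> elts omega \<subseteq> elts i"
    using ind least by auto
qed

lemma app_eq_iff:
  assumes "func f A B" "x \<in> A"
  shows "app f x = y \<longleftrightarrow> opair x y \<in> elts f"
proof -
  have "\<exists>!y. opair x y \<in> elts f"
    using assms by (simp add: func_def)
  then show ?thesis
    unfolding app_def using theI'[of "\<lambda>y. opair x y \<in> elts f"] by blast
qed

end

end

theory Submission
  imports Defs
begin

text \<open>
  Fix a countable set \<open>M\<close> of partial continuous functionals that contains those of all oracle
  machines and is closed under composition; the relation \<open>\<exists>F\<in>M. F y = x\<close> is then a preorder extending
  Turing reducibility, and no machines have to be composed. A generic construction yields a
  continuous embedding \<open>h\<close> of the Cantor space such that distinct values of \<open>h\<close> are incomparable in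
  this preorder and such that on the range of \<open>h\<close> each question ``is \<open>F y n\<close> defined?'' is decided by a
  bounded number of bits of \<open>y\<close>.

  Given a set \<open>A\<close> of reals, let \<open>B\<close> consist of the reals equivalent to some \<open>h a\<close> with \<open>a \<in> A\<close>. It is
  Turing invariant, and \<open>A\<close> is countable if \<open>B\<close> is. If \<open>B\<close> has a perfect subset \<open>Q\<close>, then by the Baire
  category theorem there are \<open>F\<close> and \<open>G\<close> in \<open>M\<close> such that the \<open>y \<in> Q\<close> with \<open>F y = h x\<close> and \<open>G (h x) = y\<close>
  for some \<open>x\<close> are dense in a nonempty open part of \<open>Q\<close>. The set of these \<open>x\<close> is closed because the
  domains of \<open>G\<close> and \<open>F \<circ> G\<close> are relatively closed in the range of \<open>h\<close>; it has no isolated points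
  because \<open>Q\<close> has none; and it is contained in \<open>A\<close> by incomparability.
\<close>

text \<open>Saturating \<open>A\<close> itself under Turing equivalence would not do: a point of
  \<open>A\<close> equivalent to a given point of a perfect set is not unique, and a limit of such
  points may be another real of the same degree, outside \<open>A\<close>. Copying \<open>A\<close>
  onto pairwise incomparable reals makes the decoding unique. Moreover, the reals on which a
  functional is total form in general only a G-delta set, which is why the construction also decides
  convergence by finitely many bits. \<open>h x\<close> is spliced blockwise from two generic reals,
  one for each value of a bit of \<open>x\<close>; the blocks below a given one are then arbitrary
  mixtures, so a requirement has to be met by its block alone.

  Separation and replacement hold for first-order formulas with parameters only, and
  \<open>omega\<close> may be nonstandard as seen from HOL. Hence set formations and inductions come
  with proofs of definability, and recursion in HOL does not build the sequences of the model.
  Dependent choice does this: for the enumerations, the generic pair and the category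
  argument.\<close>

primrec rename :: "(nat \<Rightarrow> nat) \<Rightarrow> fm \<Rightarrow> fm" where
  "rename f (Member i j) = Member (f i) (f j)"
| "rename f (Equal i j) = Equal (f i) (f j)"
| "rename f (Neg \<phi>) = Neg (rename f \<phi>)"
| "rename f (And \<phi> \<psi>) = And (rename f \<phi>) (rename f \<psi>)"
| "rename f (Forall \<phi>) = Forall (rename (case_nat 0 (\<lambda>i. Suc (f i))) \<phi>)"

lemma sat_rename: "sat mem e (rename f \<phi>) \<longleftrightarrow> sat mem (\<lambda>i. e (f i)) \<phi>"
proof (induction \<phi> arbitrary: e f)
  case (Forall \<phi>)
  have "(\<lambda>i. case_nat x e (case_nat 0 (\<lambda>i. Suc (f i)) i)) = case_nat x (\<lambda>i. e (f i))" for x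
    by (rule ext) (simp split: nat.split)
  with Forall show ?case by simp
qed simp_all

text \<open>Arguments and parameters each keep infinitely many positions of one environment. No
  arities have to be tracked, and parameters can be added without disturbing the arguments.\<close>

definition interleave :: "(nat \<Rightarrow> 'v) \<Rightarrow> (nat \<Rightarrow> 'v) \<Rightarrow> nat \<Rightarrow> 'v" where
  "interleave e c i = (if even i then e (i div 2) else c (i div 2))"

lemma interleave_simps [simp]:
  "interleave e c (2 * i) = e i" "interleave e c (Suc (2 * i)) = c i"
  by (simp_all add: interleave_def)

named_theorems definable_intros

context zf_dc
begin

subsection \<open>Definability with parameters\<close>

text \<open>
  The even variables of the formula are the arguments, the odd ones carry the parameters.
\<close>

definition definable :: "((nat \<Rightarrow> 'v) \<Rightarrow> bool) \<Rightarrow> bool" where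
  "definable P \<longleftrightarrow> (\<exists>\<phi> c. \<forall>e. sat mem (interleave e c) \<phi> \<longleftrightarrow> P e)"

text \<open>The language has no function symbols: an operation on the model counts as definable when
  its graph is, with the value as argument 0.\<close>

definition definable_term :: "((nat \<Rightarrow> 'v) \<Rightarrow> 'v) \<Rightarrow> bool" where
  "definable_term t \<longleftrightarrow> definable (\<lambda>e. e 0 = t (\<lambda>i. e (Suc i)))"

lemma definable_cong: "definable P \<Longrightarrow> (\<And>e. P e \<longleftrightarrow> Q e) \<Longrightarrow> definable Q"
  by (simp add: definable_def)

lemma definable_subst:
  assumes "definable P"
  shows "definable (\<lambda>e. P (\<lambda>i. if b i then e (g i) else p i))"
proof -
  obtain \<phi> c where \<phi>: "\<And>e. sat mem (interleave e c) \<phi> \<longleftrightarrow> P e"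
    using assms by (auto simp: definable_def)
  define f where "f i = (if even i then if b (i div 2) then 2 * g (i div 2) else Suc (2 * i)
                         else Suc (2 * i))" for i
  have "(\<lambda>i. interleave e (interleave p c) (f i))
        = interleave (\<lambda>i. if b i then e (g i) else p i) c" for e
    by (rule ext) (auto simp: f_def interleave_def)
  then have "sat mem (interleave e (interleave p c)) (rename f \<phi>)
             \<longleftrightarrow> P (\<lambda>i. if b i then e (g i) else p i)" for e
    by (simp add: sat_rename \<phi>)
  then show ?thesis unfolding definable_def by blast
qed

lemma definable_rename: "definable P \<Longrightarrow> definable (\<lambda>e. P (\<lambda>i. e (g i)))"
  using definable_subst[of P "\<lambda>_. True" g] by simp

text \<open>Serves separation under a binder: all arguments except the bound variable become
  parameters.\<close>

lemma definable_fix: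
  assumes "definable P"
  shows "definable (\<lambda>e. P (case_nat (e 0) p))"
  by (rule definable_cong[OF definable_subst[OF assms, of "\<lambda>i. i = 0" "\<lambda>_. 0" "\<lambda>i. p (i - 1)"]],
      intro arg_cong[where f = P] ext) (simp split: nat.split)

lemma definable_not [definable_intros]: "definable P \<Longrightarrow> definable (\<lambda>e. \<not> P e)"
  unfolding definable_def by (metis sat.simps(3))

lemma definable_conj [definable_intros]:
  assumes "definable P" "definable Q"
  shows "definable (\<lambda>e. P e \<and> Q e)"
proof -
  obtain \<phi> c where \<phi>: "\<And>e. sat mem (interleave e c) \<phi> \<longleftrightarrow> P e"
    using assms by (auto simp: definable_def)
  obtain \<psi> d where \<psi>: "\<And>e. sat mem (interleave e d) \<psi> \<longleftrightarrow> Q e"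
    using assms by (auto simp: definable_def)
  define f where "f i = (if even i then i else Suc (2 * (i - 1)))" for i :: nat
  define g where "g i = (if even i then i else Suc (2 * i))" for i :: nat
  have f: "(\<lambda>i. interleave e (interleave c d) (f i)) = interleave e c" for e
    by (rule ext) (auto simp: f_def interleave_def elim!: oddE)
  have g: "(\<lambda>i. interleave e (interleave c d) (g i)) = interleave e d" for e
    by (rule ext) (auto simp: g_def interleave_def elim!: oddE)
  have "sat mem (interleave e (interleave c d)) (And (rename f \<phi>) (rename g \<psi>)) \<longleftrightarrow> P e \<and> Q e" for e
    by (simp add: sat_rename f g \<phi> \<psi>)
  then show ?thesis unfolding definable_def by blast
qed

lemma definable_all [definable_intros]:
  assumes "definable (\<lambda>e. P (\<lambda>i. e (Suc i)) (e 0))"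
  shows "definable (\<lambda>e. \<forall>x. P e x)"
proof -
  obtain \<phi> c where \<phi>: "\<And>e. sat mem (interleave e c) \<phi> \<longleftrightarrow> P (\<lambda>i. e (Suc i)) (e 0)"
    using assms by (auto simp: definable_def)
  \<comment> \<open>The binder inserts a single variable in front, whereas a new argument shifts the
    even positions by two and leaves the odd ones in place; \<open>f\<close> reconciles the
    two.\<close>
  define f where "f i = (if i = 0 then 0 else if even i then i - 1 else Suc i)" for i :: nat
  have "(\<lambda>i. case_nat x (interleave e c) (f i)) = interleave (case_nat x e) c" for e x
  proof (rule ext)
    fix i
    consider "i = 0" | j where "i = Suc (2 * j)" | j where "i = Suc (Suc (2 * j))"
    proof (cases i)
      case (Suc k)
      then show thesis using that by (cases "even k") (auto elim!: evenE oddE)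
    qed
    then show "case_nat x (interleave e c) (f i) = interleave (case_nat x e) c i"
      by cases (simp_all add: f_def interleave_def)
  qed
  then have "sat mem (interleave e c) (Forall (rename f \<phi>)) \<longleftrightarrow> (\<forall>x. P e x)" for e
    by (simp add: sat_rename \<phi>)
  then show ?thesis unfolding definable_def by blast
qed

lemma definable_or [definable_intros]:
  "definable P \<Longrightarrow> definable Q \<Longrightarrow> definable (\<lambda>e. P e \<or> Q e)"
  by (rule definable_cong[of "\<lambda>e. \<not> (\<not> P e \<and> \<not> Q e)"]) ((intro definable_intros; assumption), blast)

lemma definable_imp [definable_intros]:
  "definable P \<Longrightarrow> definable Q \<Longrightarrow> definable (\<lambda>e. P e \<longrightarrow> Q e)"
  by (rule definable_cong[of "\<lambda>e. \<not> (P e \<and> \<not> Q e)"]) ((intro definable_intros; assumption), blast)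

lemma definable_iff [definable_intros]:
  "definable P \<Longrightarrow> definable Q \<Longrightarrow> definable (\<lambda>e. P e \<longleftrightarrow> Q e)"
  by (rule definable_cong[of "\<lambda>e. (P e \<longrightarrow> Q e) \<and> (Q e \<longrightarrow> P e)"]) ((intro definable_intros; assumption), blast)

lemma definable_ex [definable_intros]:
  "definable (\<lambda>e. P (\<lambda>i. e (Suc i)) (e 0)) \<Longrightarrow> definable (\<lambda>e. \<exists>x. P e x)"
  by (rule definable_cong[of "\<lambda>e. \<not> (\<forall>x. \<not> P e x)"]) ((intro definable_intros; assumption), blast)

lemma definable_var_eq: "definable (\<lambda>e. e i = e j)"
  unfolding definable_def
  by (rule exI[of _ "Equal (2 * i) (2 * j)"]) simp

lemma definable_var_mem: "definable (\<lambda>e. mem (e i) (e j))"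
  unfolding definable_def
  by (rule exI[of _ "Member (2 * i) (2 * j)"]) simp

lemma definable_term_var [definable_intros]: "definable_term (\<lambda>e. e n)"
  unfolding definable_term_def by (rule definable_var_eq)

lemma definable_term_const [definable_intros]: "definable_term (\<lambda>e. p)"
  unfolding definable_term_def definable_def
  by (rule exI[of _ "Equal 0 1"], rule exI[of _ "\<lambda>_. p"])
     (use interleave_simps(1)[where i = 0] interleave_simps(2)[where i = 0] in \<open>simp add: interleave_def\<close>)

lemma definable_const [definable_intros]: "definable (\<lambda>e. b)"
proof (cases b)
  case True
  then show ?thesis by (intro definable_cong[OF definable_var_eq[of 0 0]]) simp
next
  case False
  then show ?thesis
    by (intro definable_cong[OF definable_not[OF definable_var_eq[of 0 0]]]) simp
qed

lemma definable_term_rename: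
  assumes "definable_term t"
  shows "definable_term (\<lambda>e. t (\<lambda>i. e (g i)))"
proof -
  show ?thesis
    using definable_rename[OF assms[unfolded definable_term_def], of "case_nat 0 (\<lambda>i. Suc (g i))"]
    by (simp add: definable_term_def)
qed

text \<open>Composition with a term is eliminated in the usual way: an existentially quantified
  variable holds its value.\<close>

lemma definable_let:
  assumes "definable (\<lambda>e. P (\<lambda>i. e (Suc i)) (e 0))" "definable_term t"
  shows "definable (\<lambda>e. P e (t e))"
  by (rule definable_cong[of "\<lambda>e. \<exists>x. x = t e \<and> P e x"])
     ((intro definable_ex definable_conj assms(1) assms(2)[unfolded definable_term_def]), blast)

lemma definable_term_let:
  assumes "definable_term (\<lambda>e. s (\<lambda>i. e (Suc i)) (e 0))" "definable_term t"
  shows "definable_term (\<lambda>e. s e (t e))"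
  unfolding definable_term_def
proof (rule definable_let[where P = "\<lambda>e x. e 0 = s (\<lambda>i. e (Suc i)) x"])
  show "definable (\<lambda>e. e (Suc 0) = s (\<lambda>i. e (Suc (Suc i))) (e 0))"
    using definable_rename[OF assms(1)[unfolded definable_term_def],
        of "\<lambda>i. if i = 0 then 1 else if i = 1 then 0 else i"] by simp
  show "definable_term (\<lambda>e. t (\<lambda>i. e (Suc i)))"
    by (rule definable_term_rename) (rule assms)
qed

lemma definable_comp1:
  assumes "definable (\<lambda>e. P (e 0))" "definable_term t"
  shows "definable (\<lambda>e. P (t e))"
  by (rule definable_let) (use assms in auto)

lemma definable_comp2:
  assumes "definable (\<lambda>e. P (e 0) (e 1))" "definable_term t" "definable_term u"
  shows "definable (\<lambda>e. P (t e) (u e))"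
  apply (rule definable_let[where P = "\<lambda>e x. P x (u e)", OF _ assms(2)])
  apply (rule definable_let[where P = "\<lambda>e x. P (e 0) x", OF _ definable_term_rename[OF assms(3)]])
  \<comment> \<open>Each substitution pushes the earlier variables up by one, so the arguments
    arrive in reverse order.\<close>
  using definable_rename[OF assms(1), of "(!) [1, 0]"] by simp

lemma definable_comp3:
  assumes "definable (\<lambda>e. P (e 0) (e 1) (e 2))" "definable_term t" "definable_term u" "definable_term v"
  shows "definable (\<lambda>e. P (t e) (u e) (v e))"
  apply (rule definable_let[where P = "\<lambda>e x. P x (u e) (v e)", OF _ assms(2)])
  apply (rule definable_let[where P = "\<lambda>e x. P (e 0) x (v (\<lambda>i. e (Suc i)))", OF _ definable_term_rename[OF assms(3)]])
  apply (rule definable_let[where P = "\<lambda>e x. P (e 1) (e 0) x", OF _ definable_term_rename[OF assms(4), of "\<lambda>i. Suc (Suc i)"], simplified])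
  using definable_rename[OF assms(1), of "(!) [2, 1, 0]"] by (simp add: numeral_2_eq_2)

lemma definable_comp4:
  assumes "definable (\<lambda>e. P (e 0) (e 1) (e 2) (e 3))"
    "definable_term t" "definable_term u" "definable_term v" "definable_term w"
  shows "definable (\<lambda>e. P (t e) (u e) (v e) (w e))"
  apply (rule definable_let[where P = "\<lambda>e x. P x (u e) (v e) (w e)", OF _ assms(2)])
  apply (rule definable_let[where P = "\<lambda>e x. P (e 0) x (v (\<lambda>i. e (Suc i))) (w (\<lambda>i. e (Suc i)))",
      OF _ definable_term_rename[OF assms(3)]])
  apply (rule definable_let[where P = "\<lambda>e x. P (e 1) (e 0) x (w (\<lambda>i. e (Suc (Suc i))))",
      OF _ definable_term_rename[OF assms(4), of "\<lambda>i. Suc (Suc i)"], simplified])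
  apply (rule definable_let[where P = "\<lambda>e x. P (e (Suc (Suc 0))) (e 1) (e 0) x",
      OF _ definable_term_rename[OF assms(5), of "\<lambda>i. Suc (Suc (Suc i))"], simplified])
  using definable_rename[OF assms(1), of "(!) [3, 2, 1, 0]"]
  by (simp add: numeral_2_eq_2 numeral_3_eq_3)

lemma definable_term_comp1:
  assumes "definable_term (\<lambda>e. f (e 0))" "definable_term t"
  shows "definable_term (\<lambda>e. f (t e))"
  by (rule definable_term_let) (use assms in auto)

lemma definable_term_comp2:
  assumes "definable_term (\<lambda>e. f (e 0) (e 1))" "definable_term t" "definable_term u"
  shows "definable_term (\<lambda>e. f (t e) (u e))"
  unfolding definable_term_def
  by (rule definable_comp3[where P = "\<lambda>z x y. z = f x y"])
     (use assms definable_term_rename[of _ Suc] in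
      \<open>simp_all add: definable_term_def definable_var_eq numeral_2_eq_2\<close>)

lemma definable_term_comp3:
  assumes "definable_term (\<lambda>e. f (e 0) (e 1) (e 2))"
    "definable_term t" "definable_term u" "definable_term v"
  shows "definable_term (\<lambda>e. f (t e) (u e) (v e))"
  unfolding definable_term_def
  by (rule definable_comp4[where P = "\<lambda>z x y w. z = f x y w"])
     (use assms definable_term_rename[of _ Suc] in
      \<open>simp_all add: definable_term_def definable_var_eq numeral_2_eq_2 numeral_3_eq_3\<close>)

lemmas definable_eq [definable_intros] =
  definable_comp2[where P = "(=)", OF definable_var_eq]

lemma definable_in_elts [definable_intros]:
  "definable_term t \<Longrightarrow> definable_term u \<Longrightarrow> definable (\<lambda>e. t e \<in> elts (u e))"
  using definable_comp2[where P = mem, OF definable_var_mem] by (simp add: elts_def)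

lemma definable_ball [definable_intros]:
  assumes "definable_term t" "definable (\<lambda>e. P (\<lambda>i. e (Suc i)) (e 0))"
  shows "definable (\<lambda>e. \<forall>x\<in>elts (t e). P e x)"
  unfolding Ball_def
  by (intro definable_intros assms(2) definable_term_rename[OF assms(1)])

lemma definable_bex [definable_intros]:
  assumes "definable_term t" "definable (\<lambda>e. P (\<lambda>i. e (Suc i)) (e 0))"
  shows "definable (\<lambda>e. \<exists>x\<in>elts (t e). P e x)"
  unfolding Bex_def
  by (intro definable_intros assms(2) definable_term_rename[OF assms(1)])

lemma definable_ex1 [definable_intros]:
  assumes "definable (\<lambda>e. P (\<lambda>i. e (Suc i)) (e 0))"
  shows "definable (\<lambda>e. \<exists>!x. P e x)"
  unfolding Ex1_def
  apply (intro definable_intros assms)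
  using definable_rename[OF assms, of "\<lambda>i. if i = 0 then 0 else Suc i"] by simp

lemma definable_subset_elts [definable_intros]:
  assumes "definable_term t" "definable_term u"
  shows "definable (\<lambda>e. elts (t e) \<subseteq> elts (u e))"
  unfolding subset_iff
  by (intro definable_intros definable_term_rename[OF assms(1)] definable_term_rename[OF assms(2)])

lemma definable_termI:
  assumes "definable (\<lambda>e. P (e 0) (\<lambda>i. e (Suc i)))" "\<And>z e. z = t e \<longleftrightarrow> P z e"
  shows "definable_term t"
  unfolding definable_term_def assms(2) by (rule assms(1))

lemma definable_term_if [definable_intros]:
  assumes "definable P" "definable_term t" "definable_term u"
  shows "definable_term (\<lambda>e. if P e then t e else u e)"
  apply (rule definable_termI[where P = "\<lambda>z e. (P e \<longrightarrow> z = t e) \<and> (\<not> P e \<longrightarrow> z = u e)"])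
   apply (intro definable_intros definable_rename[OF assms(1)] definable_term_rename[OF assms(2)]
      definable_term_rename[OF assms(3)])
  by auto

subsection \<open>Basic set operations\<close>

lemma separation_definable:
  assumes "definable (\<lambda>e. P (e 0))"
  shows "\<exists>b. elts b = {x \<in> elts a. P x}"
proof -
  obtain \<phi> c where \<phi>: "\<And>e. sat mem (interleave e c) \<phi> \<longleftrightarrow> P (e 0)"
    using assms by (auto simp: definable_def)
  define f where "f i = (if even i then 0 else Suc (i div 2))" for i :: nat
  have "(\<lambda>i. case_nat x c (f i)) = interleave (\<lambda>_. x) c" for x
    by (rule ext) (simp add: f_def interleave_def)
  then have "sat mem (case_nat x c) (rename f \<phi>) \<longleftrightarrow> P x" for x
    by (simp add: sat_rename \<phi>)
  with separation[of a c "rename f \<phi>"] show ?thesis by simp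
qed

lemma replacement_definable:
  assumes "definable_term (\<lambda>e. f (e 0))"
  shows "\<exists>b. elts b = f ` elts a"
proof -
  obtain \<phi> c where \<phi>: "\<And>e. sat mem (interleave e c) \<phi> \<longleftrightarrow> e 0 = f (e (Suc 0))"
    using assms by (auto simp: definable_term_def definable_def)
  define g where "g i = (if i = 0 then 1 else if even i then 0 else Suc (Suc (i div 2)))" for i :: nat
  have "(\<lambda>i. case_nat x (case_nat y c) (g i)) = interleave (\<lambda>i. if i = 0 then y else x) c" for x y
    by (rule ext) (auto simp: g_def interleave_def elim!: evenE)
  then have "sat mem (case_nat x (case_nat y c)) (rename g \<phi>) \<longleftrightarrow> y = f x" for x y
    by (simp add: sat_rename \<phi>)
  with replacement[of a c "rename g \<phi>"] show ?thesis by (auto simp: image_def)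
qed

text \<open>The description denotes the intended subset when \<open>P\<close> is definable; for an
  arbitrary predicate of HOL the model may contain no such set. The same caveat applies to
  \<open>img\<close>.\<close>

definition sep :: "'v \<Rightarrow> ('v \<Rightarrow> bool) \<Rightarrow> 'v" where
  "sep a P = (THE z. elts z = {x \<in> elts a. P x})"

lemma elts_sep: "definable (\<lambda>e. P (e 0)) \<Longrightarrow> elts (sep a P) = {x \<in> elts a. P x}"
  unfolding sep_def using separation_definable the_elts by blast

definition img :: "'v \<Rightarrow> ('v \<Rightarrow> 'v) \<Rightarrow> 'v" where
  "img a f = (THE z. elts z = f ` elts a)"

lemma elts_img: "definable_term (\<lambda>e. f (e 0)) \<Longrightarrow> elts (img a f) = f ` elts a"
  unfolding img_def using replacement_definable the_elts by blast

lemma eq_iff_elts: "a = b \<longleftrightarrow> (\<forall>x. x \<in> elts a \<longleftrightarrow> x \<in> elts b)"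
  using extensionality by auto

lemma definable_term_sep [definable_intros]:
  assumes "definable_term t" and P: "definable (\<lambda>e. P (\<lambda>i. e (Suc i)) (e 0))"
  shows "definable_term (\<lambda>e. sep (t e) (\<lambda>x. P e x))"
proof (rule definable_termI[where P = "\<lambda>z e. \<forall>x. x \<in> elts z \<longleftrightarrow> x \<in> elts (t e) \<and> P e x"])
  show "definable (\<lambda>e. \<forall>x. x \<in> elts (e 0) \<longleftrightarrow> x \<in> elts (t (\<lambda>i. e (Suc i))) \<and> P (\<lambda>i. e (Suc i)) x)"
    apply (intro definable_intros definable_term_rename[OF assms(1)])
    using definable_rename[OF P, of "\<lambda>i. if i = 0 then 0 else Suc i"] by simp
  have "definable (\<lambda>e'. P e (e' 0))" for e
    using definable_fix[OF P, of e] by simp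
  then show "z = sep (t e) (\<lambda>x. P e x) \<longleftrightarrow> (\<forall>x. x \<in> elts z \<longleftrightarrow> x \<in> elts (t e) \<and> P e x)" for z e
    unfolding eq_iff_elts[of z] by (simp add: elts_sep)
qed

lemma definable_term_img [definable_intros]:
  assumes "definable_term t" and f: "definable_term (\<lambda>e. f (\<lambda>i. e (Suc i)) (e 0))"
  shows "definable_term (\<lambda>e. img (t e) (\<lambda>x. f e x))"
proof (rule definable_termI[where P = "\<lambda>z e. \<forall>y. y \<in> elts z \<longleftrightarrow> (\<exists>x\<in>elts (t e). y = f e x)"])
  show "definable (\<lambda>e. \<forall>y. y \<in> elts (e 0) \<longleftrightarrow>
      (\<exists>x\<in>elts (t (\<lambda>i. e (Suc i))). y = f (\<lambda>i. e (Suc i)) x))"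
    apply (intro definable_intros definable_term_rename[OF assms(1)])
    using definable_term_rename[OF f, of "\<lambda>i. if i = 0 then 0 else Suc (Suc i)"] by simp
  have "definable_term (\<lambda>e'. f e (e' 0))" for e
    unfolding definable_term_def
    using definable_subst[OF f[unfolded definable_term_def], of "\<lambda>i. i < 2" id "\<lambda>i. e (i - 2)"]
    by (simp add: numeral_2_eq_2)
  then show "z = img (t e) (\<lambda>x. f e x) \<longleftrightarrow> (\<forall>y. y \<in> elts z \<longleftrightarrow> (\<exists>x\<in>elts (t e). y = f e x))" for z e
    unfolding eq_iff_elts[of z] by (auto simp add: elts_img)
qed

lemma definable_term_upair0: "definable_term (\<lambda>e. upair (e 0) (e 1))"
  apply (rule definable_termI[where P = "\<lambda>z e. \<forall>x. x \<in> elts z \<longleftrightarrow> x = e 0 \<or> x = e 1"])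
   apply (intro definable_intros)
  unfolding eq_iff_elts[of _ "upair _ _"] by (simp add: elts_upair)

lemmas definable_term_upair [definable_intros] = definable_term_comp2[OF definable_term_upair0]

lemma definable_term_opair [definable_intros]:
  "definable_term t \<Longrightarrow> definable_term u \<Longrightarrow> definable_term (\<lambda>e. opair (t e) (u e))"
  unfolding opair_def by (intro definable_intros)

lemma definable_term_triple [definable_intros]:
  "definable_term t \<Longrightarrow> definable_term u \<Longrightarrow> definable_term v \<Longrightarrow>
   definable_term (\<lambda>e. triple (t e) (u e) (v e))"
  unfolding triple_def by (intro definable_intros)

lemma definable_term_succ0: "definable_term (\<lambda>e. succ (e 0))"
  apply (rule definable_termI[where P = "\<lambda>z e. \<forall>x. x \<in> elts z \<longleftrightarrow> x = e 0 \<or> x \<in> elts (e 0)"])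
   apply (intro definable_intros)
  unfolding eq_iff_elts[of _ "succ _"] by (simp add: elts_succ)

lemmas definable_term_succ [definable_intros] = definable_term_comp1[OF definable_term_succ0]

lemma triple_inject: "triple a b c = triple a' b' c' \<longleftrightarrow> a = a' \<and> b = b' \<and> c = c'"
  by (simp add: triple_def opair_inject)

definition Union_of :: "'v \<Rightarrow> 'v" where
  "Union_of a = (THE z. elts z = (\<Union>x\<in>elts a. elts x))"

lemma elts_Union_of: "elts (Union_of a) = (\<Union>x\<in>elts a. elts x)"
  unfolding Union_of_def using union[of a] the_elts by blast

definition pow :: "'v \<Rightarrow> 'v" where
  "pow a = (THE z. elts z = {x. elts x \<subseteq> elts a})"

lemma elts_pow: "elts (pow a) = {x. elts x \<subseteq> elts a}"
  unfolding pow_def using power_set[of a] the_elts by blast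

definition join :: "'v \<Rightarrow> 'v \<Rightarrow> 'v" where
  "join a b = Union_of (upair a b)"

lemma elts_join: "elts (join a b) = elts a \<union> elts b"
  by (auto simp: join_def elts_Union_of elts_upair)

lemma definable_term_join0: "definable_term (\<lambda>e. join (e 0) (e 1))"
  apply (rule definable_termI[where P = "\<lambda>z e. \<forall>x. x \<in> elts z \<longleftrightarrow> x \<in> elts (e 0) \<or> x \<in> elts (e 1)"])
   apply (intro definable_intros)
  unfolding eq_iff_elts[of _ "join _ _"] by (simp add: elts_join)

lemmas definable_term_join [definable_intros] = definable_term_comp2[OF definable_term_join0]

definition times :: "'v \<Rightarrow> 'v \<Rightarrow> 'v" where
  "times a b = Union_of (img a (\<lambda>x. img b (\<lambda>y. opair x y)))"

lemma elts_times: "elts (times a b) = {opair x y | x y. x \<in> elts a \<and> y \<in> elts b}"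
proof -
  have 1: "definable_term (\<lambda>e. img b (opair (e 0)))" by (intro definable_intros)
  have 2: "definable_term (\<lambda>e. opair x (e 0))" for x by (intro definable_intros)
  show ?thesis
    unfolding times_def elts_Union_of elts_img[OF 1]
    by (auto simp: elts_img[OF 2])
qed

lemma opair_in_times [simp]: "opair x y \<in> elts (times a b) \<longleftrightarrow> x \<in> elts a \<and> y \<in> elts b"
  by (auto simp: elts_times opair_inject)

text \<open>The default \<open>zero\<close> makes the projection definable on the whole model, also
  off the pairs, where a bare description would be unspecified.\<close>

definition pr1 :: "'v \<Rightarrow> 'v" where
  "pr1 z = (if \<exists>x y. z = opair x y then THE x. \<exists>y. z = opair x y else zero)"

definition pr2 :: "'v \<Rightarrow> 'v" where
  "pr2 z = (if \<exists>x y. z = opair x y then THE y. \<exists>x. z = opair x y else zero)"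

lemma pr1_opair [simp]: "pr1 (opair x y) = x"
  by (auto simp: pr1_def opair_inject)

lemma pr2_opair [simp]: "pr2 (opair x y) = y"
  by (auto simp: pr2_def opair_inject)

lemma definable_term_pr1_0: "definable_term (\<lambda>e. pr1 (e 0))"
  apply (rule definable_termI[where P = "\<lambda>z e. (\<exists>y. e 0 = opair z y) \<or> \<not> (\<exists>x y. e 0 = opair x y) \<and> z = zero"])
   apply (intro definable_intros)
  by (metis pr1_opair pr1_def)

lemma definable_term_pr2_0: "definable_term (\<lambda>e. pr2 (e 0))"
  apply (rule definable_termI[where P = "\<lambda>z e. (\<exists>y. e 0 = opair y z) \<or> \<not> (\<exists>x y. e 0 = opair x y) \<and> z = zero"])
   apply (intro definable_intros)
  by (metis pr2_opair pr2_def)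

lemmas definable_term_pr1 [definable_intros] = definable_term_comp1[OF definable_term_pr1_0]
lemmas definable_term_pr2 [definable_intros] = definable_term_comp1[OF definable_term_pr2_0]

lemma timesE:
  assumes "z \<in> elts (times a b)"
  obtains x y where "z = opair x y" "x \<in> elts a" "y \<in> elts b"
  using assms by (auto simp: elts_times)

subsection \<open>Functions\<close>

text \<open>
  Off the domain of a function, \<^const>\<open>app\<close> is an unspecified and hence possibly undefinable
  description; this variant is definable everywhere.
\<close>

definition ap :: "'v \<Rightarrow> 'v \<Rightarrow> 'v" where
  "ap f x = (if \<exists>!y. opair x y \<in> elts f then THE y. opair x y \<in> elts f else zero)"

lemma definable_term_ap0: "definable_term (\<lambda>e. ap (e 0) (e 1))"
proof (rule definable_termI[where P = "\<lambda>z e. opair (e 1) z \<in> elts (e 0) \<and> (\<forall>y. opair (e 1) y \<in> elts (e 0) \<longrightarrow> y = z)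
     \<or> \<not> (\<exists>!y. opair (e 1) y \<in> elts (e 0)) \<and> z = zero"])
  show "z = ap (e 0) (e 1) \<longleftrightarrow>
         opair (e 1) z \<in> elts (e 0) \<and> (\<forall>y. opair (e 1) y \<in> elts (e 0) \<longrightarrow> y = z)
     \<or> \<not> (\<exists>!y. opair (e 1) y \<in> elts (e 0)) \<and> z = zero" for z :: 'v and e
  proof (cases "\<exists>!y. opair (e 1) y \<in> elts (e 0)")
    case True
    then have "opair (e 1) (ap (e 0) (e 1)) \<in> elts (e 0)"
      unfolding ap_def using theI'[OF True] by simp
    with True show ?thesis by auto
  qed (auto simp: ap_def)
qed (intro definable_intros)

lemmas definable_term_ap [definable_intros] = definable_term_comp2[OF definable_term_ap0]

lemma app_eq_ap: "func f A B \<Longrightarrow> x \<in> A \<Longrightarrow> app f x = ap f x"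
  by (auto simp: app_def ap_def func_def)

lemma ap_eq_iff: "func f A B \<Longrightarrow> x \<in> A \<Longrightarrow> ap f x = y \<longleftrightarrow> opair x y \<in> elts f"
  using app_eq_iff app_eq_ap by metis

lemma ap_in: "func f A B \<Longrightarrow> x \<in> A \<Longrightarrow> ap f x \<in> B"
  using ap_eq_iff[of f A B x "ap f x"] by (auto simp: func_def opair_inject)

lemma func_mono: "func f A B \<Longrightarrow> B \<subseteq> C \<Longrightarrow> func f A C"
  unfolding func_def by blast

lemma func_eqI:
  assumes "func f A B" "func g A C" "\<And>x. x \<in> A \<Longrightarrow> ap f x = ap g x"
  shows "f = g"
proof (rule extensionality)
  have "elts f = {opair x (ap f x) | x. x \<in> A}" if "func f A B" for f B
    using ap_eq_iff[OF that] that unfolding func_def by blast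
  from this[OF assms(1)] this[OF assms(2)] assms(3) show "elts f = elts g"
    by (auto simp: opair_inject)
qed

definition lam :: "'v \<Rightarrow> ('v \<Rightarrow> 'v) \<Rightarrow> 'v" where
  "lam a f = img a (\<lambda>x. opair x (f x))"

lemma elts_lam:
  "definable_term (\<lambda>e. f (e 0)) \<Longrightarrow> elts (lam a f) = {opair x (f x) | x. x \<in> elts a}"
  unfolding lam_def by (subst elts_img) (auto intro!: definable_intros)

lemma func_lam:
  assumes "definable_term (\<lambda>e. f (e 0))" "\<And>x. x \<in> elts a \<Longrightarrow> f x \<in> B"
  shows "func (lam a f) (elts a) B"
  unfolding func_def elts_lam[OF assms(1)] using assms(2) by (auto simp: opair_inject)

lemma ap_lam: "definable_term (\<lambda>e. f (e 0)) \<Longrightarrow> x \<in> elts a \<Longrightarrow> ap (lam a f) x = f x"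
  using ap_eq_iff[OF func_lam[of f a UNIV], of x "f x"] by (auto simp: elts_lam)

lemma definable_term_lam [definable_intros]:
  assumes "definable_term t" "definable_term (\<lambda>e. f (\<lambda>i. e (Suc i)) (e 0))"
  shows "definable_term (\<lambda>e. lam (t e) (\<lambda>x. f e x))"
  unfolding lam_def by (intro definable_intros assms)

lemma func_elts_iff:
  "func f (elts a) (elts b) \<longleftrightarrow>
     (\<forall>z\<in>elts f. \<exists>x\<in>elts a. \<exists>y\<in>elts b. z = opair x y) \<and> (\<forall>x\<in>elts a. \<exists>!y. opair x y \<in> elts f)"
  unfolding func_def by blast

lemma definable_func0: "definable (\<lambda>e. func (e 0) (elts (e 1)) (elts (e 2)))"
  unfolding func_elts_iff by (intro definable_intros)

lemmas definable_func [definable_intros] =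
  definable_comp3[where P = "\<lambda>f a b. func f (elts a) (elts b)", OF definable_func0]

definition Fn :: "'v \<Rightarrow> 'v \<Rightarrow> 'v" where
  "Fn a b = sep (pow (times a b)) (\<lambda>f. func f (elts a) (elts b))"

lemma elts_Fn: "elts (Fn a b) = {f. func f (elts a) (elts b)}"
proof -
  have *: "definable (\<lambda>e. func (e 0) (elts a) (elts b))" by (intro definable_intros)
  show ?thesis
    unfolding Fn_def elts_sep[OF *] by (auto simp: elts_pow elts_times func_def)
qed

subsection \<open>Natural numbers\<close>

lemma zero_in_omega [simp]: "zero \<in> elts omega"
  and succ_in_omega: "n \<in> elts omega \<Longrightarrow> succ n \<in> elts omega"
  using omega(1) by (auto simp: is_inductive_def)

text \<open>The inductive set that catches \<open>n\<close> has to exist in the model, so it is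
  formed by separation. Induction is therefore limited to definable properties.\<close>

lemma omega_induct:
  assumes "n \<in> elts omega" "definable (\<lambda>e. P (e 0))" "P zero"
    "\<And>n. n \<in> elts omega \<Longrightarrow> P n \<Longrightarrow> P (succ n)"
  shows "P n"
proof -
  have "is_inductive (sep omega P)"
    using assms(3,4) by (simp add: is_inductive_def elts_sep[OF assms(2)] succ_in_omega)
  from omega(2)[OF this] assms(1) show ?thesis by (auto simp: elts_sep[OF assms(2)])
qed

lemma not_in_zero [simp]: "x \<notin> elts zero" by (simp add: elts_zero)

lemma omega_trans_subset: "n \<in> elts omega \<Longrightarrow> elts n \<subseteq> elts omega"
  by (rule omega_induct[where P = "\<lambda>n. elts n \<subseteq> elts omega"])
     ((intro definable_intros) | auto simp: elts_succ)+

lemma in_omega_trans: "n \<in> elts omega \<Longrightarrow> k \<in> elts n \<Longrightarrow> k \<in> elts omega"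
  using omega_trans_subset by blast

lemma nat_elts_subset:
  assumes "n \<in> elts omega"
  shows "\<forall>k\<in>elts n. elts k \<subseteq> elts n"
  by (rule omega_induct[OF assms]) ((intro definable_intros) | auto simp: elts_succ)+

lemma nat_less_trans: "n \<in> elts omega \<Longrightarrow> m \<in> elts n \<Longrightarrow> k \<in> elts m \<Longrightarrow> k \<in> elts n"
  using nat_elts_subset by blast

lemma mem_irrefl: "x \<notin> elts x"
  using foundation[of "upair x x"] by (auto simp: elts_upair)

lemma mem_asym: "x \<in> elts y \<Longrightarrow> y \<notin> elts x"
  using foundation[of "upair x y"] by (auto simp: elts_upair)

lemma succ_inject: "succ m = succ n \<longleftrightarrow> m = n"
  using elts_succ[of m] elts_succ[of n] mem_asym by (metis insertCI insertE)

lemma succ_neq_zero [simp]: "succ n \<noteq> zero" "zero \<noteq> succ n"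
  using elts_succ[of n] elts_zero by auto

lemma zero_in_succ:
  assumes "n \<in> elts omega" shows "zero \<in> elts (succ n)"
  by (rule omega_induct[OF assms]) ((intro definable_intros) | auto simp: elts_succ)+

lemma succ_in_succ:
  assumes "n \<in> elts omega" shows "\<forall>m\<in>elts n. succ m \<in> elts (succ n)"
  by (rule omega_induct[OF assms]) ((intro definable_intros) | auto simp: elts_succ)+

lemma nat_linear:
  assumes "m \<in> elts omega" "n \<in> elts omega"
  shows "m \<in> elts n \<or> m = n \<or> n \<in> elts m"
proof -
  have "\<forall>n\<in>elts omega. m \<in> elts n \<or> m = n \<or> n \<in> elts m"
  proof (rule omega_induct[OF assms(1)])
    show "definable (\<lambda>e. \<forall>n\<in>elts omega. e 0 \<in> elts n \<or> e 0 = n \<or> n \<in> elts (e 0))"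
      by (intro definable_intros)
    show "\<forall>n\<in>elts omega. zero \<in> elts n \<or> zero = n \<or> n \<in> elts zero"
    proof
      fix n assume "n \<in> elts omega"
      then show "zero \<in> elts n \<or> zero = n \<or> n \<in> elts zero"
        by (rule omega_induct) ((intro definable_intros) | auto simp: zero_in_succ)+
    qed
    fix k assume k: "k \<in> elts omega"
      and IH: "\<forall>n\<in>elts omega. k \<in> elts n \<or> k = n \<or> n \<in> elts k"
    show "\<forall>n\<in>elts omega. succ k \<in> elts n \<or> succ k = n \<or> n \<in> elts (succ k)"
    proof
      fix n assume "n \<in> elts omega"
      then show "succ k \<in> elts n \<or> succ k = n \<or> n \<in> elts (succ k)"
      proof (rule omega_induct)
        show "definable (\<lambda>e. succ k \<in> elts (e 0) \<or> succ k = e 0 \<or> e 0 \<in> elts (succ k))"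
          by (intro definable_intros)
        show "succ k \<in> elts zero \<or> succ k = zero \<or> zero \<in> elts (succ k)"
          using k zero_in_succ by blast
        fix n assume n: "n \<in> elts omega" "succ k \<in> elts n \<or> succ k = n \<or> n \<in> elts (succ k)"
        then show "succ k \<in> elts (succ n) \<or> succ k = succ n \<or> succ n \<in> elts (succ k)"
          using k succ_in_succ[of k] by (auto simp: elts_succ)
      qed
    qed
  qed
  with assms(2) show ?thesis by blast
qed

lemma succ_in_succ_iff:
  assumes "m \<in> elts omega" "n \<in> elts omega"
  shows "succ m \<in> elts (succ n) \<longleftrightarrow> m \<in> elts n"
proof
  assume *: "succ m \<in> elts (succ n)"
  show "m \<in> elts n"
  proof (rule ccontr)
    assume "m \<notin> elts n"
    then have "n = m \<or> succ n \<in> elts (succ m)"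
      using nat_linear[OF assms] succ_in_succ[OF assms(1)] by blast
    then show False using * mem_asym[OF *] mem_irrefl by blast
  qed
qed (use succ_in_succ[OF assms(2)] in blast)

lemma nat_subset_iff:
  assumes "m \<in> elts omega" "n \<in> elts omega"
  shows "elts m \<subseteq> elts n \<longleftrightarrow> m \<in> elts n \<or> m = n"
  using nat_linear[OF assms] nat_elts_subset assms mem_irrefl by blast

lemma nat_subset_linear:
  "m \<in> elts omega \<Longrightarrow> n \<in> elts omega \<Longrightarrow> elts m \<subseteq> elts n \<or> elts n \<subseteq> elts m"
  using nat_linear nat_subset_iff by blast

lemma nat_max:
  assumes "m \<in> elts omega" "n \<in> elts omega"
  obtains l where "l \<in> elts omega" "elts m \<subseteq> elts l" "elts n \<subseteq> elts l"
  using nat_subset_linear[OF assms] assms by blast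

lemma nat_cases:
  assumes "n \<in> elts omega"
  obtains "n = zero" | m where "m \<in> elts omega" "n = succ m"
proof -
  have "n = zero \<or> (\<exists>m\<in>elts omega. n = succ m)"
    by (rule omega_induct[OF assms]) ((intro definable_intros) | auto)+
  with that show thesis by blast
qed

lemma one_in_omega [simp]: "one \<in> elts omega" and two_in_omega [simp]: "two \<in> elts omega"
  by (simp_all add: one_def two_def succ_in_omega)

lemma elts_two: "elts two = {zero, one}"
  by (auto simp: two_def one_def elts_succ elts_zero)

lemma zero_neq_one [simp]: "zero \<noteq> one" "one \<noteq> zero"
  by (simp_all add: one_def)

subsection \<open>Dependent choice with a prescribed start\<close>

text \<open>The axiom gives no control over the first value. It is therefore applied not to
  \<open>R\<close> but to approximations \<open>(n,c)\<close>, where the first \<open>n\<close>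
  steps of \<open>c\<close> form an \<open>R\<close>-chain from \<open>x0\<close>; one step of
  \<open>r\<close> prolongs the chain by one and keeps what it had. All \<open>c\<close> are total
  on \<open>omega\<close>, so that no finite domains have to be handled.\<close>

lemma dc_start:
  assumes R: "definable (\<lambda>e. R (e 0) (e 1))" and x0: "x0 \<in> elts a"
    and total: "\<And>x. x \<in> elts a \<Longrightarrow> \<exists>y\<in>elts a. R x y"
  obtains f where "func f (elts omega) (elts a)" "ap f zero = x0"
    "\<forall>n\<in>elts omega. R (ap f n) (ap f (succ n))"
proof -
  note [definable_intros] = definable_comp2[where P = R, OF R]
  define T where "T n c \<longleftrightarrow> ap c zero = x0 \<and> (\<forall>i\<in>elts n. R (ap c i) (ap c (succ i)))" for n c
  define S where "S = sep (times omega (Fn omega a)) (\<lambda>z. \<exists>n c. z = opair n c \<and> T n c)"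
  have S: "opair n c \<in> elts S \<longleftrightarrow> n \<in> elts omega \<and> func c (elts omega) (elts a) \<and> T n c" for n c
    unfolding S_def T_def
    by (subst elts_sep, intro definable_intros) (auto simp: elts_Fn opair_inject)
  have S_pair: "\<exists>n c. z = opair n c" if "z \<in> elts S" for z
  proof -
    have "z \<in> elts (times omega (Fn omega a))"
      using that unfolding S_def T_def by (subst (asm) elts_sep, intro definable_intros) auto
    then show ?thesis by (blast elim: timesE)
  qed
  define r where "r = sep (times S S) (\<lambda>z. \<exists>n c c'. z = opair (opair n c) (opair (succ n) c') \<and>
      (\<forall>i\<in>elts (succ n). ap c' i = ap c i))"
  have r: "opair z z' \<in> elts r \<longleftrightarrow> z \<in> elts S \<and> z' \<in> elts S \<and>
      (\<exists>n c c'. z = opair n c \<and> z' = opair (succ n) c' \<and> (\<forall>i\<in>elts (succ n). ap c' i = ap c i))" for z z'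
    unfolding r_def by (subst elts_sep, intro definable_intros) (auto simp: opair_inject)
  have const: "definable_term (\<lambda>e. x0)" by (intro definable_intros)
  have "opair zero (lam omega (\<lambda>_. x0)) \<in> elts S"
    using x0 by (simp add: S T_def func_lam[OF const] ap_lam[OF const] elts_zero)
  then have ne: "elts S \<noteq> {}" by blast
  have step: "\<exists>z'\<in>elts S. opair z z' \<in> elts r" if z: "z \<in> elts S" for z
  proof -
    obtain n c where nc: "z = opair n c" using S_pair[OF z] by blast
    with z have n: "n \<in> elts omega" and c: "func c (elts omega) (elts a)" and T: "T n c" by (auto simp: S)
    obtain y where y: "y \<in> elts a" "R (ap c n) y" using total ap_in[OF c n] by blast
    define c' where "c' = lam omega (\<lambda>i. if i = succ n then y else ap c i)"
    have d: "definable_term (\<lambda>e. if e 0 = succ n then y else ap c (e 0))" by (intro definable_intros)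
    have c': "func c' (elts omega) (elts a)"
      unfolding c'_def by (rule func_lam[OF d]) (use y ap_in[OF c] in auto)
    have ap_c': "ap c' i = (if i = succ n then y else ap c i)" if "i \<in> elts omega" for i
      unfolding c'_def using ap_lam[OF d that] .
    have old: "ap c' i = ap c i" if "i \<in> elts (succ n)" for i
      using ap_c'[of i] that n mem_irrefl in_omega_trans succ_in_omega by metis
    have "R (ap c' i) (ap c' (succ i))" if i: "i \<in> elts (succ n)" for i
    proof (cases "i = n")
      case True
      then show ?thesis using y old[OF i] ap_c'[of "succ n"] succ_in_omega[OF n] by simp
    next
      case False
      then have "i \<in> elts n" using i by (simp add: elts_succ)
      then show ?thesis using T old[OF i] old[of "succ i"] succ_in_succ[OF n] by (simp add: T_def)
    qed
    moreover have "ap c' zero = x0" using T old zero_in_succ[OF n] by (simp add: T_def)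
    ultimately have "opair (succ n) c' \<in> elts S"
      using c' n succ_in_omega by (simp add: S T_def)
    then show ?thesis using z old nc by (auto simp: r opair_inject)
  qed
  obtain g where g: "func g (elts omega) (elts S)"
    "\<And>n. n \<in> elts omega \<Longrightarrow> opair (app g n) (app g (succ n)) \<in> elts r"
    using dependent_choice[OF ne step] by blast
  define N where "N k = pr1 (ap g k)" for k
  define C where "C k = pr2 (ap g k)" for k
  have gS: "opair (N k) (C k) \<in> elts S" if "k \<in> elts omega" for k
    using ap_in[OF g(1) that] S_pair[OF ap_in[OF g(1) that]] by (auto simp: N_def C_def)
  have gstep: "N (succ k) = succ (N k)" "\<And>i. i \<in> elts (succ (N k)) \<Longrightarrow> ap (C (succ k)) i = ap (C k) i"
    if k: "k \<in> elts omega" for k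
    using g(2)[OF k] app_eq_ap[OF g(1)] k succ_in_omega by (auto simp: r N_def C_def)
  \<comment> \<open>The chain of approximations may itself begin at any length, hence an inequality
    only.\<close>
  have kN: "elts k \<subseteq> elts (N k)" if "k \<in> elts omega" for k
  proof (rule omega_induct[OF that])
    show "definable (\<lambda>e. elts (e 0) \<subseteq> elts (N (e 0)))" unfolding N_def by (intro definable_intros)
    fix n assume n: "n \<in> elts omega" "elts n \<subseteq> elts (N n)"
    then have "N n \<in> elts omega" using gS S by blast
    with n show "elts (succ n) \<subseteq> elts (N (succ n))"
      using nat_subset_iff by (auto simp: elts_succ gstep)
  qed (simp add: elts_zero)
  have kN': "k \<in> elts (succ (N k))" if "k \<in> elts omega" for k
    using kN[OF that] nat_subset_iff[OF that] gS[OF that] by (auto simp: S elts_succ)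
  \<comment> \<open>Position \<open>k\<close> is already final in \<open>C k\<close>, because
    \<open>k\<close> does not exceed \<open>N k\<close>.\<close>
  define f where "f = lam omega (\<lambda>k. ap (C k) k)"
  have d: "definable_term (\<lambda>e. ap (C (e 0)) (e 0))" unfolding C_def by (intro definable_intros)
  have ap_f: "ap f k = ap (C k) k" if "k \<in> elts omega" for k
    unfolding f_def using ap_lam[OF d that] .
  show thesis
  proof
    show "func f (elts omega) (elts a)"
      unfolding f_def by (rule func_lam[OF d]) (use gS S ap_in in blast)
    show "ap f zero = x0" using ap_f gS[of zero] by (simp add: S T_def)
    show "\<forall>n\<in>elts omega. R (ap f n) (ap f (succ n))"
    proof
      fix n assume n: "n \<in> elts omega"
      then have "n \<in> elts (N (succ n))" using gstep kN' by simp
      then have "R (ap (C (succ n)) n) (ap (C (succ n)) (succ n))"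
        using gS[OF succ_in_omega[OF n]] by (simp add: S T_def)
      then show "R (ap f n) (ap f (succ n))"
        using gstep(2)[OF n kN'[OF n]] ap_f n succ_in_omega by simp
    qed
  qed
qed

text \<open>The stage number is carried along as the first component, so that the relation may
  depend on it.\<close>

lemma dc_indexed:
  assumes R: "definable (\<lambda>e. R (e 0) (e 1) (e 2))" and x0: "x0 \<in> elts a"
    and total: "\<And>n x. n \<in> elts omega \<Longrightarrow> x \<in> elts a \<Longrightarrow> \<exists>y\<in>elts a. R n x y"
  obtains f where "func f (elts omega) (elts a)" "ap f zero = x0"
    "\<forall>n\<in>elts omega. R n (ap f n) (ap f (succ n))"
proof -
  note [definable_intros] = definable_comp3[where P = R, OF R]
  have "definable (\<lambda>e. pr1 (e 1) = succ (pr1 (e 0)) \<and> R (pr1 (e 0)) (pr2 (e 0)) (pr2 (e 1)))"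
    by (intro definable_intros)
  moreover have "opair zero x0 \<in> elts (times omega a)" using x0 by simp
  moreover have "\<exists>y\<in>elts (times omega a). pr1 y = succ (pr1 x) \<and> R (pr1 x) (pr2 x) (pr2 y)"
    if xa: "x \<in> elts (times omega a)" for x
  proof -
    obtain n c where x: "x = opair n c" "n \<in> elts omega" "c \<in> elts a" using xa by (rule timesE)
    obtain d where "d \<in> elts a" "R n c d" using total x by blast
    with x show ?thesis by (intro bexI[of _ "opair (succ n) d"]) (simp_all add: succ_in_omega)
  qed
  ultimately obtain g where g: "func g (elts omega) (elts (times omega a))" "ap g zero = opair zero x0"
    "\<forall>n\<in>elts omega. pr1 (ap g (succ n)) = succ (pr1 (ap g n)) \<and>
        R (pr1 (ap g n)) (pr2 (ap g n)) (pr2 (ap g (succ n)))"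
    by (rule dc_start) blast
  have idx: "pr1 (ap g n) = n" if "n \<in> elts omega" for n
    by (rule omega_induct[OF that]) ((intro definable_intros) | simp add: g)+
  have d: "definable_term (\<lambda>e. pr2 (ap g (e 0)))" by (intro definable_intros)
  show thesis
  proof
    show "func (lam omega (\<lambda>n. pr2 (ap g n))) (elts omega) (elts a)"
      by (rule func_lam[OF d], drule ap_in[OF g(1)]) (auto elim: timesE)
    show "ap (lam omega (\<lambda>n. pr2 (ap g n))) zero = x0" using ap_lam[OF d] g(2) by simp
    show "\<forall>n\<in>elts omega. R n (ap (lam omega (\<lambda>n. pr2 (ap g n))) n)
        (ap (lam omega (\<lambda>n. pr2 (ap g n))) (succ n))"
      using g(3) idx ap_lam[OF d] succ_in_omega by simp
  qed
qed

subsection \<open>Enumerable sets\<close>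

text \<open>
  The walk through the pairs of numbers passes, for each \<open>k\<close>, from \<open>(0,k)\<close> right to \<open>(k,k)\<close>, then
  down to \<open>(k,0)\<close>, and on to \<open>(0,k+1)\<close>; this avoids arithmetic.
\<close>

lemma omega_times_omega:
  obtains p where "func p (elts omega) (elts (times omega omega))"
    "\<And>m n. m \<in> elts omega \<Longrightarrow> n \<in> elts omega \<Longrightarrow> \<exists>t\<in>elts omega. ap p t = opair m n"
proof -
  define R where "R z z' \<longleftrightarrow> (\<exists>m n. z = opair m n \<and>
     (m \<in> elts n \<and> z' = opair (succ m) n \<or>
      m \<notin> elts n \<and> n = zero \<and> z' = opair zero (succ m) \<or>
      m \<notin> elts n \<and> (\<exists>k\<in>elts omega. n = succ k \<and> z' = opair m k)))" for z z'
  have "definable (\<lambda>e. R (e 0) (e 1))" unfolding R_def by (intro definable_intros)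
  moreover have "opair zero zero \<in> elts (times omega omega)" by simp
  moreover have "\<exists>z'\<in>elts (times omega omega). R z z'" if z: "z \<in> elts (times omega omega)" for z
  proof -
    obtain m n where mn: "z = opair m n" "m \<in> elts omega" "n \<in> elts omega" using z by (rule timesE)
    consider "m \<in> elts n" | "m \<notin> elts n" "n = zero"
      | k where "m \<notin> elts n" "k \<in> elts omega" "n = succ k"
      using nat_cases[OF mn(3)] by blast
    then show ?thesis
    proof cases
      case 1
      then show ?thesis
        using mn by (intro bexI[of _ "opair (succ m) n"]) (auto simp: R_def succ_in_omega opair_inject)
    next
      case 2
      then show ?thesis
        using mn by (intro bexI[of _ "opair zero (succ m)"]) (auto simp: R_def succ_in_omega opair_inject)
    next
      case (3 k)
      then show ?thesis
        using mn by (intro bexI[of _ "opair m k"]) (auto simp: R_def opair_inject)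
    qed
  qed
  ultimately obtain p where p: "func p (elts omega) (elts (times omega omega))"
    "ap p zero = opair zero zero" "\<forall>n\<in>elts omega. R (ap p n) (ap p (succ n))"
    by (rule dc_start) blast
  define hit where "hit z \<longleftrightarrow> (\<exists>t\<in>elts omega. ap p t = z)" for z
  have dhit [definable_intros]: "definable_term t \<Longrightarrow> definable (\<lambda>e. hit (t e))" for t
    by (rule definable_comp1[where P = hit]) (unfold hit_def, intro definable_intros)
  \<comment> \<open>The walk is deterministic, so every admissible move from a visited pair is the
    move actually made.\<close>
  have Rfun: "R z u \<Longrightarrow> R z v \<Longrightarrow> u = v" for z u v
    by (auto simp: R_def opair_inject succ_inject)
  have hit: "hit z'" if "hit z" "R z z'" for z z'
    using that p(3) Rfun succ_in_omega unfolding hit_def by metis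
  have right: "hit (opair j k)" if k: "k \<in> elts omega" "hit (opair zero k)" and j: "j \<in> elts (succ k)" for j k
  proof -
    have "j \<in> elts omega" using j k in_omega_trans succ_in_omega by blast
    then have "j \<in> elts (succ k) \<longrightarrow> hit (opair j k)"
    proof (rule omega_induct)
      fix n assume n: "n \<in> elts omega" and IH: "n \<in> elts (succ k) \<longrightarrow> hit (opair n k)"
      show "succ n \<in> elts (succ k) \<longrightarrow> hit (opair (succ n) k)"
      proof
        assume *: "succ n \<in> elts (succ k)"
        have "n \<in> elts k"
          using * succ_in_succ_iff n k by blast
        then show "hit (opair (succ n) k)"
          using IH by (intro hit[of "opair n k" "opair (succ n) k"]) (auto simp: R_def elts_succ opair_inject)
      qed
    qed ((intro definable_intros) | simp add: k)+
    with j show ?thesis by simp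
  qed
  have down: "hit (opair k j)" if k: "k \<in> elts omega" "hit (opair k k)" and j: "j \<in> elts (succ k)" for j k
  proof -
    \<comment> \<open>The walk goes down while the induction goes up: the claim for \<open>n\<close>
      is that from \<open>(k,n)\<close> the walk reaches all \<open>(k,j)\<close> with
      \<open>j \<le> n\<close>.\<close>
    have "k \<in> elts (succ k) \<and> hit (opair k k) \<longrightarrow> (\<forall>j\<in>elts (succ k). hit (opair k j))"
    proof (rule omega_induct[OF k(1), where P = "\<lambda>n. n \<in> elts (succ k) \<and> hit (opair k n) \<longrightarrow> (\<forall>j\<in>elts (succ n). hit (opair k j))"])
      fix n assume n: "n \<in> elts omega"
        and IH: "n \<in> elts (succ k) \<and> hit (opair k n) \<longrightarrow> (\<forall>j\<in>elts (succ n). hit (opair k j))"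
      show "succ n \<in> elts (succ k) \<and> hit (opair k (succ n)) \<longrightarrow> (\<forall>j\<in>elts (succ (succ n)). hit (opair k j))"
      proof
        assume *: "succ n \<in> elts (succ k) \<and> hit (opair k (succ n))"
        then have "k \<notin> elts (succ n)"
          using mem_asym[of k "succ n"] mem_irrefl[of k] by (auto simp: elts_succ[of k])
        then have "hit (opair k n)" using * n
          by (intro hit[of "opair k (succ n)" "opair k n"]) (auto simp: R_def)
        moreover have "n \<in> elts (succ k)"
          using * nat_less_trans[OF succ_in_omega[OF k(1)], of "succ n" n] by (simp add: elts_succ[of n])
        ultimately show "\<forall>j\<in>elts (succ (succ n)). hit (opair k j)"
          using IH * by (auto simp: elts_succ[of "succ n"])
      qed
    qed ((intro definable_intros) | simp add: elts_succ elts_zero)+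
    moreover have "k \<in> elts (succ k)" by (simp add: elts_succ)
    ultimately show ?thesis using k(2) j by blast
  qed
  have diag: "hit (opair k k)" if "k \<in> elts omega" "hit (opair zero k)" for k
    using right[OF that, of k] by (simp add: elts_succ)
  have left: "hit (opair zero k)" if "k \<in> elts omega" for k
  proof (rule omega_induct[OF that])
    show "hit (opair zero zero)" using p(2) zero_in_omega by (auto simp: hit_def)
    fix n assume n: "n \<in> elts omega" "hit (opair zero n)"
    then have "hit (opair n zero)" using down[OF n(1) diag[OF n], of zero] zero_in_succ by blast
    then show "hit (opair zero (succ n))" by (rule hit) (unfold R_def, use not_in_zero in blast)
  qed (intro definable_intros)
  have "hit (opair m n)" if "m \<in> elts omega" "n \<in> elts omega" for m n
    using nat_linear[OF that] right[of n m] down[of m n] left diag that by (auto simp: elts_succ)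
  with p(1) that show thesis unfolding hit_def by blast
qed

text \<open>A covering by a sequence instead of an injection into \<open>omega\<close>: it passes to
  images and subsets without selecting preimages, and it includes the empty set.\<close>

definition enumerable :: "'v \<Rightarrow> bool" where
  "enumerable a \<longleftrightarrow> (\<exists>f. \<forall>x\<in>elts a. \<exists>n\<in>elts omega. ap f n = x)"

lemma enumerable_image:
  assumes "enumerable a" and g: "definable_term (\<lambda>e. g (e 0))" and "elts b \<subseteq> g ` elts a"
  shows "enumerable b"
proof -
  obtain f where f: "\<And>x. x \<in> elts a \<Longrightarrow> \<exists>n\<in>elts omega. ap f n = x"
    using assms(1) by (auto simp: enumerable_def)
  have d: "definable_term (\<lambda>e. g (ap f (e 0)))"
    by (intro definable_term_comp1[OF g] definable_intros)
  have "\<exists>n\<in>elts omega. ap (lam omega (\<lambda>n. g (ap f n))) n = x" if "x \<in> elts b" for x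
    using that assms(3) f ap_lam[OF d] by fastforce
  then show ?thesis unfolding enumerable_def by blast
qed

lemma enumerable_omega: "enumerable omega"
proof -
  have d: "definable_term (\<lambda>e. e 0)" by (intro definable_intros)
  show ?thesis unfolding enumerable_def using ap_lam[OF d] by blast
qed

lemma enumerable_singleton: "enumerable (upair a a)"
proof -
  have "definable_term (\<lambda>e. a)" by (intro definable_intros)
  moreover have "elts (upair a a) \<subseteq> (\<lambda>_. a) ` elts omega"
    using zero_in_omega unfolding elts_upair by blast
  ultimately show ?thesis by (rule enumerable_image[where g = "\<lambda>_. a", OF enumerable_omega])
qed

lemma enumerable_omega_times_omega: "enumerable (times omega omega)"
proof -
  obtain p where "\<And>m n. m \<in> elts omega \<Longrightarrow> n \<in> elts omega \<Longrightarrow> \<exists>t\<in>elts omega. ap p t = opair m n"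
    by (rule omega_times_omega) blast
  then show ?thesis unfolding enumerable_def by (blast elim: timesE)
qed

lemma enumerable_times:
  assumes "enumerable a" "enumerable b"
  shows "enumerable (times a b)"
proof -
  obtain f where f: "\<And>x. x \<in> elts a \<Longrightarrow> \<exists>n\<in>elts omega. ap f n = x"
    using assms(1) by (auto simp: enumerable_def)
  obtain g where g: "\<And>x. x \<in> elts b \<Longrightarrow> \<exists>n\<in>elts omega. ap g n = x"
    using assms(2) by (auto simp: enumerable_def)
  have "definable_term (\<lambda>e. opair (ap f (pr1 (e 0))) (ap g (pr2 (e 0))))"
    by (intro definable_intros)
  moreover have "elts (times a b) \<subseteq> (\<lambda>z. opair (ap f (pr1 z)) (ap g (pr2 z))) ` elts (times omega omega)"
  proof
    fix z assume "z \<in> elts (times a b)"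
    then obtain x y where z: "z = opair x y" "x \<in> elts a" "y \<in> elts b" by (rule timesE)
    then obtain m n where "m \<in> elts omega" "ap f m = x" "n \<in> elts omega" "ap g n = y"
      using f g by blast
    with z show "z \<in> (\<lambda>z. opair (ap f (pr1 z)) (ap g (pr2 z))) ` elts (times omega omega)"
      by (intro image_eqI[of _ _ "opair m n"]) auto
  qed
  ultimately show ?thesis by (rule enumerable_image[OF enumerable_omega_times_omega])
qed

lemma enumerable_join:
  assumes "enumerable a" "enumerable b"
  shows "enumerable (join a b)"
proof -
  obtain f where f: "\<And>x. x \<in> elts a \<Longrightarrow> \<exists>n\<in>elts omega. ap f n = x"
    using assms(1) by (auto simp: enumerable_def)
  obtain g where g: "\<And>x. x \<in> elts b \<Longrightarrow> \<exists>n\<in>elts omega. ap g n = x"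
    using assms(2) by (auto simp: enumerable_def)
  let ?h = "\<lambda>z. if pr1 z = zero then ap f (pr2 z) else ap g (pr2 z)"
  have "definable_term (\<lambda>e. ?h (e 0))" by (intro definable_intros)
  moreover have "elts (join a b) \<subseteq> ?h ` elts (times omega omega)"
  proof
    fix x assume "x \<in> elts (join a b)"
    then consider n where "n \<in> elts omega" "ap f n = x" | n where "n \<in> elts omega" "ap g n = x"
      using f g unfolding elts_join by blast
    then show "x \<in> ?h ` elts (times omega omega)"
    proof cases
      case (1 n) then show ?thesis by (intro image_eqI[of _ _ "opair zero n"]) auto
    next
      case (2 n) then show ?thesis by (intro image_eqI[of _ _ "opair one n"]) auto
    qed
  qed
  ultimately show ?thesis by (rule enumerable_image[OF enumerable_omega_times_omega])
qed

lemma enumeration: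
  assumes "enumerable a" "x0 \<in> elts a"
  obtains f where "func f (elts omega) (elts a)" "\<And>x. x \<in> elts a \<Longrightarrow> \<exists>n\<in>elts omega. ap f n = x"
proof -
  obtain f where f: "\<And>x. x \<in> elts a \<Longrightarrow> \<exists>n\<in>elts omega. ap f n = x"
    using assms(1) by (auto simp: enumerable_def)
  have d: "definable_term (\<lambda>e. if ap f (e 0) \<in> elts a then ap f (e 0) else x0)"
    by (intro definable_intros)
  show thesis
  proof
    show "func (lam omega (\<lambda>n. if ap f n \<in> elts a then ap f n else x0)) (elts omega) (elts a)"
      by (rule func_lam[OF d]) (use assms in auto)
    show "\<exists>n\<in>elts omega. ap (lam omega (\<lambda>n. if ap f n \<in> elts a then ap f n else x0)) n = x"
      if "x \<in> elts a" for x
    proof -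
      obtain n where "n \<in> elts omega" "ap f n = x" using f \<open>x \<in> elts a\<close> by blast
      then show ?thesis using ap_lam[OF d] that by auto
    qed
  qed
qed

text \<open>Each stage is an enumeration of the previous one together with all results of
  \<open>opn\<close> on it. Passing to the next stage means picking an enumeration, which is what
  dependent choice is for; the ambient \<open>X\<close> makes the candidates form a set. The union
  is indexed by a stage and a position in it, hence enumerable.\<close>

lemma enumerable_closure:
  assumes d: "definable_term (\<lambda>e. opn (e 0) (e 1))"
    and opn: "\<And>x y. x \<in> elts X \<Longrightarrow> y \<in> elts X \<Longrightarrow> opn x y \<in> elts X"
    and S: "elts S \<subseteq> elts X" "enumerable S" "s0 \<in> elts S"
  obtains W where "elts S \<subseteq> elts W" "elts W \<subseteq> elts X" "enumerable W"
    "\<And>x y. x \<in> elts W \<Longrightarrow> y \<in> elts W \<Longrightarrow> opn x y \<in> elts W"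
proof -
  note [definable_intros] = definable_term_comp2[where f = opn, OF d]
  define R where "R e e' \<longleftrightarrow> (\<forall>m\<in>elts omega. \<exists>k\<in>elts omega. ap e' k = ap e m) \<and>
      (\<forall>m\<in>elts omega. \<forall>n\<in>elts omega. \<exists>k\<in>elts omega. ap e' k = opn (ap e m) (ap e n))" for e e'
  obtain e0 where e0: "func e0 (elts omega) (elts S)" "\<And>x. x \<in> elts S \<Longrightarrow> \<exists>n\<in>elts omega. ap e0 n = x"
    using enumeration[OF S(2,3)] by blast
  have "definable (\<lambda>e. R (e 0) (e 1))" unfolding R_def by (intro definable_intros)
  moreover have "e0 \<in> elts (Fn omega X)"
    using func_mono[OF e0(1) S(1)] by (simp add: elts_Fn)
  moreover have "\<exists>e'\<in>elts (Fn omega X). R e e'" if e: "e \<in> elts (Fn omega X)" for e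
  proof -
    have fe: "func e (elts omega) (elts X)" using e by (simp add: elts_Fn)
    have d1: "definable_term (\<lambda>v. ap e (v 0))" by (intro definable_intros)
    have d2: "definable_term (\<lambda>v. opn (ap e (pr1 (v 0))) (ap e (pr2 (v 0))))"
      by (intro definable_intros)
    define b where "b = join (img omega (\<lambda>n. ap e n)) (img (times omega omega) (\<lambda>z. opn (ap e (pr1 z)) (ap e (pr2 z))))"
    have b: "elts b = ap e ` elts omega \<union> (\<lambda>z. opn (ap e (pr1 z)) (ap e (pr2 z))) ` elts (times omega omega)"
      unfolding b_def elts_join elts_img[OF d1] elts_img[OF d2] ..
    have "enumerable b"
      unfolding b_def
      by (intro enumerable_join enumerable_image[OF enumerable_omega d1]
          enumerable_image[OF enumerable_omega_times_omega d2])
         (simp_all add: elts_img[OF d1] elts_img[OF d2])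
    moreover have "ap e zero \<in> elts b" unfolding b by simp
    ultimately obtain e' where e': "func e' (elts omega) (elts b)"
      "\<And>x. x \<in> elts b \<Longrightarrow> \<exists>n\<in>elts omega. ap e' n = x"
      using enumeration by blast
    have "elts b \<subseteq> elts X"
      unfolding b by (auto elim!: timesE intro!: opn ap_in[OF fe])
    then have "e' \<in> elts (Fn omega X)" using func_mono[OF e'(1)] by (simp add: elts_Fn)
    moreover have "R e e'"
      unfolding R_def
    proof (intro conjI ballI)
      fix m n assume mn: "m \<in> elts omega" "n \<in> elts omega"
      have "opn (ap e m) (ap e n) \<in> elts b"
        unfolding b using mn by (intro UnI2 image_eqI[of _ _ "opair m n"]) auto
      then show "\<exists>k\<in>elts omega. ap e' k = opn (ap e m) (ap e n)" by (rule e'(2))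
    qed (use e'(2) b in blast)
    ultimately show ?thesis by blast
  qed
  ultimately obtain E where E: "func E (elts omega) (elts (Fn omega X))" "ap E zero = e0"
    "\<forall>n\<in>elts omega. R (ap E n) (ap E (succ n))"
    by (rule dc_start) blast
  \<comment> \<open>Two elements that appear at different stages are brought to a common stage,
    where \<open>opn\<close> is applied to them.\<close>
  have mono: "\<forall>i\<in>elts (succ j). \<forall>m\<in>elts omega. \<exists>k\<in>elts omega. ap (ap E j) k = ap (ap E i) m"
    if "j \<in> elts omega" for j
  proof (rule omega_induct[OF that])
    fix n assume n: "n \<in> elts omega"
      "\<forall>i\<in>elts (succ n). \<forall>m\<in>elts omega. \<exists>k\<in>elts omega. ap (ap E n) k = ap (ap E i) m"
    have "\<forall>m\<in>elts omega. \<exists>k\<in>elts omega. ap (ap E (succ n)) k = ap (ap E n) m"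
      using bspec[OF E(3) n(1)] by (simp add: R_def)
    with n(2) show "\<forall>i\<in>elts (succ (succ n)). \<forall>m\<in>elts omega. \<exists>k\<in>elts omega. ap (ap E (succ n)) k = ap (ap E i) m"
      unfolding elts_succ[of "succ n"] by (metis insert_iff)
  qed ((intro definable_intros) | auto simp: elts_succ)+
  have dW: "definable_term (\<lambda>v. ap (ap E (pr1 (v 0))) (pr2 (v 0)))" by (intro definable_intros)
  define W where "W = img (times omega omega) (\<lambda>z. ap (ap E (pr1 z)) (pr2 z))"
  have eltsW: "elts W = (\<lambda>z. ap (ap E (pr1 z)) (pr2 z)) ` elts (times omega omega)"
    unfolding W_def by (rule elts_img[OF dW])
  have W: "x \<in> elts W \<longleftrightarrow> (\<exists>i\<in>elts omega. \<exists>m\<in>elts omega. x = ap (ap E i) m)" for x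
  proof
    assume "\<exists>i\<in>elts omega. \<exists>m\<in>elts omega. x = ap (ap E i) m"
    then obtain i m where "i \<in> elts omega" "m \<in> elts omega" "x = ap (ap E i) m" by blast
    then show "x \<in> elts W" unfolding eltsW by (intro image_eqI[of _ _ "opair i m"]) auto
  next
    assume "x \<in> elts W"
    then obtain z where z: "z \<in> elts (times omega omega)" "x = ap (ap E (pr1 z)) (pr2 z)"
      unfolding eltsW by blast
    from z(1) obtain i m where im: "z = opair i m" "i \<in> elts omega" "m \<in> elts omega" by (rule timesE)
    with z(2) have "x = ap (ap E i) m" by simp
    with im(2,3) show "\<exists>i\<in>elts omega. \<exists>m\<in>elts omega. x = ap (ap E i) m" by blast
  qed
  show thesis
  proof
    show "elts S \<subseteq> elts W"
    proof
      fix x assume "x \<in> elts S"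
      then obtain n where "n \<in> elts omega" "ap (ap E zero) n = x" using e0(2) E(2) by blast
      then show "x \<in> elts W" unfolding W using zero_in_omega by blast
    qed
    show "elts W \<subseteq> elts X"
    proof
      fix x assume "x \<in> elts W"
      then obtain i m where im: "i \<in> elts omega" "m \<in> elts omega" "x = ap (ap E i) m"
        unfolding W by blast
      have "func (ap E i) (elts omega) (elts X)" using ap_in[OF E(1) im(1)] by (simp add: elts_Fn)
      from ap_in[OF this im(2)] im(3) show "x \<in> elts X" by simp
    qed
    show "enumerable W"
      by (rule enumerable_image[OF enumerable_omega_times_omega dW]) (simp add: eltsW)
    fix x y assume "x \<in> elts W" "y \<in> elts W"
    then obtain i m j n where *: "i \<in> elts omega" "m \<in> elts omega" "x = ap (ap E i) m"
      "j \<in> elts omega" "n \<in> elts omega" "y = ap (ap E j) n"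
      unfolding W by blast
    obtain l where l: "l \<in> elts omega" "elts i \<subseteq> elts l" "elts j \<subseteq> elts l"
      using nat_max * by blast
    then have "i \<in> elts (succ l)" "j \<in> elts (succ l)"
      using nat_subset_iff[OF *(1) l(1)] nat_subset_iff[OF *(4) l(1)] by (auto simp: elts_succ)
    then obtain m' n' where "m' \<in> elts omega" "ap (ap E l) m' = x" "n' \<in> elts omega" "ap (ap E l) n' = y"
      using mono[OF l(1)] * by metis
    then have "\<exists>k\<in>elts omega. ap (ap E (succ l)) k = opn x y"
      using bspec[OF E(3) l(1)] unfolding R_def by blast
    then show "opn x y \<in> elts W" unfolding W using succ_in_omega[OF l(1)] by metis
  qed
qed

subsection \<open>Reals\<close>

lemma definable_is_real [definable_intros]:
  "definable_term t \<Longrightarrow> definable (\<lambda>e. is_real (t e))"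
  unfolding is_real_def by (intro definable_intros)

definition RR :: 'v where "RR = Fn omega two"

lemma elts_RR: "elts RR = {x. is_real x}"
  by (simp add: RR_def elts_Fn is_real_def)

definition agree :: "'v \<Rightarrow> 'v \<Rightarrow> 'v \<Rightarrow> bool" where
  "agree x y n \<longleftrightarrow> (\<forall>k\<in>elts n. ap x k = ap y k)"

lemma definable_agree0: "definable (\<lambda>e. agree (e 0) (e 1) (e 2))"
  unfolding agree_def by (intro definable_intros)

lemmas definable_agree [definable_intros] = definable_comp3[OF definable_agree0]

lemma agree_refl [simp]: "agree x x n"
  and agree_sym: "agree x y n \<Longrightarrow> agree y x n"
  and agree_trans: "agree x y n \<Longrightarrow> agree y z n \<Longrightarrow> agree x z n"
  and agree_mono: "agree x y n \<Longrightarrow> elts m \<subseteq> elts n \<Longrightarrow> agree x y m"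
  by (auto simp: agree_def)

lemma app_real: "is_real x \<Longrightarrow> n \<in> elts omega \<Longrightarrow> app x n = ap x n"
  unfolding is_real_def by (rule app_eq_ap)

lemma real_bit: "is_real x \<Longrightarrow> n \<in> elts omega \<Longrightarrow> ap x n = zero \<or> ap x n = one"
  using ap_in[of x "elts omega" "elts two" n] by (simp add: is_real_def elts_two)

lemma real_eqI:
  "is_real x \<Longrightarrow> is_real y \<Longrightarrow> (\<And>n. n \<in> elts omega \<Longrightarrow> ap x n = ap y n) \<Longrightarrow> x = y"
  unfolding is_real_def by (rule func_eqI)

lemma real_lam:
  assumes "definable_term (\<lambda>e. f (e 0))" "\<forall>n\<in>elts omega. f n = zero \<or> f n = one"
  shows "is_real (lam omega f)" "\<And>n. n \<in> elts omega \<Longrightarrow> ap (lam omega f) n = f n"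
  unfolding is_real_def using func_lam[OF assms(1)] assms(2) ap_lam[OF assms(1)]
  by (auto simp: elts_two)

lemma nbhd_eq:
  assumes "is_real x" "n \<in> elts omega"
  shows "nbhd x n = {y. is_real y \<and> agree x y n}"
  using assms in_omega_trans app_real unfolding nbhd_def agree_def by (auto; metis)

section \<open>Limits of sequences of reals\<close>

lemma increasing_ge:
  assumes m: "definable_term (\<lambda>e. m (e 0))"
    and nat: "\<And>t. t \<in> elts omega \<Longrightarrow> m t \<in> elts omega"
    and inc: "\<And>t. t \<in> elts omega \<Longrightarrow> m t \<in> elts (m (succ t))"
    and t: "t \<in> elts omega"
  shows "elts t \<subseteq> elts (m t)"
proof (rule omega_induct[OF t])
  show "definable (\<lambda>e. elts (e 0) \<subseteq> elts (m (e 0)))"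
    by (intro definable_intros definable_term_comp1[where f = m, OF m])
  fix n assume n: "n \<in> elts omega" "elts n \<subseteq> elts (m n)"
  then have "n \<in> elts (m n) \<or> n = m n" using nat_subset_iff nat by blast
  then have "n \<in> elts (m (succ n))"
    using inc[OF n(1)] nat_less_trans[OF nat[OF succ_in_omega[OF n(1)]]] by metis
  then show "elts (succ n) \<subseteq> elts (m (succ n))"
    using nat_elts_subset[OF nat[OF succ_in_omega[OF n(1)]]] by (auto simp: elts_succ)
qed (simp add: elts_zero)

lemma increasing_mono:
  assumes m: "definable_term (\<lambda>e. m (e 0))"
    and nat: "\<And>t. t \<in> elts omega \<Longrightarrow> m t \<in> elts omega"
    and inc: "\<And>t. t \<in> elts omega \<Longrightarrow> m t \<in> elts (m (succ t))"
    and s: "s \<in> elts omega"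
  shows "\<forall>t\<in>elts (succ s). elts (m t) \<subseteq> elts (m s)"
proof (rule omega_induct[OF s])
  show "definable (\<lambda>e. \<forall>t\<in>elts (succ (e 0)). elts (m t) \<subseteq> elts (m (e 0)))"
    by (intro definable_intros definable_term_comp1[where f = m, OF m])
  fix n assume n: "n \<in> elts omega" and IH: "\<forall>t\<in>elts (succ n). elts (m t) \<subseteq> elts (m n)"
  have "elts (m n) \<subseteq> elts (m (succ n))"
    using nat_elts_subset[OF nat[OF succ_in_omega[OF n]]] inc[OF n] by blast
  then show "\<forall>t\<in>elts (succ (succ n)). elts (m t) \<subseteq> elts (m (succ n))"
    using IH unfolding elts_succ[of "succ n"] by blast
qed (simp add: elts_succ elts_zero)

lemma limit_of_reals:
  assumes q: "definable_term (\<lambda>e. q (e 0))" and m: "definable_term (\<lambda>e. m (e 0))"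
    and real: "\<And>t. t \<in> elts omega \<Longrightarrow> is_real (q t)"
    and nat: "\<And>t. t \<in> elts omega \<Longrightarrow> m t \<in> elts omega"
    and inc: "\<And>t. t \<in> elts omega \<Longrightarrow> m t \<in> elts (m (succ t))"
    and agr: "\<And>t. t \<in> elts omega \<Longrightarrow> agree (q t) (q (succ t)) (m t)"
  obtains x where "is_real x" "\<And>t. t \<in> elts omega \<Longrightarrow> agree (q t) x (m t)"
proof -
  note [definable_intros] = definable_term_comp1[where f = q, OF q] definable_term_comp1[where f = m, OF m]
  have le: "elts t \<subseteq> elts (m t)" if "t \<in> elts omega" for t
    by (rule increasing_ge[where m = m, OF m _ _ that]) (fact nat, fact inc)
  have mono: "\<forall>t\<in>elts (succ s). elts (m t) \<subseteq> elts (m s)" if "s \<in> elts omega" for s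
    by (rule increasing_mono[where m = m, OF m _ _ that]) (fact nat, fact inc)
  have coh: "\<forall>t\<in>elts (succ s). agree (q t) (q s) (m t)" if "s \<in> elts omega" for s
  proof (rule omega_induct[OF that])
    fix n assume n: "n \<in> elts omega" and IH: "\<forall>t\<in>elts (succ n). agree (q t) (q n) (m t)"
    show "\<forall>t\<in>elts (succ (succ n)). agree (q t) (q (succ n)) (m t)"
    proof
      fix t assume "t \<in> elts (succ (succ n))"
      then consider "t = succ n" | "t \<in> elts (succ n)" unfolding elts_succ[of "succ n"] by blast
      then show "agree (q t) (q (succ n)) (m t)"
      proof cases
        case 2
        then have "agree (q n) (q (succ n)) (m t)"
          using agree_mono[OF agr[OF n]] mono[OF n] by blast
        with 2 IH show ?thesis using agree_trans by blast
      qed simp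
    qed
  qed ((intro definable_intros) | simp add: elts_succ elts_zero)+
  have d: "definable_term (\<lambda>e. ap (q (succ (e 0))) (e 0))" by (intro definable_intros)
  \<comment> \<open>Bit \<open>k\<close> is settled in \<open>q (succ k)\<close>, because
    \<open>k\<close> lies below \<open>m (succ k)\<close>.\<close>
  define x where "x = lam omega (\<lambda>k. ap (q (succ k)) k)"
  have x: "is_real x" "\<And>k. k \<in> elts omega \<Longrightarrow> ap x k = ap (q (succ k)) k"
    unfolding x_def using real_lam[OF d] real real_bit succ_in_omega by blast+
  have "agree (q t) x (m t)" if t: "t \<in> elts omega" for t
    unfolding agree_def
  proof
    fix k assume k: "k \<in> elts (m t)"
    then have kw: "k \<in> elts omega" using nat[OF t] in_omega_trans by blast
    then have sk: "succ k \<in> elts omega" by (rule succ_in_omega)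
    have km: "k \<in> elts (m (succ k))" using le[OF sk] by (auto simp: elts_succ)
    from nat_linear[OF t sk] have "ap (q t) k = ap (q (succ k)) k"
      using coh[OF sk] coh[OF t] k km by (auto simp: agree_def elts_succ[of t] elts_succ[of "succ k"])
    then show "ap (q t) k = ap x k" using x(2)[OF kw] by simp
  qed
  with x(1) that show thesis by blast
qed

subsection \<open>Continuous functionals\<close>

text \<open>
  A partial continuous functional is represented by the set of the triples \<open>(y,n,r)\<close> such that it
  outputs \<open>r\<close> on oracle \<open>y\<close> and input \<open>n\<close>; the output may be defined for some \<open>n\<close> only.
\<close>

definition val :: "'v \<Rightarrow> 'v \<Rightarrow> 'v \<Rightarrow> 'v \<Rightarrow> bool" where
  "val F y n r \<longleftrightarrow> triple y n r \<in> elts F"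

definition functional :: "'v \<Rightarrow> bool" where
  "functional F \<longleftrightarrow>
     (\<forall>z\<in>elts F. \<exists>y n r. z = triple y n r \<and> is_real y \<and> n \<in> elts omega \<and> r \<in> elts two) \<and>
     (\<forall>y n r. val F y n r \<longrightarrow>
        (\<exists>m\<in>elts omega. \<forall>y'. is_real y' \<and> agree y y' m \<longrightarrow> val F y' n r)) \<and>
     (\<forall>y n r r'. val F y n r \<and> val F y n r' \<longrightarrow> r = r')"

definition maps_to :: "'v \<Rightarrow> 'v \<Rightarrow> 'v \<Rightarrow> bool" where
  "maps_to F y x \<longleftrightarrow> (\<forall>n\<in>elts omega. val F y n (ap x n))"

lemma definable_val [definable_intros]:
  "definable_term t \<Longrightarrow> definable_term u \<Longrightarrow> definable_term v \<Longrightarrow> definable_term w \<Longrightarrow>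
   definable (\<lambda>e. val (t e) (u e) (v e) (w e))"
  unfolding val_def by (intro definable_intros)

lemma definable_functional0: "definable (\<lambda>e. functional (e 0))"
  unfolding functional_def by (intro definable_intros)

lemma definable_maps_to0: "definable (\<lambda>e. maps_to (e 0) (e 1) (e 2))"
  unfolding maps_to_def by (intro definable_intros)

lemmas definable_functional [definable_intros] = definable_comp1[OF definable_functional0]
lemmas definable_maps_to [definable_intros] = definable_comp3[OF definable_maps_to0]

lemma val_open:
  assumes "functional F" "val F y n r"
  obtains m where "m \<in> elts omega" "\<And>y'. is_real y' \<Longrightarrow> agree y y' m \<Longrightarrow> val F y' n r"
  using assms unfolding functional_def by blast

lemma val_unique: "functional F \<Longrightarrow> val F y n r \<Longrightarrow> val F y n r' \<Longrightarrow> r = r'"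
  unfolding functional_def by blast

lemma val_dom: "functional F \<Longrightarrow> val F y n r \<Longrightarrow> is_real y \<and> n \<in> elts omega \<and> r \<in> elts two"
  unfolding functional_def val_def by (metis triple_inject)

definition graph_of :: "('v \<Rightarrow> 'v \<Rightarrow> 'v \<Rightarrow> bool) \<Rightarrow> 'v" where
  "graph_of P = sep (times RR (times omega two)) (\<lambda>z. \<exists>y n r. z = triple y n r \<and> P y n r)"

lemma val_graph_of:
  assumes P: "definable (\<lambda>e. P (e 0) (e 1) (e 2))"
  shows "val (graph_of P) y n r \<longleftrightarrow> is_real y \<and> n \<in> elts omega \<and> r \<in> elts two \<and> P y n r"
proof -
  have "definable (\<lambda>e. \<exists>y n r. e 0 = triple y n r \<and> P y n r)"
    by (intro definable_intros definable_comp3[where P = P, OF P])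
  from elts_sep[where P = "\<lambda>z. \<exists>y n r. z = triple y n r \<and> P y n r", OF this]
  show ?thesis
    unfolding val_def graph_of_def by (auto simp: triple_def opair_inject elts_RR)
qed

lemma elts_graph_of:
  assumes P: "definable (\<lambda>e. P (e 0) (e 1) (e 2))" and "z \<in> elts (graph_of P)"
  shows "\<exists>y n r. z = triple y n r \<and> is_real y \<and> n \<in> elts omega \<and> r \<in> elts two"
proof -
  have "definable (\<lambda>e. \<exists>y n r. e 0 = triple y n r \<and> P y n r)"
    by (intro definable_intros definable_comp3[where P = P, OF P])
  from elts_sep[where P = "\<lambda>z. \<exists>y n r. z = triple y n r \<and> P y n r", OF this]
  obtain y n r where z: "z = triple y n r" using assms(2) unfolding graph_of_def by blast
  with assms(2) have "val (graph_of P) y n r" by (simp add: val_def)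
  with z show ?thesis unfolding val_graph_of[OF P] by blast
qed

lemma functional_graph_of:
  assumes P: "definable (\<lambda>e. P (e 0) (e 1) (e 2))"
    and opn: "\<And>y n r. is_real y \<Longrightarrow> n \<in> elts omega \<Longrightarrow> P y n r \<Longrightarrow>
        \<exists>m\<in>elts omega. \<forall>y'. is_real y' \<and> agree y y' m \<longrightarrow> P y' n r"
    and unique: "\<And>y n r r'. is_real y \<Longrightarrow> n \<in> elts omega \<Longrightarrow> P y n r \<Longrightarrow> P y n r' \<Longrightarrow> r = r'"
  shows "functional (graph_of P)"
  unfolding functional_def val_graph_of[OF P]
proof (intro conjI ballI allI impI)
  fix y n r assume *: "is_real y \<and> n \<in> elts omega \<and> r \<in> elts two \<and> P y n r"
  then obtain m where "m \<in> elts omega" "\<forall>y'. is_real y' \<and> agree y y' m \<longrightarrow> P y' n r"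
    using opn by blast
  with * show "\<exists>m\<in>elts omega. \<forall>y'. is_real y' \<and> agree y y' m \<longrightarrow>
      is_real y' \<and> n \<in> elts omega \<and> r \<in> elts two \<and> P y' n r"
    by blast
qed (use elts_graph_of[OF P] unique in blast)+

lemma definable_term_graph_of [definable_intros]:
  assumes "definable (\<lambda>e. P (\<lambda>i. e (Suc (Suc (Suc (Suc i))))) (e 2) (e 1) (e 0))"
  shows "definable_term (\<lambda>e. graph_of (\<lambda>y n r. P e y n r))"
  unfolding graph_of_def
  by (intro definable_intros) (use assms in \<open>simp add: numeral_2_eq_2\<close>)

definition idf :: 'v where
  "idf = graph_of (\<lambda>y n r. r = ap y n)"

lemma val_idf: "val idf y n r \<longleftrightarrow> is_real y \<and> n \<in> elts omega \<and> r = ap y n"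
proof -
  have d: "definable (\<lambda>e. e 2 = ap (e 0) (e 1))" by (intro definable_intros)
  show ?thesis
    unfolding idf_def val_graph_of[where P = "\<lambda>y n r. r = ap y n", OF d]
    using real_bit[of y n] by (auto simp: elts_two)
qed

lemma functional_idf: "functional idf"
  unfolding idf_def
proof (rule functional_graph_of)
  show "definable (\<lambda>e. e 2 = ap (e 0) (e 1))" by (intro definable_intros)
  show "\<exists>m\<in>elts omega. \<forall>y'. is_real y' \<and> agree y y' m \<longrightarrow> r = ap y' n"
    if "n \<in> elts omega" "r = ap y n" for y n r
    using that by (intro bexI[of _ "succ n"]) (auto simp: agree_def elts_succ succ_in_omega)
qed simp

lemma maps_to_idf: "is_real x \<Longrightarrow> maps_to idf x x"
  by (simp add: maps_to_def val_idf)

definition comp :: "'v \<Rightarrow> 'v \<Rightarrow> 'v" where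
  "comp G F = graph_of (\<lambda>y n r. \<exists>m\<in>elts omega. \<exists>w. is_real w \<and>
      (\<forall>i\<in>elts m. val F y i (ap w i)) \<and> (\<forall>w'. is_real w' \<and> agree w w' m \<longrightarrow> val G w' n r))"

lemma definable_term_comp0: "definable_term (\<lambda>e. comp (e 0) (e 1))"
  unfolding comp_def by (intro definable_intros)

lemma val_comp:
  "val (comp G F) y n r \<longleftrightarrow> is_real y \<and> n \<in> elts omega \<and> r \<in> elts two \<and>
     (\<exists>m\<in>elts omega. \<exists>w. is_real w \<and> (\<forall>i\<in>elts m. val F y i (ap w i)) \<and>
        (\<forall>w'. is_real w' \<and> agree w w' m \<longrightarrow> val G w' n r))"
  unfolding comp_def
  by (rule val_graph_of) (intro definable_intros)

text \<open>The computations of the first \<open>m\<close> output bits have a common bound on their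
  use, the maximum of the individual ones. The number \<open>m\<close> is finite only in the sense
  of the model, so the maximum is taken by induction.\<close>

lemma functional_use_bound:
  assumes F: "functional F" and m: "m \<in> elts omega" "\<And>i. i \<in> elts m \<Longrightarrow> val F y i (ap w i)"
  obtains l where "l \<in> elts omega"
    "\<And>y' i. is_real y' \<Longrightarrow> agree y y' l \<Longrightarrow> i \<in> elts m \<Longrightarrow> val F y' i (ap w i)"
proof -
  have "(\<forall>i\<in>elts m. val F y i (ap w i)) \<longrightarrow>
      (\<exists>l\<in>elts omega. \<forall>y'. is_real y' \<and> agree y y' l \<longrightarrow> (\<forall>i\<in>elts m. val F y' i (ap w i)))"
  proof (rule omega_induct[OF m(1)])
    fix n assume n: "n \<in> elts omega" and IH: "(\<forall>i\<in>elts n. val F y i (ap w i)) \<longrightarrow>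
      (\<exists>l\<in>elts omega. \<forall>y'. is_real y' \<and> agree y y' l \<longrightarrow> (\<forall>i\<in>elts n. val F y' i (ap w i)))"
    show "(\<forall>i\<in>elts (succ n). val F y i (ap w i)) \<longrightarrow>
      (\<exists>l\<in>elts omega. \<forall>y'. is_real y' \<and> agree y y' l \<longrightarrow> (\<forall>i\<in>elts (succ n). val F y' i (ap w i)))"
    proof
      assume *: "\<forall>i\<in>elts (succ n). val F y i (ap w i)"
      then obtain l where l: "l \<in> elts omega"
        "\<forall>y'. is_real y' \<and> agree y y' l \<longrightarrow> (\<forall>i\<in>elts n. val F y' i (ap w i))"
        using IH by (auto simp: elts_succ)
      have "val F y n (ap w n)" using * by (simp add: elts_succ)
      then obtain l' where l': "l' \<in> elts omega"
        "\<And>y'. is_real y' \<Longrightarrow> agree y y' l' \<Longrightarrow> val F y' n (ap w n)"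
        using val_open[OF F] by blast
      obtain k where "k \<in> elts omega" "elts l \<subseteq> elts k" "elts l' \<subseteq> elts k" using nat_max l(1) l'(1) by blast
      then show "\<exists>l\<in>elts omega. \<forall>y'. is_real y' \<and> agree y y' l \<longrightarrow> (\<forall>i\<in>elts (succ n). val F y' i (ap w i))"
        using l(2) l'(2) agree_mono by (intro bexI[of _ k]) (auto simp: elts_succ)
    qed
  next
    show "definable (\<lambda>e. (\<forall>i\<in>elts (e 0). val F y i (ap w i)) \<longrightarrow>
      (\<exists>l\<in>elts omega. \<forall>y'. is_real y' \<and> agree y y' l \<longrightarrow> (\<forall>i\<in>elts (e 0). val F y' i (ap w i))))"
      by (intro definable_intros)
  next
    show "(\<forall>i\<in>elts zero. val F y i (ap w i)) \<longrightarrow>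
      (\<exists>l\<in>elts omega. \<forall>y'. is_real y' \<and> agree y y' l \<longrightarrow> (\<forall>i\<in>elts zero. val F y' i (ap w i)))"
      using zero_in_omega unfolding elts_zero by blast
  qed
  with m(2) that show thesis by blast
qed

lemma functional_comp:
  assumes F: "functional F" and G: "functional G"
  shows "functional (comp G F)"
  unfolding comp_def
proof (rule functional_graph_of)
  show "definable (\<lambda>e. \<exists>m\<in>elts omega. \<exists>w. is_real w \<and> (\<forall>i\<in>elts m. val F (e 0) i (ap w i)) \<and>
      (\<forall>w'. is_real w' \<and> agree w w' m \<longrightarrow> val G w' (e 1) (e 2)))"
    by (intro definable_intros)
next
  fix y n r
  assume "\<exists>m\<in>elts omega. \<exists>w. is_real w \<and> (\<forall>i\<in>elts m. val F y i (ap w i)) \<and>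
      (\<forall>w'. is_real w' \<and> agree w w' m \<longrightarrow> val G w' n r)"
  then obtain m w where m: "m \<in> elts omega" "is_real w" "\<And>i. i \<in> elts m \<Longrightarrow> val F y i (ap w i)"
      "\<forall>w'. is_real w' \<and> agree w w' m \<longrightarrow> val G w' n r" by blast
  obtain l where "l \<in> elts omega"
    "\<And>y' i. is_real y' \<Longrightarrow> agree y y' l \<Longrightarrow> i \<in> elts m \<Longrightarrow> val F y' i (ap w i)"
    using functional_use_bound[OF F m(1,3)] by blast
  with m show "\<exists>l\<in>elts omega. \<forall>y'. is_real y' \<and> agree y y' l \<longrightarrow> (\<exists>m\<in>elts omega. \<exists>w. is_real w \<and>
      (\<forall>i\<in>elts m. val F y' i (ap w i)) \<and> (\<forall>w'. is_real w' \<and> agree w w' m \<longrightarrow> val G w' n r))"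
    by blast
next
  fix y n r r'
  assume "\<exists>m\<in>elts omega. \<exists>w. is_real w \<and> (\<forall>i\<in>elts m. val F y i (ap w i)) \<and>
      (\<forall>w'. is_real w' \<and> agree w w' m \<longrightarrow> val G w' n r)"
  then obtain m w where m: "m \<in> elts omega" "is_real w" "\<And>i. i \<in> elts m \<Longrightarrow> val F y i (ap w i)"
      "\<forall>w'. is_real w' \<and> agree w w' m \<longrightarrow> val G w' n r" by blast
  assume "\<exists>m\<in>elts omega. \<exists>w. is_real w \<and> (\<forall>i\<in>elts m. val F y i (ap w i)) \<and>
      (\<forall>w'. is_real w' \<and> agree w w' m \<longrightarrow> val G w' n r')"
  then obtain m' w' where m': "m' \<in> elts omega" "is_real w'" "\<And>i. i \<in> elts m' \<Longrightarrow> val F y i (ap w' i)"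
      "\<forall>w. is_real w \<and> agree w' w m' \<longrightarrow> val G w n r'" by blast
  \<comment> \<open>As \<open>F\<close> is single-valued, the shorter piece of intermediate output
    is an initial segment of the longer one; the intermediate real of the longer one gets both
    answers from \<open>G\<close>.\<close>
  from nat_subset_linear[OF m(1) m'(1)] show "r = r'"
  proof
    assume "elts m \<subseteq> elts m'"
    then have "agree w w' m" using m(3) m'(3) val_unique[OF F] unfolding agree_def by blast
    then show ?thesis using m(4) m' val_unique[OF G] agree_refl by blast
  next
    assume "elts m' \<subseteq> elts m"
    then have "agree w' w m'" using m(3) m'(3) val_unique[OF F] unfolding agree_def by blast
    then show ?thesis using m m'(4) val_unique[OF G] agree_refl by blast
  qed
qed

lemma maps_to_comp:
  assumes "functional F" "functional G" "is_real x" "is_real y" "is_real z" "maps_to F z y" "maps_to G y x"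
  shows "maps_to (comp G F) z x"
  unfolding maps_to_def
proof
  fix n assume n: "n \<in> elts omega"
  then have v: "val G y n (ap x n)" using assms by (simp add: maps_to_def)
  then obtain m where m: "m \<in> elts omega" "\<And>y'. is_real y' \<Longrightarrow> agree y y' m \<Longrightarrow> val G y' n (ap x n)"
    using val_open assms(2) by blast
  have "\<forall>i\<in>elts m. val F z i (ap y i)"
    using assms(6) m(1) in_omega_trans by (simp add: maps_to_def)
  then show "val (comp G F) z n (ap x n)"
    unfolding val_comp using assms n m val_dom[OF assms(2) v] by blast
qed

text \<open>By single-valuedness of \<open>F\<close>, the bits used by the composite are bits of
  \<open>y\<close>. This transfers convergence of a composite at \<open>z\<close> to convergence of
  the outer functional at \<open>y\<close>.\<close>

lemma val_comp_maps_to: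
  assumes "functional F" "is_real y" "maps_to F z y" "val (comp G F) z n r"
  shows "val G y n r"
proof -
  obtain m w where m: "m \<in> elts omega" "\<And>i. i \<in> elts m \<Longrightarrow> val F z i (ap w i)"
      "\<forall>w'. is_real w' \<and> agree w w' m \<longrightarrow> val G w' n r"
    using assms(4) unfolding val_comp by blast
  have "agree w y m"
    using m(2) assms(3) in_omega_trans[OF m(1)] val_unique[OF assms(1)]
    unfolding agree_def maps_to_def by blast
  with m(3) assms(2) show ?thesis by blast
qed

subsection \<open>Machine functionals\<close>

text \<open>From here the machine notions are restated with \<open>ap\<close> for \<open>app\<close>
  and with quantifiers in place of HOL sets, which makes them definable for all arguments. On runs
  of a machine both versions agree, since every application there stays within the domain of the
  function.\<close>

definition is_config :: "'v \<Rightarrow> 'v \<Rightarrow> 'v \<Rightarrow> bool" where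
  "is_config k s u \<longleftrightarrow> (\<exists>q\<in>elts k. \<exists>h\<in>elts omega. \<exists>t. func t (elts omega) (elts s) \<and> u = triple q h t)"

definition init :: "'v \<Rightarrow> 'v \<Rightarrow> bool" where
  "init n u \<longleftrightarrow> (\<exists>t. u = triple two zero t \<and>
     (\<forall>j\<in>elts omega. ap t j = (if j \<in> elts n then one else zero)))"

definition next_config :: "'v \<Rightarrow> 'v \<Rightarrow> 'v \<Rightarrow> 'v \<Rightarrow> bool" where
  "next_config d y u u' \<longleftrightarrow>
     (\<exists>q h t q' h' t' a v.
        u = triple q h t \<and> u' = triple q' h' t' \<and> q \<notin> elts two \<and>
        ap d (triple q (ap y h) (ap t h)) = triple q' a v \<and>
        (\<forall>j\<in>elts omega. ap t' j = (if j = h then a else ap t j)) \<and>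
        (v = one \<longrightarrow> h' = succ h) \<and>
        (v = zero \<longrightarrow> h = succ h' \<or> h = zero \<and> h' = zero))"

definition run :: "'v \<Rightarrow> 'v \<Rightarrow> 'v \<Rightarrow> 'v \<Rightarrow> 'v \<Rightarrow> 'v \<Rightarrow> 'v \<Rightarrow> bool" where
  "run k s d y n m c \<longleftrightarrow>
     (\<forall>z\<in>elts c. \<exists>i\<in>elts (succ m). \<exists>u. is_config k s u \<and> z = opair i u) \<and>
     (\<forall>i\<in>elts (succ m). \<exists>!u. opair i u \<in> elts c) \<and>
     init n (ap c zero) \<and> (\<forall>i\<in>elts m. next_config d y (ap c i) (ap c (succ i)))"

definition outputs :: "'v \<Rightarrow> 'v \<Rightarrow> 'v \<Rightarrow> 'v \<Rightarrow> 'v \<Rightarrow> 'v \<Rightarrow> bool" where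
  "outputs k s d y n r \<longleftrightarrow> r \<in> elts two \<and>
     (\<exists>m\<in>elts omega. \<exists>c. run k s d y n m c \<and> (\<exists>h t. ap c m = triple r h t))"

lemma definable_is_config0: "definable (\<lambda>e. is_config (e 0) (e 1) (e 2))"
  unfolding is_config_def by (intro definable_intros)

lemma definable_init0: "definable (\<lambda>e. init (e 0) (e 1))"
  unfolding init_def by (intro definable_intros)

lemma definable_next_config0: "definable (\<lambda>e. next_config (e 0) (e 1) (e 2) (e 3))"
  unfolding next_config_def by (intro definable_intros)

lemmas definable_is_config [definable_intros] = definable_comp3[OF definable_is_config0]
lemmas definable_init [definable_intros] = definable_comp2[OF definable_init0]
lemmas definable_next_config [definable_intros] = definable_comp4[OF definable_next_config0]

lemma is_config_iff: "is_config k s u \<longleftrightarrow> u \<in> configs k s"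
  unfolding is_config_def configs_def by blast

lemma run_func:
  "run k s d y n m c \<longleftrightarrow> func c (elts (succ m)) (configs k s) \<and> init n (ap c zero) \<and>
     (\<forall>i\<in>elts m. next_config d y (ap c i) (ap c (succ i)))"
  unfolding run_def func_def is_config_iff by blast

lemma machine_in_domain:
  assumes "oracle_machine k s d" "is_real y" "q \<in> elts k" "h \<in> elts omega" "func t (elts omega) (elts s)"
  shows "triple q (ap y h) (ap t h) \<in> {triple q b a | q b a. q \<in> elts k \<and> b \<in> elts two \<and> a \<in> elts s}"
  using assms ap_in[of y "elts omega" "elts two" h] ap_in[OF assms(5,4)] unfolding is_real_def by blast

lemma machine_func:
  assumes "oracle_machine k s d"
  shows "func d {triple q b a | q b a. q \<in> elts k \<and> b \<in> elts two \<and> a \<in> elts s}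
            {triple q a v | q a v. q \<in> elts k \<and> a \<in> elts s \<and> v \<in> elts two}"
  using assms by (simp add: oracle_machine_def)

lemma initial_config_iff:
  assumes "u \<in> configs k s"
  shows "initial_config n u \<longleftrightarrow> init n u"
proof -
  obtain q h t where u: "u = triple q h t" "func t (elts omega) (elts s)"
    using assms unfolding configs_def by blast
  show ?thesis
    unfolding initial_config_def init_def u(1) triple_inject using app_eq_ap[OF u(2)] by auto
qed

lemma next_config_triple:
  "next_config d y (triple q h t) (triple q' h' t') \<longleftrightarrow>
     (\<exists>a v. q \<notin> elts two \<and> ap d (triple q (ap y h) (ap t h)) = triple q' a v \<and>
        (\<forall>j\<in>elts omega. ap t' j = (if j = h then a else ap t j)) \<and>
        (v = one \<longrightarrow> h' = succ h) \<and> (v = zero \<longrightarrow> h = succ h' \<or> h = zero \<and> h' = zero))"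
  unfolding next_config_def triple_inject by blast

lemma step_triple:
  "step d y (triple q h t) (triple q' h' t') \<longleftrightarrow>
     (\<exists>a v. q \<notin> elts two \<and> app d (triple q (app y h) (app t h)) = triple q' a v \<and>
        (\<forall>j\<in>elts omega. app t' j = (if j = h then a else app t j)) \<and>
        (v = one \<longrightarrow> h' = succ h) \<and> (v = zero \<longrightarrow> h = succ h' \<or> h = zero \<and> h' = zero))"
  unfolding step_def triple_inject by blast

lemma step_iff:
  assumes "oracle_machine k s d" "is_real y" "u \<in> configs k s" "u' \<in> configs k s"
  shows "step d y u u' \<longleftrightarrow> next_config d y u u'"
proof -
  obtain q h t where u: "u = triple q h t" "q \<in> elts k" "h \<in> elts omega" "func t (elts omega) (elts s)"
    using assms(3) unfolding configs_def by blast
  obtain q' h' t' where u': "u' = triple q' h' t'" "func t' (elts omega) (elts s)"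
    using assms(4) unfolding configs_def by blast
  have 1: "app t j = ap t j" "app t' j = ap t' j" if "j \<in> elts omega" for j
    using app_eq_ap[OF u(4) that] app_eq_ap[OF u'(2) that] by auto
  have 2: "app d (triple q (ap y h) (ap t h)) = ap d (triple q (ap y h) (ap t h))"
    by (rule app_eq_ap[OF machine_func[OF assms(1)] machine_in_domain[OF assms(1,2) u(2-4)]])
  have 3: "app y h = ap y h" using app_real[OF assms(2) u(3)] .
  show ?thesis
    unfolding u(1) u'(1) step_triple next_config_triple 3 1(1)[OF u(3)] 2
    using 1 by auto
qed

lemma machine_output_iff:
  assumes "oracle_machine k s d" "is_real y"
  shows "machine_output k s d y n r \<longleftrightarrow> outputs k s d y n r"
proof -
  have "func c (elts (succ m)) (configs k s) \<and> initial_config n (app c zero) \<and>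
        (\<forall>i\<in>elts m. step d y (app c i) (app c (succ i))) \<and> (\<exists>h t. app c m = triple r h t) \<longleftrightarrow>
      run k s d y n m c \<and> (\<exists>h t. ap c m = triple r h t)" if m: "m \<in> elts omega" for m c
  proof (cases "func c (elts (succ m)) (configs k s)")
    case True
    have c: "app c i = ap c i" "ap c i \<in> configs k s" if "i \<in> elts (succ m)" for i
      using app_eq_ap[OF True that] ap_in[OF True that] by auto
    have i: "i \<in> elts (succ m)" "succ i \<in> elts (succ m)" if "i \<in> elts m" for i
      using that succ_in_succ[OF m] by (auto simp: elts_succ)
    have "(\<forall>i\<in>elts m. step d y (app c i) (app c (succ i))) \<longleftrightarrow>
          (\<forall>i\<in>elts m. next_config d y (ap c i) (ap c (succ i)))"
      using step_iff[OF assms] c i by simp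
    moreover have "initial_config n (app c zero) \<longleftrightarrow> init n (ap c zero)"
      using initial_config_iff[OF c(2)] c(1) zero_in_succ[OF m] by simp
    moreover have "app c m = ap c m" using c by (simp add: elts_succ)
    ultimately show ?thesis unfolding run_func using True by simp
  qed (simp add: run_func)
  then show ?thesis unfolding machine_output_def outputs_def by blast
qed

section \<open>Runs are deterministic and use finitely many oracle bits\<close>

lemma next_configE:
  assumes "next_config d y u u'" "oracle_machine k s d" "is_real y" "u \<in> configs k s" "u' \<in> configs k s"
  obtains q h t q' h' t' a v where "u = triple q h t" "u' = triple q' h' t'" "q \<notin> elts two"
    "h \<in> elts omega" "h' \<in> elts omega"
    "func t' (elts omega) (elts s)"
    "ap d (triple q (ap y h) (ap t h)) = triple q' a v"
    "\<forall>j\<in>elts omega. ap t' j = (if j = h then a else ap t j)"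
    "v = one \<and> h' = succ h \<or> v = zero \<and> (h = succ h' \<or> h = zero \<and> h' = zero)"
proof -
  obtain q h t q' h' t' a v where *: "u = triple q h t" "u' = triple q' h' t'" "q \<notin> elts two"
    "ap d (triple q (ap y h) (ap t h)) = triple q' a v"
    "\<forall>j\<in>elts omega. ap t' j = (if j = h then a else ap t j)"
    "v = one \<longrightarrow> h' = succ h" "v = zero \<longrightarrow> h = succ h' \<or> h = zero \<and> h' = zero"
    using assms(1) unfolding next_config_def by blast
  have u: "q \<in> elts k" "h \<in> elts omega" "func t (elts omega) (elts s)"
    using assms(4) unfolding *(1) configs_def by (auto simp: triple_inject)
  have u': "h' \<in> elts omega" "func t' (elts omega) (elts s)"
    using assms(5) unfolding *(2) configs_def by (auto simp: triple_inject)
  have "triple q' a v \<in> {triple q a v | q a v. q \<in> elts k \<and> a \<in> elts s \<and> v \<in> elts two}"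
    using ap_in[OF machine_func[OF assms(2)] machine_in_domain[OF assms(2,3) u]] *(4) by simp
  \<comment> \<open>The typing of the table leaves only these two moves, so the two implications
    about \<open>v\<close> determine the new head position.\<close>
  then have v: "v = zero \<or> v = one" by (auto simp: triple_inject elts_two)
  show thesis
  proof (rule that[OF *(1-3) u(2) u' *(4)])
    show "\<forall>j\<in>elts omega. ap t' j = (if j = h then a else ap t j)" by (rule *(5))
    show "v = one \<and> h' = succ h \<or> v = zero \<and> (h = succ h' \<or> h = zero \<and> h' = zero)"
      using *(6,7) v by blast
  qed
qed

lemma next_config_unique:
  assumes "next_config d y u u'" "next_config d y u u''" "oracle_machine k s d" "is_real y"
    "u \<in> configs k s" "u' \<in> configs k s" "u'' \<in> configs k s"
  shows "u' = u''"
proof -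
  obtain q h t q' h' t' a v where *: "u = triple q h t" "u' = triple q' h' t'"
    and "q \<notin> elts two" "h \<in> elts omega" "h' \<in> elts omega" and step1: "func t' (elts omega) (elts s)"
    "ap d (triple q (ap y h) (ap t h)) = triple q' a v"
    "\<forall>j\<in>elts omega. ap t' j = (if j = h then a else ap t j)"
    "v = one \<and> h' = succ h \<or> v = zero \<and> (h = succ h' \<or> h = zero \<and> h' = zero)"
    using assms(1,3,4,5,6) by (rule next_configE)
  obtain p i w q'' h'' t'' a' v' where u2: "u = triple p i w" "u'' = triple q'' h'' t''"
    and "p \<notin> elts two" "i \<in> elts omega" "h'' \<in> elts omega" and step2: "func t'' (elts omega) (elts s)"
    "ap d (triple p (ap y i) (ap w i)) = triple q'' a' v'"
    "\<forall>j\<in>elts omega. ap t'' j = (if j = i then a' else ap w j)"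
    "v' = one \<and> h'' = succ i \<or> v' = zero \<and> (i = succ h'' \<or> i = zero \<and> h'' = zero)"
    using assms(2,3,4,5,7) by (rule next_configE)
  have e: "p = q" "i = h" "w = t" using *(1) u2(1) by (auto simp: triple_inject)
  have e': "q'' = q'" "a' = a" "v' = v" using step1(2) step2(2) unfolding e by (auto simp: triple_inject)
  have "t' = t''" using step1(1) step2(1) by (rule func_eqI) (use step1(3) step2(3) in \<open>simp add: e e'\<close>)
  moreover have "h' = h''" using step1(4) step2(4) unfolding e e' by (auto simp: succ_inject)
  ultimately show ?thesis using *(2) u2(2) e' by simp
qed

lemma init_unique:
  assumes "init n u" "init n u'" "u \<in> configs k s" "u' \<in> configs k s"
  shows "u = u'"
proof -
  obtain t where t: "u = triple two zero t" "\<forall>j\<in>elts omega. ap t j = (if j \<in> elts n then one else zero)"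
    using assms(1) unfolding init_def by blast
  obtain t' where t': "u' = triple two zero t'" "\<forall>j\<in>elts omega. ap t' j = (if j \<in> elts n then one else zero)"
    using assms(2) unfolding init_def by blast
  have "func t (elts omega) (elts s)" "func t' (elts omega) (elts s)"
    using assms(3,4) unfolding t(1) t'(1) configs_def by (auto simp: triple_inject)
  then have "t = t'" by (rule func_eqI) (simp add: t(2) t'(2))
  then show ?thesis by (simp add: t t')
qed

text \<open>Two runs coincide as long as both last, because steps are deterministic. They have the
  same length because a halting state has no successor.\<close>

lemma outputs_unique:
  assumes M: "oracle_machine k s d" "is_real y" and "outputs k s d y n r" "outputs k s d y n r'"
  shows "r = r'"
proof -
  obtain m c h t where m: "m \<in> elts omega" "run k s d y n m c" "ap c m = triple r h t" "r \<in> elts two"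
    using assms(3) unfolding outputs_def by blast
  obtain m' c' h' t' where m': "m' \<in> elts omega" "run k s d y n m' c'" "ap c' m' = triple r' h' t'" "r' \<in> elts two"
    using assms(4) unfolding outputs_def by blast
  have c: "func c (elts (succ m)) (configs k s)" and c': "func c' (elts (succ m')) (configs k s)"
    using m(2) m'(2) unfolding run_func by auto
  have same: "i \<in> elts (succ m) \<and> i \<in> elts (succ m') \<longrightarrow> ap c i = ap c' i" if "i \<in> elts omega" for i
  proof (rule omega_induct[OF that])
    show "definable (\<lambda>e. e 0 \<in> elts (succ m) \<and> e 0 \<in> elts (succ m') \<longrightarrow> ap c (e 0) = ap c' (e 0))"
      by (intro definable_intros)
    show "zero \<in> elts (succ m) \<and> zero \<in> elts (succ m') \<longrightarrow> ap c zero = ap c' zero"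
      using init_unique ap_in[OF c] ap_in[OF c'] m(2) m'(2) unfolding run_func by blast
    fix i assume i: "i \<in> elts omega" and IH: "i \<in> elts (succ m) \<and> i \<in> elts (succ m') \<longrightarrow> ap c i = ap c' i"
    show "succ i \<in> elts (succ m) \<and> succ i \<in> elts (succ m') \<longrightarrow> ap c (succ i) = ap c' (succ i)"
    proof
      assume s: "succ i \<in> elts (succ m) \<and> succ i \<in> elts (succ m')"
      then have im: "i \<in> elts m" "i \<in> elts m'" using succ_in_succ_iff[OF i] m(1) m'(1) by auto
      then have im': "i \<in> elts (succ m)" "i \<in> elts (succ m')" by (auto simp: elts_succ)
      have eq: "ap c i = ap c' i" using IH im' by blast
      have "next_config d y (ap c i) (ap c (succ i))"
        using m(2) im(1) unfolding run_func by blast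
      moreover have "next_config d y (ap c i) (ap c' (succ i))"
        using m'(2) im(2) unfolding run_func eq by blast
      ultimately show "ap c (succ i) = ap c' (succ i)"
        using next_config_unique M ap_in[OF c] ap_in[OF c'] im' s by blast
    qed
  qed
  have halt: "\<not> next_config d y (triple r h t) u" if "r \<in> elts two" for r h t u
    using that by (auto simp: next_config_def triple_inject)
  have "m = m'"
    using nat_linear[OF m(1) m'(1)]
  proof (elim disjE)
    assume "m \<in> elts m'"
    then have "next_config d y (ap c m) (ap c' (succ m))" "m \<in> elts (succ m')"
      using same[OF m(1)] m'(2) by (auto simp: run_func elts_succ)
    then show ?thesis using m(3,4) halt by simp
  next
    assume "m' \<in> elts m"
    then have "next_config d y (ap c' m') (ap c (succ m'))" "m' \<in> elts (succ m)"
      using same[OF m'(1)] m(2) by (auto simp: run_func elts_succ)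
    then show ?thesis using m'(3,4) halt by simp
  qed simp
  then show ?thesis
    using same[OF m(1)] m(3) m'(3) by (simp add: elts_succ triple_inject)
qed

text \<open>After \<open>i\<close> steps the head has moved at most \<open>i\<close> cells, so \<open>m\<close> steps use only \<open>m\<close> oracle bits.\<close>

lemma outputs_open:
  assumes M: "oracle_machine k s d" "is_real y" and "outputs k s d y n r"
  shows "\<exists>m\<in>elts omega. \<forall>y'. is_real y' \<and> agree y y' m \<longrightarrow> outputs k s d y' n r"
proof -
  obtain m c h t where m: "m \<in> elts omega" "run k s d y n m c" "ap c m = triple r h t" "r \<in> elts two"
    using assms(3) unfolding outputs_def by blast
  have c: "func c (elts (succ m)) (configs k s)" and c0: "init n (ap c zero)"
    and cs: "\<And>i. i \<in> elts m \<Longrightarrow> next_config d y (ap c i) (ap c (succ i))"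
    using m(2) unfolding run_func by auto
  have head: "i \<in> elts (succ m) \<longrightarrow> (\<exists>q h t. ap c i = triple q h t \<and> elts h \<subseteq> elts i)"
    if "i \<in> elts omega" for i
  proof (rule omega_induct[OF that])
    show "zero \<in> elts (succ m) \<longrightarrow> (\<exists>q h t. ap c zero = triple q h t \<and> elts h \<subseteq> elts zero)"
      using c0 unfolding init_def by blast
    fix i assume i: "i \<in> elts omega"
      and IH: "i \<in> elts (succ m) \<longrightarrow> (\<exists>q h t. ap c i = triple q h t \<and> elts h \<subseteq> elts i)"
    show "succ i \<in> elts (succ m) \<longrightarrow> (\<exists>q h t. ap c (succ i) = triple q h t \<and> elts h \<subseteq> elts (succ i))"
    proof
      assume s: "succ i \<in> elts (succ m)"
      then have im: "i \<in> elts m" using succ_in_succ_iff[OF i m(1)] by simp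
      then have im': "i \<in> elts (succ m)" by (simp add: elts_succ)
      obtain q h t q' h' t' a v where *: "ap c i = triple q h t" "ap c (succ i) = triple q' h' t'"
        and "q \<notin> elts two" and **: "h \<in> elts omega" and "h' \<in> elts omega"
        "func t' (elts omega) (elts s)" "ap d (triple q (ap y h) (ap t h)) = triple q' a v"
        "\<forall>j\<in>elts omega. ap t' j = (if j = h then a else ap t j)"
        and move: "v = one \<and> h' = succ h \<or> v = zero \<and> (h = succ h' \<or> h = zero \<and> h' = zero)"
        using cs[OF im] M ap_in[OF c im'] ap_in[OF c s] by (rule next_configE)
      have h: "elts h \<subseteq> elts i" using IH im' *(1) by (auto simp: triple_inject)
      then have hi: "h = i \<or> h \<in> elts i" using nat_subset_iff[OF ** i] by blast
      from move have "elts h' \<subseteq> elts (succ i)"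
      proof (elim disjE conjE)
        assume "h' = succ h"
        then show ?thesis using h hi by (auto simp: elts_succ)
      next
        assume "h = succ h'"
        then show ?thesis using h by (auto simp: elts_succ)
      qed (simp add: elts_zero)
      with *(2) show "\<exists>q h t. ap c (succ i) = triple q h t \<and> elts h \<subseteq> elts (succ i)" by blast
    qed
  qed (intro definable_intros)
  have "outputs k s d y' n r" if y': "is_real y'" "agree y y' m" for y'
  proof -
    have "next_config d y' (ap c i) (ap c (succ i))" if i: "i \<in> elts m" for i
    proof -
      have iw: "i \<in> elts omega" using in_omega_trans[OF m(1) i] .
      have i': "i \<in> elts (succ m)" "succ i \<in> elts (succ m)"
        using i succ_in_succ[OF m(1)] by (auto simp: elts_succ)
      obtain q h t where q: "ap c i = triple q h t" "elts h \<subseteq> elts i" using head[OF iw] i' by blast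
      have "h \<in> elts omega"
        using ap_in[OF c i'(1)] unfolding q(1) configs_def by (auto simp: triple_inject)
      then have "h = i \<or> h \<in> elts i" using nat_subset_iff iw q(2) by blast
      then have "h \<in> elts m" using i nat_less_trans[OF m(1) i] by blast
      then have "ap y' h = ap y h" using y'(2) by (simp add: agree_def)
      then show ?thesis using cs[OF i] unfolding q(1) next_config_def triple_inject by auto
    qed
    then have "run k s d y' n m c" unfolding run_func using c c0 by blast
    then show ?thesis unfolding outputs_def using m by blast
  qed
  with m(1) show ?thesis by blast
qed

definition machine_functional :: "'v \<Rightarrow> 'v" where
  "machine_functional p = graph_of (\<lambda>y n r. outputs (pr1 p) (pr1 (pr2 p)) (pr2 (pr2 p)) y n r)"

lemma definable_term_machine_functional0: "definable_term (\<lambda>e. machine_functional (e 0))"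
  unfolding machine_functional_def outputs_def run_def by (intro definable_intros)

lemma definable_outputs: "definable (\<lambda>e. outputs k s d (e 0) (e 1) (e 2))"
  unfolding outputs_def run_def by (intro definable_intros)

lemma machine_functional_triple: "machine_functional (triple k s d) = graph_of (outputs k s d)"
  by (simp add: machine_functional_def triple_def)

lemma functional_machine_functional:
  "oracle_machine k s d \<Longrightarrow> functional (machine_functional (triple k s d))"
  unfolding machine_functional_triple
  by (rule functional_graph_of[OF definable_outputs]) (blast intro: outputs_open outputs_unique)+

lemma turing_le_maps_to:
  assumes "turing_le x y"
  shows "\<exists>k s d. oracle_machine k s d \<and> maps_to (machine_functional (triple k s d)) y x"
proof -
  obtain k s d where *: "is_real x" "is_real y" "oracle_machine k s d"
    "\<And>n. n \<in> elts omega \<Longrightarrow> machine_output k s d y n (app x n)"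
    using assms unfolding turing_le_def by blast
  then have "outputs k s d y n (ap x n)" if "n \<in> elts omega" for n
    using that machine_output_iff app_real by metis
  then have "maps_to (machine_functional (triple k s d)) y x"
    unfolding maps_to_def machine_functional_triple val_graph_of[OF definable_outputs]
    using * by (auto simp: outputs_def)
  with * show ?thesis by blast
qed

subsection \<open>Enumerating the machines\<close>

text \<open>Finiteness is meant in the model, so the union is assembled by induction on
  \<open>n\<close>. Used three times in a row, for the three components of an argument of a
  table.\<close>

lemma finite_union_closed:
  assumes P: "definable (\<lambda>e. P (e 0) (e 1))" and n: "n \<in> elts omega" and W: "zero \<in> elts W"
    "\<And>x y. x \<in> elts W \<Longrightarrow> y \<in> elts W \<Longrightarrow> join x y \<in> elts W"
    and pieces: "\<And>q. q \<in> elts n \<Longrightarrow> \<exists>w\<in>elts W. \<forall>z. z \<in> elts w \<longleftrightarrow> P q z"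
  shows "\<exists>w\<in>elts W. \<forall>z. z \<in> elts w \<longleftrightarrow> (\<exists>q\<in>elts n. P q z)"
proof -
  note [definable_intros] = definable_comp2[where P = P, OF P]
  have "(\<forall>q\<in>elts n. \<exists>w\<in>elts W. \<forall>z. z \<in> elts w \<longleftrightarrow> P q z) \<longrightarrow>
    (\<exists>w\<in>elts W. \<forall>z. z \<in> elts w \<longleftrightarrow> (\<exists>q\<in>elts n. P q z))"
  proof (rule omega_induct[OF n])
    fix n assume IH: "(\<forall>q\<in>elts n. \<exists>w\<in>elts W. \<forall>z. z \<in> elts w \<longleftrightarrow> P q z) \<longrightarrow>
      (\<exists>w\<in>elts W. \<forall>z. z \<in> elts w \<longleftrightarrow> (\<exists>q\<in>elts n. P q z))"
    show "(\<forall>q\<in>elts (succ n). \<exists>w\<in>elts W. \<forall>z. z \<in> elts w \<longleftrightarrow> P q z) \<longrightarrow>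
      (\<exists>w\<in>elts W. \<forall>z. z \<in> elts w \<longleftrightarrow> (\<exists>q\<in>elts (succ n). P q z))"
    proof
      assume *: "\<forall>q\<in>elts (succ n). \<exists>w\<in>elts W. \<forall>z. z \<in> elts w \<longleftrightarrow> P q z"
      then have "\<forall>q\<in>elts n. \<exists>w\<in>elts W. \<forall>z. z \<in> elts w \<longleftrightarrow> P q z" by (simp add: elts_succ)
      with IH obtain w where w: "w \<in> elts W" "\<forall>z. z \<in> elts w \<longleftrightarrow> (\<exists>q\<in>elts n. P q z)" by blast
      have "\<exists>w\<in>elts W. \<forall>z. z \<in> elts w \<longleftrightarrow> P n z" using * by (simp add: elts_succ)
      then obtain w' where w': "w' \<in> elts W" "\<forall>z. z \<in> elts w' \<longleftrightarrow> P n z" by blast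
      show "\<exists>w\<in>elts W. \<forall>z. z \<in> elts w \<longleftrightarrow> (\<exists>q\<in>elts (succ n). P q z)"
        using W(2)[OF w(1) w'(1)] w(2) w'(2)
        by (intro bexI[of _ "join w w'"]) (simp_all add: elts_join elts_succ, blast)
    qed
  next
    show "definable (\<lambda>e. (\<forall>q\<in>elts (e 0). \<exists>w\<in>elts W. \<forall>z. z \<in> elts w \<longleftrightarrow> P q z) \<longrightarrow>
      (\<exists>w\<in>elts W. \<forall>z. z \<in> elts w \<longleftrightarrow> (\<exists>q\<in>elts (e 0). P q z)))"
      by (intro definable_intros)
  next
    show "(\<forall>q\<in>elts zero. \<exists>w\<in>elts W. \<forall>z. z \<in> elts w \<longleftrightarrow> P q z) \<longrightarrow>
      (\<exists>w\<in>elts W. \<forall>z. z \<in> elts w \<longleftrightarrow> (\<exists>q\<in>elts zero. P q z))"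
      using W(1) elts_zero by auto
  qed
  with pieces show ?thesis by blast
qed

text \<open>A table is a finite set of entries, so it lies in the closure of the empty set and the
  singletons of entries under binary union. This avoids coding finite sets by numbers.\<close>

lemma enumerable_machines:
  obtains C where "enumerable C" "\<And>k s d. oracle_machine k s d \<Longrightarrow> triple k s d \<in> elts C"
proof -
  \<comment> \<open>Possible entries of tables: argument and value are both triples of
    numbers.\<close>
  define D where "D = times (times omega (times omega omega)) (times omega (times omega omega))"
  have D: "enumerable D"
    unfolding D_def by (intro enumerable_times enumerable_omega)
  have sing: "definable_term (\<lambda>e. upair (e 0) (e 0))" by (intro definable_intros)
  define S where "S = join (upair zero zero) (img D (\<lambda>z. upair z z))"
  have S: "elts S = insert zero ((\<lambda>z. upair z z) ` elts D)"
    unfolding S_def elts_join elts_img[OF sing] by (simp add: elts_upair)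
  have "elts S \<subseteq> elts (pow D)" unfolding S by (auto simp: elts_pow elts_upair elts_zero)
  moreover have "enumerable S"
    unfolding S_def
  proof (intro enumerable_join)
    show "enumerable (img D (\<lambda>z. upair z z))"
      by (rule enumerable_image[OF D sing]) (simp add: elts_img[OF sing])
    show "enumerable (upair zero zero)" by (rule enumerable_singleton)
  qed
  moreover have "zero \<in> elts S" by (simp add: S)
  moreover have "join x y \<in> elts (pow D)" if "x \<in> elts (pow D)" "y \<in> elts (pow D)" for x y
    using that by (simp add: elts_pow elts_join)
  ultimately obtain W where W: "elts S \<subseteq> elts W" "enumerable W"
    "\<And>x y. x \<in> elts W \<Longrightarrow> y \<in> elts W \<Longrightarrow> join x y \<in> elts W"
    using enumerable_closure[OF definable_term_join0, of "pow D" S zero] by metis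
  have zW: "zero \<in> elts W" using W(1) by (auto simp: S)
  have "d \<in> elts W" if M: "oracle_machine k s d" for k s d
  proof -
    have ks: "k \<in> elts omega" "s \<in> elts omega" using M by (auto simp: oracle_machine_def)
    note d = machine_func[OF M]
    have piece: "\<exists>w\<in>elts W. \<forall>z. z \<in> elts w \<longleftrightarrow> z \<in> elts d \<and> (\<exists>y. z = opair (triple q b a) y)"
      if qba: "q \<in> elts k" "b \<in> elts two" "a \<in> elts s" for q b a
    proof -
      let ?x = "triple q b a"
      have x: "?x \<in> {triple q b a | q b a. q \<in> elts k \<and> b \<in> elts two \<and> a \<in> elts s}" using qba by blast
      obtain q' a' v where v: "ap d ?x = triple q' a' v" "q' \<in> elts k" "a' \<in> elts s" "v \<in> elts two"
        using ap_in[OF d x] by blast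
      have "opair ?x (ap d ?x) \<in> elts D"
        unfolding v(1) unfolding D_def triple_def
        using qba v ks in_omega_trans two_in_omega by (simp; blast)
      then have "upair (opair ?x (ap d ?x)) (opair ?x (ap d ?x)) \<in> elts W"
        using W(1) by (auto simp: S)
      moreover have "z = opair ?x (ap d ?x) \<longleftrightarrow> z \<in> elts d \<and> (\<exists>y. z = opair ?x y)" for z
        using ap_eq_iff[OF d x] by metis
      ultimately show ?thesis
        by (intro bexI[of _ "upair (opair ?x (ap d ?x)) (opair ?x (ap d ?x))"]) (simp_all add: elts_upair)
    qed
    have "\<exists>w\<in>elts W. \<forall>z. z \<in> elts w \<longleftrightarrow>
      (\<exists>q\<in>elts k. \<exists>b\<in>elts two. \<exists>a\<in>elts s. z \<in> elts d \<and> (\<exists>y. z = opair (triple q b a) y))"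
      by (intro finite_union_closed ks two_in_omega zW W(3) piece definable_intros)
    then obtain w where w: "w \<in> elts W" "\<And>z. z \<in> elts w \<longleftrightarrow>
      (\<exists>q\<in>elts k. \<exists>b\<in>elts two. \<exists>a\<in>elts s. z \<in> elts d \<and> (\<exists>y. z = opair (triple q b a) y))"
      by blast
    have "w = d"
      unfolding eq_iff_elts[of w] w(2) using d unfolding func_def by blast
    with w(1) show ?thesis by simp
  qed
  then have "triple k s d \<in> elts (times omega (times omega W))" if "oracle_machine k s d" for k s d
    using that by (simp add: triple_def oracle_machine_def)
  moreover have "enumerable (times omega (times omega W))"
    by (intro enumerable_times enumerable_omega W)
  ultimately show thesis using that by blast
qed

lemma functional_semigroup:
  obtains M where "enumerable M" "\<forall>F\<in>elts M. functional F" "idf \<in> elts M"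
    "\<forall>F\<in>elts M. \<forall>G\<in>elts M. comp G F \<in> elts M"
    "\<forall>x y. turing_le x y \<longrightarrow> (\<exists>F\<in>elts M. maps_to F y x)"
proof -
  define X where "X = sep (pow (times RR (times omega two))) functional"
  have X: "F \<in> elts X \<longleftrightarrow> functional F" for F
    unfolding X_def elts_sep[OF definable_functional0] elts_pow
    by (auto simp: functional_def triple_def elts_RR)
  obtain C where C: "enumerable C" "\<And>k s d. oracle_machine k s d \<Longrightarrow> triple k s d \<in> elts C"
    using enumerable_machines by metis
  note df = definable_term_machine_functional0
  have dC: "definable (\<lambda>e. functional (machine_functional (e 0)))"
    by (intro definable_intros df)
  \<comment> \<open>\<open>C\<close> may contain triples that are not machines. Filtering by the
    value being a functional keeps all machines and uses a property already known to be
    definable.\<close>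
  define C' where "C' = sep C (\<lambda>p. functional (machine_functional p))"
  have C': "elts C' = {p \<in> elts C. functional (machine_functional p)}"
    unfolding C'_def by (rule elts_sep[OF dC])
  define S where "S = join (upair idf idf) (img C' machine_functional)"
  have S: "elts S = insert idf (machine_functional ` elts C')"
    unfolding S_def elts_join elts_img[OF df] by (simp add: elts_upair)
  have "elts S \<subseteq> elts X" by (auto simp: S C' X functional_idf)
  moreover have "enumerable S"
    unfolding S_def
  proof (intro enumerable_join)
    show "enumerable (img C' machine_functional)"
      by (rule enumerable_image[OF C(1) df]) (auto simp: elts_img[OF df] C')
    show "enumerable (upair idf idf)" by (rule enumerable_singleton)
  qed
  moreover have "idf \<in> elts S" by (simp add: S)
  moreover have "comp x y \<in> elts X" if "x \<in> elts X" "y \<in> elts X" for x y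
    using that functional_comp by (simp add: X)
  ultimately obtain M where M: "elts S \<subseteq> elts M" "elts M \<subseteq> elts X" "enumerable M"
    "\<And>x y. x \<in> elts M \<Longrightarrow> y \<in> elts M \<Longrightarrow> comp x y \<in> elts M"
    using enumerable_closure[OF definable_term_comp0, of X S idf] by metis
  show thesis
  proof
    show "\<forall>x y. turing_le x y \<longrightarrow> (\<exists>F\<in>elts M. maps_to F y x)"
    proof (intro allI impI)
      fix x y assume le: "turing_le x y"
      obtain k s d where *: "oracle_machine k s d" "maps_to (machine_functional (triple k s d)) y x"
        using turing_le_maps_to[OF le] by blast
      then have "machine_functional (triple k s d) \<in> elts S"
        unfolding S C' using C(2) functional_machine_functional by blast
      with * M(1) show "\<exists>F\<in>elts M. maps_to F y x" by blast
    qed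
  qed (use M S X in auto)
qed

subsection \<open>Dense requirements on pairs of reals\<close>

definition update :: "'v \<Rightarrow> 'v \<Rightarrow> 'v \<Rightarrow> 'v" where
  "update x p b = lam omega (\<lambda>k. if k = p then b else ap x k)"

lemma definable_term_update0: "definable_term (\<lambda>e. update (e 0) (e 1) (e 2))"
  unfolding update_def by (intro definable_intros)

lemmas definable_term_update [definable_intros] = definable_term_comp3[OF definable_term_update0]

lemma
  assumes "is_real x" "b \<in> elts two"
  shows real_update: "is_real (update x p b)"
    and ap_update: "k \<in> elts omega \<Longrightarrow> ap (update x p b) k = (if k = p then b else ap x k)"
proof -
  have d: "definable_term (\<lambda>e. if e 0 = p then b else ap x (e 0))" by (intro definable_intros)
  have "\<forall>n\<in>elts omega. (if n = p then b else ap x n) = zero \<or> (if n = p then b else ap x n) = one"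
    using assms real_bit by (simp add: elts_two)
  note * = real_lam[where f = "\<lambda>k. if k = p then b else ap x k", OF d this]
  show "is_real (update x p b)" unfolding update_def by (rule *(1))
  show "ap (update x p b) k = (if k = p then b else ap x k)" if "k \<in> elts omega"
    unfolding update_def using that by (rule *(2))
qed

text \<open>
  \<open>K l v v'\<close> says that the pair \<open>(v,v')\<close> meets a requirement already because of its first \<open>l\<close> bits.
\<close>

definition dense_req :: "('v \<Rightarrow> 'v \<Rightarrow> 'v \<Rightarrow> bool) \<Rightarrow> bool" where
  "dense_req K \<longleftrightarrow>
     (\<forall>l\<in>elts omega. \<forall>l'\<in>elts omega. \<forall>v v'. is_real v \<and> is_real v' \<and> elts l \<subseteq> elts l' \<and> K l v v' \<longrightarrow> K l' v v') \<and>
     (\<forall>l\<in>elts omega. \<forall>v v' u u'. is_real v \<and> is_real v' \<and> is_real u \<and> is_real u' \<and>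
        agree v u l \<and> agree v' u' l \<and> K l v v' \<longrightarrow> K l u u') \<and>
     (\<forall>m\<in>elts omega. \<forall>v v'. is_real v \<and> is_real v' \<longrightarrow>
        (\<exists>l\<in>elts omega. \<exists>w w'. is_real w \<and> is_real w' \<and> elts m \<subseteq> elts l \<and>
           agree v w m \<and> agree v' w' m \<and> K l w w'))"

lemma dense_reqI:
  assumes "\<And>l l' v v'. l \<in> elts omega \<Longrightarrow> l' \<in> elts omega \<Longrightarrow> is_real v \<Longrightarrow> is_real v' \<Longrightarrow>
      elts l \<subseteq> elts l' \<Longrightarrow> K l v v' \<Longrightarrow> K l' v v'"
    and "\<And>l v v' u u'. l \<in> elts omega \<Longrightarrow> is_real v \<Longrightarrow> is_real v' \<Longrightarrow> is_real u \<Longrightarrow> is_real u' \<Longrightarrow>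
      agree v u l \<Longrightarrow> agree v' u' l \<Longrightarrow> K l v v' \<Longrightarrow> K l u u'"
    and "\<And>m v v'. m \<in> elts omega \<Longrightarrow> is_real v \<Longrightarrow> is_real v' \<Longrightarrow>
      \<exists>l\<in>elts omega. \<exists>w w'. is_real w \<and> is_real w' \<and> elts m \<subseteq> elts l \<and>
           agree v w m \<and> agree v' w' m \<and> K l w w'"
  shows "dense_req K"
  unfolding dense_req_def
  by (intro conjI ballI allI impI; elim conjE) (fact assms(1), fact assms(2), fact assms(3))

lemma dense_req_mono:
  "dense_req K \<Longrightarrow> l \<in> elts omega \<Longrightarrow> l' \<in> elts omega \<Longrightarrow> is_real v \<Longrightarrow> is_real v' \<Longrightarrow>
   elts l \<subseteq> elts l' \<Longrightarrow> K l v v' \<Longrightarrow> K l' v v'"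
  unfolding dense_req_def by blast

lemma dense_req_agree:
  "dense_req K \<Longrightarrow> l \<in> elts omega \<Longrightarrow> is_real v \<Longrightarrow> is_real v' \<Longrightarrow> is_real u \<Longrightarrow> is_real u' \<Longrightarrow>
   agree v u l \<Longrightarrow> agree v' u' l \<Longrightarrow> K l v v' \<Longrightarrow> K l u u'"
  unfolding dense_req_def by blast

lemma dense_reqE:
  assumes "dense_req K" "m \<in> elts omega" "is_real v" "is_real v'"
  obtains l w w' where "l \<in> elts omega" "is_real w" "is_real w'" "elts m \<subseteq> elts l"
    "agree v w m" "agree v' w' m" "K l w w'"
  using assms unfolding dense_req_def by metis

lemma dense_req_cong:
  assumes "dense_req K"
    "\<And>l v v'. l \<in> elts omega \<Longrightarrow> is_real v \<Longrightarrow> is_real v' \<Longrightarrow> K l v v' \<longleftrightarrow> K' l v v'"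
  shows "dense_req K'"
proof (rule dense_reqI)
  fix m v v' assume "m \<in> elts omega" "is_real v" "is_real v'"
  from assms(1) this obtain l w w' where "l \<in> elts omega" "is_real w" "is_real w'"
    "elts m \<subseteq> elts l" "agree v w m" "agree v' w' m" "K l w w'"
    by (rule dense_reqE)
  then show "\<exists>l\<in>elts omega. \<exists>w w'. is_real w \<and> is_real w' \<and> elts m \<subseteq> elts l \<and>
           agree v w m \<and> agree v' w' m \<and> K' l w w'"
    using assms(2) by blast
next
  fix l l' v v' assume "l \<in> elts omega" "l' \<in> elts omega" "is_real v" "is_real v'" "elts l \<subseteq> elts l'" "K' l v v'"
  then show "K' l' v v'" using dense_req_mono[OF assms(1)] assms(2) by blast
next
  fix l v v' u u' assume "l \<in> elts omega" "is_real v" "is_real v'" "is_real u" "is_real u'"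
      "agree v u l" "agree v' u' l" "K' l v v'"
  then show "K' l u u'" using dense_req_agree[OF assms(1)] assms(2) by blast
qed

lemma dense_req_conj:
  assumes K1: "dense_req K1" and K2: "dense_req K2"
  shows "dense_req (\<lambda>l v v'. K1 l v v' \<and> K2 l v v')"
proof (rule dense_reqI)
  fix m v v' assume v: "m \<in> elts omega" "is_real v" "is_real v'"
  from K1 v obtain l w w' where w: "l \<in> elts omega" "is_real w" "is_real w'"
    "elts m \<subseteq> elts l" "agree v w m" "agree v' w' m" "K1 l w w'"
    by (rule dense_reqE)
  from K2 w(1-3) obtain l' u u' where u: "l' \<in> elts omega" "is_real u" "is_real u'"
    "elts l \<subseteq> elts l'" "agree w u l" "agree w' u' l" "K2 l' u u'"
    by (rule dense_reqE)
  have "K1 l u u'" using dense_req_agree[OF K1] w u by blast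
  then have "K1 l' u u'" using dense_req_mono[OF K1] w u by blast
  moreover have "agree v u m" "agree v' u' m"
    using w u agree_mono agree_trans by blast+
  ultimately show "\<exists>l\<in>elts omega. \<exists>w w'. is_real w \<and> is_real w' \<and> elts m \<subseteq> elts l \<and>
           agree v w m \<and> agree v' w' m \<and> K1 l w w' \<and> K2 l w w'"
    using w(4) u by blast
next
  fix l l' v v' assume "l \<in> elts omega" "l' \<in> elts omega" "is_real v" "is_real v'" "elts l \<subseteq> elts l'"
    "K1 l v v' \<and> K2 l v v'"
  then show "K1 l' v v' \<and> K2 l' v v'" using dense_req_mono[OF K1] dense_req_mono[OF K2] by blast
next
  fix l v v' u u' assume "l \<in> elts omega" "is_real v" "is_real v'" "is_real u" "is_real u'"
      "agree v u l" "agree v' u' l" "K1 l v v' \<and> K2 l v v'"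
  then show "K1 l u u' \<and> K2 l u u'" using dense_req_agree[OF K1] dense_req_agree[OF K2] by blast
qed

lemma dense_req_swap:
  assumes K: "dense_req K"
  shows "dense_req (\<lambda>l v v'. K l v' v)"
proof (rule dense_reqI)
  fix m v v' assume "m \<in> elts omega" "is_real v" "is_real v'"
  then show "\<exists>l\<in>elts omega. \<exists>w w'. is_real w \<and> is_real w' \<and> elts m \<subseteq> elts l \<and>
           agree v w m \<and> agree v' w' m \<and> K l w' w"
    using dense_reqE[OF K, of m v' v] by metis
next
  fix l l' v v' assume "l \<in> elts omega" "l' \<in> elts omega" "is_real v" "is_real v'" "elts l \<subseteq> elts l'" "K l v' v"
  then show "K l' v' v" using dense_req_mono[OF K] by blast
next
  fix l v v' u u' assume "l \<in> elts omega" "is_real v" "is_real v'" "is_real u" "is_real u'"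
      "agree v u l" "agree v' u' l" "K l v' v"
  then show "K l u' u" using dense_req_agree[OF K] by blast
qed

text \<open>The updated pair is extended to one that meets \<open>K\<close>, and then the original
  bit \<open>p\<close> is put back. The extension starts beyond \<open>p\<close>, so the pair found
  still carries the prescribed bits there and updating again recovers it.\<close>

lemma dense_req_update:
  assumes K: "dense_req K" and p: "p \<in> elts omega" and b: "b \<in> elts two" "b' \<in> elts two"
  shows "dense_req (\<lambda>l v v'. K l (update v p b) (update v' p b'))"
proof (rule dense_reqI)
  fix m v v' assume v: "m \<in> elts omega" "is_real v" "is_real v'"
  obtain m' where m': "m' \<in> elts omega" "elts m \<subseteq> elts m'" "elts (succ p) \<subseteq> elts m'"
    using nat_max[OF v(1) succ_in_omega[OF p]] by blast
  from K m'(1) real_update[OF v(2) b(1)] real_update[OF v(3) b(2)]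
  obtain l w w' where w: "l \<in> elts omega" "is_real w" "is_real w'"
    "elts m' \<subseteq> elts l" "agree (update v p b) w m'" "agree (update v' p b') w' m'" "K l w w'"
    by (rule dense_reqE)
  have restore: "\<exists>u. is_real u \<and> agree x u m \<and> update u p c = y"
    if x: "is_real x" "is_real y" "c \<in> elts two" "agree (update x p c) y m'" for x y c
  proof -
    have xp: "ap x p \<in> elts two" using real_bit[OF x(1) p] by (auto simp: elts_two)
    note u = real_update[OF x(2) xp, of p]
    have "agree x (update y p (ap x p)) m"
      unfolding agree_def
    proof
      fix k assume k: "k \<in> elts m"
      then have kw: "k \<in> elts omega" using in_omega_trans v(1) by blast
      have "ap (update x p c) k = ap y k" using x(4) k m'(2) by (auto simp: agree_def)
      then show "ap x k = ap (update y p (ap x p)) k"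
        using ap_update[OF x(1,3) kw] ap_update[OF x(2) xp kw] by (auto split: if_splits)
    qed
    moreover have "update (update y p (ap x p)) p c = y"
    proof (rule real_eqI[OF real_update[OF u x(3)] x(2)])
      fix k assume kw: "k \<in> elts omega"
      have "ap y p = c"
        using x(4) m'(3) ap_update[OF x(1,3) p] by (auto simp: agree_def elts_succ)
      then show "ap (update (update y p (ap x p)) p c) k = ap y k"
        using ap_update[OF u x(3) kw] ap_update[OF x(2) xp kw] by simp
    qed
    ultimately show ?thesis using u by blast
  qed
  obtain u where u: "is_real u" "agree v u m" "update u p b = w"
    using restore[OF v(2) w(2) b(1) w(5)] by blast
  obtain u' where u': "is_real u'" "agree v' u' m" "update u' p b' = w'"
    using restore[OF v(3) w(3) b(2) w(6)] by blast
  have "K l (update u p b) (update u' p b')" unfolding u(3) u'(3) by (rule w(7))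
  then show "\<exists>l\<in>elts omega. \<exists>w w'. is_real w \<and> is_real w' \<and> elts m \<subseteq> elts l \<and>
           agree v w m \<and> agree v' w' m \<and> K l (update w p b) (update w' p b')"
    using w(1) u(1,2) u'(1,2) order_trans[OF m'(2) w(4)] by blast
next
  fix l l' v v' assume "l \<in> elts omega" "l' \<in> elts omega" "is_real v" "is_real v'" "elts l \<subseteq> elts l'"
    "K l (update v p b) (update v' p b')"
  then show "K l' (update v p b) (update v' p b')" using dense_req_mono[OF K] real_update b by blast
next
  fix l v v' u u' assume *: "l \<in> elts omega" "is_real v" "is_real v'" "is_real u" "is_real u'"
      "agree v u l" "agree v' u' l" "K l (update v p b) (update v' p b')"
  have agr: "agree (update x p c) (update y p c) l" if "is_real x" "is_real y" "c \<in> elts two" "agree x y l" for x y c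
    using that in_omega_trans[OF *(1)] by (simp add: agree_def ap_update)
  show "K l (update u p b) (update u' p b')"
    by (rule dense_req_agree[OF K *(1) real_update[OF *(2) b(1)] real_update[OF *(3) b(2)]
          real_update[OF *(4) b(1)] real_update[OF *(5) b(2)]
          agr[OF *(2,4) b(1) *(6)] agr[OF *(3,5) b(2) *(7)] *(8)])
qed

section \<open>Requirements met regardless of the bits below a position\<close>

definition agree_from :: "'v \<Rightarrow> 'v \<Rightarrow> 'v \<Rightarrow> 'v \<Rightarrow> bool" where
  "agree_from p l x y \<longleftrightarrow> (\<forall>k\<in>elts l. k \<notin> elts p \<longrightarrow> ap x k = ap y k)"

lemma definable_agree_from0: "definable (\<lambda>e. agree_from (e 0) (e 1) (e 2) (e 3))"
  unfolding agree_from_def by (intro definable_intros)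

lemmas definable_agree_from [definable_intros] = definable_comp4[OF definable_agree_from0]

text \<open>The bits between \<open>p\<close> and \<open>l\<close> alone guarantee \<open>K\<close>,
  whatever stands below \<open>p\<close>. The embedding needs this strength, since below a block it
  mixes the two generic reals in a way that depends on its argument.\<close>

definition uniform_req :: "('v \<Rightarrow> 'v \<Rightarrow> 'v \<Rightarrow> bool) \<Rightarrow> 'v \<Rightarrow> 'v \<Rightarrow> 'v \<Rightarrow> 'v \<Rightarrow> bool" where
  "uniform_req K p l v v' \<longleftrightarrow>
     (\<forall>u u'. is_real u \<and> is_real u' \<and> agree_from p l v u \<and> agree_from p l v' u' \<longrightarrow> K l u u')"

text \<open>Freeing one more bit in both reals amounts to the four ways of prescribing it.\<close>

lemma uniform_req_succ:
  assumes p: "p \<in> elts omega" and l: "l \<in> elts omega" and v: "is_real v" "is_real v'"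
  shows "uniform_req K (succ p) l v v' \<longleftrightarrow>
    (\<forall>b\<in>elts two. \<forall>b'\<in>elts two. uniform_req K p l (update v p b) (update v' p b'))"
proof -
  have 1: "agree_from (succ p) l x u" if "is_real x" "b \<in> elts two" "agree_from p l (update x p b) u" for x u b
    using that in_omega_trans[OF l] by (auto simp: agree_from_def elts_succ ap_update)
  have 2: "agree_from p l (update x p (ap u p)) u \<and> ap u p \<in> elts two"
    if "is_real x" "is_real u" "agree_from (succ p) l x u" for x u
  proof -
    have "ap u p \<in> elts two" using real_bit[OF that(2) p] by (auto simp: elts_two)
    then show ?thesis
      using that in_omega_trans[OF l] by (auto simp: agree_from_def elts_succ ap_update)
  qed
  show ?thesis
  proof
    assume "uniform_req K (succ p) l v v'"
    then show "\<forall>b\<in>elts two. \<forall>b'\<in>elts two. uniform_req K p l (update v p b) (update v' p b')"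
      unfolding uniform_req_def using 1 v by blast
  next
    assume *: "\<forall>b\<in>elts two. \<forall>b'\<in>elts two. uniform_req K p l (update v p b) (update v' p b')"
    show "uniform_req K (succ p) l v v'"
      unfolding uniform_req_def
    proof (intro allI impI; elim conjE)
      fix u u' assume u: "is_real u" "is_real u'" "agree_from (succ p) l v u" "agree_from (succ p) l v' u'"
      note 2[OF v(1) u(1,3)] 2[OF v(2) u(2,4)]
      with * u show "K l u u'" unfolding uniform_req_def by blast
    qed
  qed
qed

text \<open>The usual treatment of all finite prefixes in turn, done one bit at a time: by the
  previous lemma each step is a conjunction of four updated requirements, and dense requirements are
  closed under conjunction.\<close>

lemma dense_req_uniform:
  assumes dK: "definable (\<lambda>e. K (e 0) (e 1) (e 2))" and K: "dense_req K" and p: "p \<in> elts omega"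
  shows "dense_req (uniform_req K p)"
proof (rule omega_induct[OF p])
  note [definable_intros] = definable_comp3[where P = K, OF dK]
  show "definable (\<lambda>e. dense_req (uniform_req K (e 0)))"
    unfolding dense_req_def uniform_req_def by (intro definable_intros)
  show "dense_req (uniform_req K zero)"
  proof (rule dense_req_cong[OF K])
    fix l v v' assume *: "l \<in> elts omega" "is_real v" "is_real v'"
    have "agree_from zero l x y \<longleftrightarrow> agree x y l" for x y
      by (simp add: agree_from_def agree_def)
    then show "K l v v' \<longleftrightarrow> uniform_req K zero l v v'"
      unfolding uniform_req_def using dense_req_agree[OF K] * agree_refl by blast
  qed
  fix n assume n: "n \<in> elts omega" and IH: "dense_req (uniform_req K n)"
  let ?U = "\<lambda>b b' l v v'. uniform_req K n l (update v n b) (update v' n b')"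
  have U: "dense_req (?U b b')" if "b \<in> elts two" "b' \<in> elts two" for b b'
    by (rule dense_req_update[OF IH n that])
  have "dense_req (\<lambda>l v v'. (?U zero zero l v v' \<and> ?U zero one l v v') \<and> (?U one zero l v v' \<and> ?U one one l v v'))"
    by (intro dense_req_conj U) (simp_all add: elts_two)
  then show "dense_req (uniform_req K (succ n))"
    by (rule dense_req_cong) (auto simp: uniform_req_succ[OF n] elts_two)
qed

section \<open>Deciding convergence and separating two reals\<close>

definition decided :: "'v \<Rightarrow> 'v \<Rightarrow> 'v \<Rightarrow> 'v \<Rightarrow> bool" where
  "decided F n v l \<longleftrightarrow>
     (\<exists>r. \<forall>w. is_real w \<and> agree v w l \<longrightarrow> val F w n r) \<or>
     (\<forall>w r. is_real w \<and> agree v w l \<longrightarrow> \<not> val F w n r)"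

definition separated :: "'v \<Rightarrow> 'v \<Rightarrow> 'v \<Rightarrow> 'v \<Rightarrow> bool" where
  "separated F l v v' \<longleftrightarrow>
     (\<forall>w w'. is_real w \<and> is_real w' \<and> agree v w l \<and> agree v' w' l \<longrightarrow> \<not> maps_to F w w')"

definition block_req :: "'v \<Rightarrow> 'v \<Rightarrow> 'v \<Rightarrow> 'v \<Rightarrow> 'v \<Rightarrow> bool" where
  "block_req F n l v v' \<longleftrightarrow>
     (separated F l v v' \<and> separated F l v' v) \<and> (decided F n v l \<and> decided F n v' l)"

lemma definable_decided0: "definable (\<lambda>e. decided (e 0) (e 1) (e 2) (e 3))"
  unfolding decided_def by (intro definable_intros)

lemma definable_separated0: "definable (\<lambda>e. separated (e 0) (e 1) (e 2) (e 3))"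
  unfolding separated_def by (intro definable_intros)

lemmas definable_decided [definable_intros] = definable_comp4[OF definable_decided0]
lemmas definable_separated [definable_intros] = definable_comp4[OF definable_separated0]

lemma definable_block_req [definable_intros]:
  assumes "definable_term t" "definable_term u" "definable_term v" "definable_term w" "definable_term z"
  shows "definable (\<lambda>e. block_req (t e) (u e) (v e) (w e) (z e))"
  unfolding block_req_def by (intro definable_intros assms)

text \<open>Either some extension makes \<open>F\<close> converge at \<open>n\<close>, and a long
  enough piece of it forces the value, or the present \<open>m\<close> bits already force
  divergence.\<close>

lemma dense_req_decided:
  assumes F: "functional F"
  shows "dense_req (\<lambda>l v v'. decided F n v l)"
proof (rule dense_reqI)
  fix m v v' assume v: "m \<in> elts omega" "is_real v" "is_real v'"
  show "\<exists>l\<in>elts omega. \<exists>w w'. is_real w \<and> is_real w' \<and> elts m \<subseteq> elts l \<and>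
           agree v w m \<and> agree v' w' m \<and> decided F n w l"
  proof (cases "\<exists>w r. is_real w \<and> agree v w m \<and> val F w n r")
    case True
    then obtain w r where w: "is_real w" "agree v w m" "val F w n r" by blast
    obtain k where k: "k \<in> elts omega" "\<And>y. is_real y \<Longrightarrow> agree w y k \<Longrightarrow> val F y n r"
      using val_open[OF F w(3)] by blast
    obtain l where l: "l \<in> elts omega" "elts m \<subseteq> elts l" "elts k \<subseteq> elts l" using nat_max[OF v(1) k(1)] by blast
    then have "decided F n w l" unfolding decided_def using k(2) agree_mono by blast
    with l w v show ?thesis using agree_refl by blast
  next
    case False
    then have "decided F n v m" unfolding decided_def by blast
    with v show ?thesis using agree_refl by blast
  qed
next
  fix l l' v assume "elts l \<subseteq> elts l'" "decided F n v l"
  then show "decided F n v l'" unfolding decided_def using agree_mono by metis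
next
  fix l v u assume "agree v u l" "decided F n v l"
  then show "decided F n u l" unfolding decided_def using agree_trans by metis
qed

text \<open>Diagonalization at output bit \<open>m\<close>, the first one not fixed by the first
  \<open>m\<close> bits of \<open>v'\<close>. If some extension of \<open>v\<close> makes
  \<open>F\<close> output a bit there, the second real is given the opposite bit; otherwise no
  extension of \<open>v\<close> is mapped to a real at all.\<close>

lemma dense_req_separated:
  assumes F: "functional F"
  shows "dense_req (\<lambda>l v v'. separated F l v v')"
proof (rule dense_reqI)
  fix m v v' assume v: "m \<in> elts omega" "is_real v" "is_real v'"
  show "\<exists>l\<in>elts omega. \<exists>w w'. is_real w \<and> is_real w' \<and> elts m \<subseteq> elts l \<and>
           agree v w m \<and> agree v' w' m \<and> separated F l w w'"
  proof (cases "\<exists>w r. is_real w \<and> agree v w m \<and> val F w m r")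
    case True
    then obtain w r where w: "is_real w" "agree v w m" "val F w m r" by blast
    obtain k where k: "k \<in> elts omega" "\<And>y. is_real y \<Longrightarrow> agree w y k \<Longrightarrow> val F y m r"
      using val_open[OF F w(3)] by blast
    obtain l where l: "l \<in> elts omega" "elts (succ m) \<subseteq> elts l" "elts k \<subseteq> elts l"
      using nat_max[OF succ_in_omega[OF v(1)] k(1)] by blast
    define b where "b = (if r = zero then one else zero)"
    have b: "b \<in> elts two" "b \<noteq> r" by (auto simp: b_def elts_two)
    define w' where "w' = update v' m b"
    have w': "is_real w'" "ap w' m = b" "agree v' w' m"
      unfolding w'_def using real_update[OF v(3) b(1)] ap_update[OF v(3) b(1)] v(1) mem_irrefl in_omega_trans[OF v(1)]
      by (auto simp: agree_def)
    have "separated F l w w'"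
      unfolding separated_def
    proof (intro allI impI notI; elim conjE)
      fix u u' assume u: "is_real u" "is_real u'" "agree w u l" "agree w' u' l" and "maps_to F u u'"
      then have "val F u m (ap u' m)" using v(1) by (simp add: maps_to_def)
      moreover have "val F u m r" using k(2) u agree_mono l(3) by blast
      moreover have "ap u' m = b" using u(4) l(2) w'(2) by (auto simp: agree_def elts_succ)
      ultimately show False using val_unique[OF F] b(2) by blast
    qed
    moreover have "elts m \<subseteq> elts l" using l(2) by (auto simp: elts_succ)
    ultimately show ?thesis using l(1) w w' by blast
  next
    case False
    have "separated F m v v'"
      unfolding separated_def maps_to_def using False v(1) by blast
    with v show ?thesis using agree_refl by blast
  qed
next
  fix l l' v v' assume "elts l \<subseteq> elts l'" "separated F l v v'"
  then show "separated F l' v v'" unfolding separated_def using agree_mono by blast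
next
  fix l v v' u u' assume "agree v u l" "agree v' u' l" "separated F l v v'"
  then show "separated F l u u'" unfolding separated_def using agree_trans by blast
qed

lemma dense_req_block_req:
  assumes F: "functional F"
  shows "dense_req (block_req F n)"
proof -
  have "dense_req (\<lambda>l v v'. (separated F l v v' \<and> separated F l v' v) \<and> (decided F n v l \<and> decided F n v' l))"
    by (intro dense_req_conj dense_req_separated[OF F] dense_req_decided[OF F]
        dense_req_swap[OF dense_req_separated[OF F]]
        dense_req_swap[where K = "\<lambda>l v v'. decided F n v l", OF dense_req_decided[OF F]])
  then show ?thesis by (rule dense_req_cong) (simp add: block_req_def)
qed

subsection \<open>A perfect set of pairwise incomparable reals\<close>

text \<open>No choice of a bound for every \<open>t\<close> is involved: as \<open>Q\<close> is
  monotone in the bound, the maximum so far absorbs the next one.\<close>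

lemma nat_bound:
  assumes Q: "definable (\<lambda>e. Q (e 0) (e 1))" and l: "l \<in> elts omega"
    and ex: "\<And>t. t \<in> elts l \<Longrightarrow> \<exists>m\<in>elts omega. Q t m"
    and mono: "\<And>t m m'. m' \<in> elts omega \<Longrightarrow> elts m \<subseteq> elts m' \<Longrightarrow> Q t m \<Longrightarrow> Q t m'"
  shows "\<exists>m\<in>elts omega. \<forall>t\<in>elts l. Q t m"
proof -
  note [definable_intros] = definable_comp2[where P = Q, OF Q]
  have "(\<forall>t\<in>elts l. \<exists>m\<in>elts omega. Q t m) \<longrightarrow> (\<exists>m\<in>elts omega. \<forall>t\<in>elts l. Q t m)"
  proof (rule omega_induct[OF l])
    show "definable (\<lambda>e. (\<forall>t\<in>elts (e 0). \<exists>m\<in>elts omega. Q t m) \<longrightarrow> (\<exists>m\<in>elts omega. \<forall>t\<in>elts (e 0). Q t m))"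
      by (intro definable_intros)
    show "(\<forall>t\<in>elts zero. \<exists>m\<in>elts omega. Q t m) \<longrightarrow> (\<exists>m\<in>elts omega. \<forall>t\<in>elts zero. Q t m)"
      using zero_in_omega unfolding elts_zero by blast
    fix n assume IH: "(\<forall>t\<in>elts n. \<exists>m\<in>elts omega. Q t m) \<longrightarrow> (\<exists>m\<in>elts omega. \<forall>t\<in>elts n. Q t m)"
    show "(\<forall>t\<in>elts (succ n). \<exists>m\<in>elts omega. Q t m) \<longrightarrow> (\<exists>m\<in>elts omega. \<forall>t\<in>elts (succ n). Q t m)"
    proof
      assume *: "\<forall>t\<in>elts (succ n). \<exists>m\<in>elts omega. Q t m"
      then obtain m where m: "m \<in> elts omega" "\<forall>t\<in>elts n. Q t m" using IH unfolding elts_succ by blast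
      obtain m' where m': "m' \<in> elts omega" "Q n m'" using * unfolding elts_succ by blast
      obtain k where "k \<in> elts omega" "elts m \<subseteq> elts k" "elts m' \<subseteq> elts k" using nat_max[OF m(1) m'(1)] by blast
      then show "\<exists>m\<in>elts omega. \<forall>t\<in>elts (succ n). Q t m"
        using m m' mono unfolding elts_succ by blast
    qed
  qed
  with ex show ?thesis by blast
qed

text \<open>
  On the block between \<open>p t\<close> and \<open>p (t+1)\<close> the pair \<open>(g0,g1)\<close> meets the requirement given by
  \<open>idx t = (i,F,n)\<close>; the number \<open>i\<close> is the bit of \<open>x\<close> that the embedding below encodes there.
\<close>

lemma generic_blocks:
  assumes M: "enumerable M" "F0 \<in> elts M" "\<forall>F\<in>elts M. functional F"
  obtains p idx g0 g1 where
    "\<forall>t\<in>elts omega. ap p t \<in> elts omega \<and> ap p t \<in> elts (ap p (succ t))"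
    "func idx (elts omega) (elts (times omega (times M omega)))"
    "\<forall>i\<in>elts omega. \<forall>F\<in>elts M. \<forall>n\<in>elts omega. \<exists>t\<in>elts omega. ap idx t = opair i (opair F n)"
    "is_real g0" "is_real g1"
    "\<forall>t\<in>elts omega.
       uniform_req (block_req (pr1 (pr2 (ap idx t))) (pr2 (pr2 (ap idx t)))) (ap p t) (ap p (succ t)) g0 g1"
proof -
  have "enumerable (times omega (times M omega))"
    by (intro enumerable_times enumerable_omega M)
  moreover have "opair zero (opair F0 zero) \<in> elts (times omega (times M omega))" using M(2) by simp
  ultimately obtain idx where idx: "func idx (elts omega) (elts (times omega (times M omega)))"
    "\<And>x. x \<in> elts (times omega (times M omega)) \<Longrightarrow> \<exists>t\<in>elts omega. ap idx t = x"
    using enumeration by blast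
  let ?F = "\<lambda>t. pr1 (pr2 (ap idx t))" and ?n = "\<lambda>t. pr2 (pr2 (ap idx t))"
  have dense: "dense_req (uniform_req (block_req (?F t) (?n t)) q)" if tq: "t \<in> elts omega" "q \<in> elts omega" for t q
  proof (rule dense_req_uniform[OF _ _ tq(2)])
    obtain i z where z: "ap idx t = opair i z" and "i \<in> elts omega" and z': "z \<in> elts (times M omega)"
      using ap_in[OF idx(1) tq(1)] by (rule timesE)
    obtain F n where "z = opair F n" "F \<in> elts M" "n \<in> elts omega" using z' by (rule timesE)
    with z show "dense_req (block_req (?F t) (?n t))"
      using dense_req_block_req M(3) by simp
    show "definable (\<lambda>e. block_req (?F t) (?n t) (e 0) (e 1) (e 2))" by (intro definable_intros)
  qed
  define St where "St = times omega (times RR RR)"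
  \<comment> \<open>A state consists of a length and two reals, of which only the bits below that
    length are committed. The block added at stage \<open>t\<close> meets requirement number
    \<open>t\<close> uniformly.\<close>
  define R where "R t z z' \<longleftrightarrow> pr1 z \<in> elts (pr1 z') \<and>
      agree (pr1 (pr2 z)) (pr1 (pr2 z')) (pr1 z) \<and> agree (pr2 (pr2 z)) (pr2 (pr2 z')) (pr1 z) \<and>
      uniform_req (block_req (?F t) (?n t)) (pr1 z) (pr1 z') (pr1 (pr2 z')) (pr2 (pr2 z'))" for t z z'
  have dR: "definable (\<lambda>e. R (e 0) (e 1) (e 2))"
    unfolding R_def uniform_req_def by (intro definable_intros)
  have dz: "definable_term (\<lambda>e. zero)" by (intro definable_intros)
  have z: "is_real (lam omega (\<lambda>_. zero))" by (rule real_lam(1)[where f = "\<lambda>_. zero", OF dz]) simp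
  then have start: "opair zero (opair (lam omega (\<lambda>_. zero)) (lam omega (\<lambda>_. zero))) \<in> elts St"
    by (simp add: St_def elts_RR)
  have total: "\<exists>z'\<in>elts St. R t z z'" if t: "t \<in> elts omega" and z: "z \<in> elts St" for t z
  proof -
    obtain q y where y: "z = opair q y" "q \<in> elts omega" "y \<in> elts (times RR RR)"
      using z unfolding St_def by (rule timesE)
    obtain v v' where v: "y = opair v v'" "v \<in> elts RR" "v' \<in> elts RR" using y(3) by (rule timesE)
    then have r: "is_real v" "is_real v'" by (auto simp: elts_RR)
    \<comment> \<open>Density is used at \<open>succ q\<close> instead of \<open>q\<close>, so that
      the length strictly increases.\<close>
    from dense[OF t y(2)] succ_in_omega[OF y(2)] r
    obtain l w w' where w: "l \<in> elts omega" "is_real w" "is_real w'" "elts (succ q) \<subseteq> elts l"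
      "agree v w (succ q)" "agree v' w' (succ q)" "uniform_req (block_req (?F t) (?n t)) q l w w'"
      by (rule dense_reqE)
    have "q \<in> elts l" using w(4) by (auto simp: elts_succ)
    moreover have "agree v w q" "agree v' w' q" using w(5,6) by (auto simp: agree_def elts_succ)
    ultimately show ?thesis
      using w y v by (intro bexI[of _ "opair l (opair w w')"]) (simp_all add: R_def St_def elts_RR)
  qed
  obtain f where f: "func f (elts omega) (elts St)"
    "\<forall>t\<in>elts omega. R t (ap f t) (ap f (succ t))"
    by (rule dc_indexed[where R = R, OF dR start total]) auto
  have fS: "pr1 (ap f t) \<in> elts omega \<and> is_real (pr1 (pr2 (ap f t))) \<and> is_real (pr2 (pr2 (ap f t)))"
    if t: "t \<in> elts omega" for t
  proof -
    obtain q y where y: "ap f t = opair q y" "q \<in> elts omega" "y \<in> elts (times RR RR)"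
      using ap_in[OF f(1) t] unfolding St_def by (rule timesE)
    obtain v v' where "y = opair v v'" "v \<in> elts RR" "v' \<in> elts RR" using y(3) by (rule timesE)
    with y show ?thesis by (simp add: elts_RR)
  qed
  have fR: "R t (ap f t) (ap f (succ t))" if "t \<in> elts omega" for t using f(2) that by blast
  have d0: "definable_term (\<lambda>e. pr1 (ap f (e 0)))" "definable_term (\<lambda>e. pr1 (pr2 (ap f (e 0))))"
    "definable_term (\<lambda>e. pr2 (pr2 (ap f (e 0))))" by (intro definable_intros)+
  obtain g0 where g0: "is_real g0" "\<And>t. t \<in> elts omega \<Longrightarrow> agree (pr1 (pr2 (ap f t))) g0 (pr1 (ap f t))"
    by (rule limit_of_reals[OF d0(2,1)]) (use fS fR in \<open>auto simp: R_def\<close>)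
  obtain g1 where g1: "is_real g1" "\<And>t. t \<in> elts omega \<Longrightarrow> agree (pr2 (pr2 (ap f t))) g1 (pr1 (ap f t))"
    by (rule limit_of_reals[OF d0(3,1)]) (use fS fR in \<open>auto simp: R_def\<close>)
  define p where "p = lam omega (\<lambda>t. pr1 (ap f t))"
  have p: "ap p t = pr1 (ap f t)" if "t \<in> elts omega" for t
    unfolding p_def using ap_lam[OF d0(1) that] .
  show thesis
  proof
    show "\<forall>t\<in>elts omega. ap p t \<in> elts omega \<and> ap p t \<in> elts (ap p (succ t))"
      using fS fR p succ_in_omega by (simp add: R_def)
    show "func idx (elts omega) (elts (times omega (times M omega)))" by (rule idx)
    show "\<forall>i\<in>elts omega. \<forall>F\<in>elts M. \<forall>n\<in>elts omega. \<exists>t\<in>elts omega. ap idx t = opair i (opair F n)"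
      using idx(2) by simp
    show "is_real g0" "is_real g1" by (rule g0 g1)+
    show "\<forall>t\<in>elts omega. uniform_req (block_req (?F t) (?n t)) (ap p t) (ap p (succ t)) g0 g1"
    proof
      fix t assume t: "t \<in> elts omega"
      note t' = succ_in_omega[OF t]
      have "uniform_req (block_req (?F t) (?n t)) (pr1 (ap f t)) (pr1 (ap f (succ t)))
          (pr1 (pr2 (ap f (succ t)))) (pr2 (pr2 (ap f (succ t))))"
        using fR[OF t] by (simp add: R_def)
      \<comment> \<open>The requirement depends only on the bits below the length reached at stage
        \<open>succ t\<close>, and the limits keep these.\<close>
      then have "uniform_req (block_req (?F t) (?n t)) (pr1 (ap f t)) (pr1 (ap f (succ t))) g0 g1"
        using fS[OF t] fS[OF t'] g0(1) g0(2)[OF t'] g1(1) g1(2)[OF t']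
        by (elim conjE) (rule dense_req_agree[OF dense[OF t]])
      then show "uniform_req (block_req (?F t) (?n t)) (ap p t) (ap p (succ t)) g0 g1"
        using p t t' by simp
    qed
  qed
qed

text \<open>\<open>h x\<close> copies block \<open>t\<close> from \<open>g0\<close> or from
  \<open>g1\<close> according to bit \<open>i t\<close> of \<open>x\<close>. If \<open>x\<close> and
  \<open>x'\<close> differ at bit \<open>j\<close>, then in a block indexed by
  \<open>(j,F,n)\<close> one of them follows \<open>g0\<close> and the other \<open>g1\<close>, and
  the uniform requirement separates \<open>h x\<close> from \<open>h x'\<close> whatever happens
  below that block.\<close>

lemma incomparable_embedding:
  assumes M: "enumerable M" "idf \<in> elts M" "\<forall>F\<in>elts M. functional F"
  obtains h where "definable_term (\<lambda>e. h (e 0))" "\<forall>x. is_real x \<longrightarrow> is_real (h x)"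
    "\<forall>x x'. \<forall>F\<in>elts M. is_real x \<and> is_real x' \<and> maps_to F (h x) (h x') \<longrightarrow> x = x'"
    "\<forall>l\<in>elts omega. \<exists>m\<in>elts omega.
       \<forall>x x'. is_real x \<and> is_real x' \<and> agree x x' m \<longrightarrow> agree (h x) (h x') l"
    "\<forall>m\<in>elts omega. \<exists>l\<in>elts omega.
       \<forall>x x'. is_real x \<and> is_real x' \<and> agree (h x) (h x') l \<longrightarrow> agree x x' m"
    "\<forall>F\<in>elts M. \<forall>n\<in>elts omega. \<exists>l\<in>elts omega. \<forall>x. is_real x \<longrightarrow> decided F n (h x) l"
proof -
  obtain p idx g0 g1 where
    p_inc: "\<forall>t\<in>elts omega. ap p t \<in> elts omega \<and> ap p t \<in> elts (ap p (succ t))"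
    and idx: "func idx (elts omega) (elts (times omega (times M omega)))"
    and onto: "\<forall>i\<in>elts omega. \<forall>F\<in>elts M. \<forall>n\<in>elts omega. \<exists>t\<in>elts omega. ap idx t = opair i (opair F n)"
    and g: "is_real g0" "is_real g1"
    and req: "\<forall>t\<in>elts omega.
       uniform_req (block_req (pr1 (pr2 (ap idx t))) (pr2 (pr2 (ap idx t)))) (ap p t) (ap p (succ t)) g0 g1"
    using M by (rule generic_blocks)
  have p: "ap p t \<in> elts omega" and inc: "ap p t \<in> elts (ap p (succ t))" if "t \<in> elts omega" for t
    using p_inc that by blast+
  have dp: "definable_term (\<lambda>e. ap p (e 0))" by (intro definable_intros)
  have pge: "elts t \<subseteq> elts (ap p t)" if "t \<in> elts omega" for t
    by (rule increasing_ge[where m = "ap p", OF dp _ _ that]) (fact p, fact inc)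
  have pmono: "\<forall>t\<in>elts (succ s). elts (ap p t) \<subseteq> elts (ap p s)" if "s \<in> elts omega" for s
    by (rule increasing_mono[where m = "ap p", OF dp _ _ that]) (fact p, fact inc)
  define i where "i t = pr1 (ap idx t)" for t
  have iw: "i t \<in> elts omega" if t: "t \<in> elts omega" for t
  proof -
    obtain j z where "ap idx t = opair j z" "j \<in> elts omega" "z \<in> elts (times M omega)"
      using ap_in[OF idx t] by (rule timesE)
    then show ?thesis by (simp add: i_def)
  qed
  define block where "block k t \<longleftrightarrow> k \<in> elts (ap p (succ t)) \<and> k \<notin> elts (ap p t)" for k t
  have block_unique: "t = t'" if "block k t" "block k t'" "t \<in> elts omega" "t' \<in> elts omega" for k t t'
  proof (rule ccontr)
    have less: False if "t \<in> elts t'" "block k t" "block k t'" "t' \<in> elts omega" for t t'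
    proof -
      have "succ t \<in> elts (succ t')" using succ_in_succ that by blast
      then have "elts (ap p (succ t)) \<subseteq> elts (ap p t')" using pmono that by blast
      with that show False by (auto simp: block_def)
    qed
    assume "t \<noteq> t'"
    then show False using nat_linear[OF that(3,4)] less that by blast
  qed
  \<comment> \<open>A position that belongs to no block takes the bit of \<open>g1\<close>.\<close>
  define h where "h x = lam omega (\<lambda>k. if \<exists>t\<in>elts omega. block k t \<and> ap x (i t) = zero then ap g0 k else ap g1 k)" for x
  have dh: "definable_term (\<lambda>e. h (e 0))"
    unfolding h_def block_def i_def by (intro definable_intros)
  have dh': "definable_term (\<lambda>e. if \<exists>t\<in>elts omega. block (e 0) t \<and> ap x (i t) = zero then ap g0 (e 0) else ap g1 (e 0))" for x
    unfolding block_def i_def by (intro definable_intros)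
  have bit: "\<forall>k\<in>elts omega. (if \<exists>t\<in>elts omega. block k t \<and> ap x (i t) = zero then ap g0 k else ap g1 k) = zero \<or>
     (if \<exists>t\<in>elts omega. block k t \<and> ap x (i t) = zero then ap g0 k else ap g1 k) = one" for x
    using real_bit[OF g(1)] real_bit[OF g(2)] by simp
  have hr: "is_real (h x)"
    and hk: "\<And>k. k \<in> elts omega \<Longrightarrow> ap (h x) k = (if \<exists>t\<in>elts omega. block k t \<and> ap x (i t) = zero then ap g0 k else ap g1 k)" for x
    unfolding h_def
    using real_lam[where f = "\<lambda>k. if \<exists>t\<in>elts omega. block k t \<and> ap x (i t) = zero then ap g0 k else ap g1 k", OF dh' bit]
    by blast+
  have block_w: "k \<in> elts omega" if "block k t" "t \<in> elts omega" for k t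
    using that in_omega_trans p succ_in_omega unfolding block_def by blast
  have h0: "agree_from (ap p t) (ap p (succ t)) g0 (h x)" if "t \<in> elts omega" "ap x (i t) = zero" for t x
    unfolding agree_from_def using that hk block_w by (auto simp: block_def)
  have h1: "agree_from (ap p t) (ap p (succ t)) g1 (h x)" if t: "t \<in> elts omega" "ap x (i t) \<noteq> zero" for t x
    unfolding agree_from_def
  proof (intro ballI impI)
    fix k assume "k \<in> elts (ap p (succ t))" "k \<notin> elts (ap p t)"
    then have k: "block k t" by (simp add: block_def)
    then have ne: "\<not> (\<exists>t\<in>elts omega. block k t \<and> ap x (i t) = zero)" using block_unique t by blast
    have "ap (h x) k = ap g1 k" unfolding hk[OF block_w[OF k t(1)]] using ne by (rule if_not_P)
    then show "ap g1 k = ap (h x) k" ..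
  qed
  have sep: "block_req F n (ap p (succ t)) (h x) (h x')"
    if "t \<in> elts omega" "ap idx t = opair j (opair F n)" "ap x j = zero" "ap x' j \<noteq> zero" for t j F n x x'
    using bspec[OF req that(1)] h0[of t x] h1[of t x'] hr that unfolding uniform_req_def i_def by auto
  \<comment> \<open>It is not known which of the two reals follows \<open>g0\<close>;
    \<open>block_req\<close> contains the separation in both directions.\<close>
  have sep': "separated F (ap p (succ t)) (h x) (h x')"
    if t: "t \<in> elts omega" "ap idx t = opair j (opair F n)" and "ap x j \<noteq> ap x' j" "j \<in> elts omega"
      "is_real x" "is_real x'" for t j F n x x'
  proof (cases "ap x j = zero")
    case True
    then show ?thesis using sep[OF t True] that(3) by (simp add: block_req_def)
  next
    case False
    then have "ap x' j = zero" using real_bit that by metis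
    then show ?thesis using sep[OF t _ False] by (simp add: block_req_def)
  qed
  show thesis
  proof
    show "definable_term (\<lambda>e. h (e 0))" by (rule dh)
    show "\<forall>x. is_real x \<longrightarrow> is_real (h x)" using hr by blast
  next
    show "\<forall>x x'. \<forall>F\<in>elts M. is_real x \<and> is_real x' \<and> maps_to F (h x) (h x') \<longrightarrow> x = x'"
    proof (intro allI ballI impI; elim conjE)
      fix x x' F assume *: "F \<in> elts M" "is_real x" "is_real x'" "maps_to F (h x) (h x')"
      show "x = x'"
      proof (rule real_eqI[OF *(2,3)], rule ccontr)
        fix j assume j: "j \<in> elts omega" "ap x j \<noteq> ap x' j"
        obtain t where "t \<in> elts omega" "ap idx t = opair j (opair F zero)"
          using onto j(1) *(1) zero_in_omega by blast
        from sep'[OF this j(2,1) *(2,3)] *(4) hr show False unfolding separated_def using agree_refl by blast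
      qed
    qed
  next
    show "\<forall>l\<in>elts omega. \<exists>m\<in>elts omega.
       \<forall>x x'. is_real x \<and> is_real x' \<and> agree x x' m \<longrightarrow> agree (h x) (h x') l"
    proof
      fix l assume l: "l \<in> elts omega"
      have "\<exists>m\<in>elts omega. \<forall>t\<in>elts l. i t \<in> elts m"
      proof (rule nat_bound[OF _ l])
        show "definable (\<lambda>e. i (e 0) \<in> elts (e 1))" unfolding i_def by (intro definable_intros)
        show "\<exists>m\<in>elts omega. i t \<in> elts m" if "t \<in> elts l" for t
          using iw[OF in_omega_trans[OF l that]] succ_in_omega by (auto simp: elts_succ intro!: bexI[of _ "succ (i t)"])
      qed blast
      then obtain m where m: "m \<in> elts omega" "\<And>t. t \<in> elts l \<Longrightarrow> i t \<in> elts m" by blast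
      have "agree (h x) (h x') l" if "agree x x' m" for x x'
        unfolding agree_def
      proof
        fix k assume k: "k \<in> elts l"
        then have kw: "k \<in> elts omega" using in_omega_trans l by blast
        have "ap x (i t) = ap x' (i t)" if t: "t \<in> elts omega" "block k t" for t
        proof -
          \<comment> \<open>A block containing \<open>k\<close> has an index at most
            \<open>k\<close>, so the first \<open>l\<close> bits of \<open>h x\<close> depend only
            on the bits \<open>i t\<close> of \<open>x\<close> with \<open>t\<close> below
            \<open>l\<close>.\<close>
          have "k \<notin> elts t" using t pge[OF t(1)] by (auto simp: block_def)
          then have "t = k \<or> t \<in> elts k" using nat_linear[OF t(1) kw] by blast
          then have "t \<in> elts l" using k nat_less_trans[OF l k] by blast
          with m(2) \<open>agree x x' m\<close> show ?thesis by (simp add: agree_def)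
        qed
        then have "(\<exists>t\<in>elts omega. block k t \<and> ap x (i t) = zero) \<longleftrightarrow> (\<exists>t\<in>elts omega. block k t \<and> ap x' (i t) = zero)"
          by auto
        then show "ap (h x) k = ap (h x') k" using hk[OF kw] by simp
      qed
      with m(1) show "\<exists>m\<in>elts omega. \<forall>x x'. is_real x \<and> is_real x' \<and> agree x x' m \<longrightarrow> agree (h x) (h x') l"
        by blast
    qed
  next
    show "\<forall>m\<in>elts omega. \<exists>l\<in>elts omega.
       \<forall>x x'. is_real x \<and> is_real x' \<and> agree (h x) (h x') l \<longrightarrow> agree x x' m"
    proof
      fix m assume m: "m \<in> elts omega"
      note [definable_intros] = definable_term_comp1[where f = h, OF dh]
      have "\<exists>l\<in>elts omega. \<forall>j\<in>elts m. \<forall>x x'. is_real x \<and> is_real x' \<and> agree (h x) (h x') l \<longrightarrow> ap x j = ap x' j"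
      proof (rule nat_bound[OF _ m])
        show "definable (\<lambda>e. \<forall>x x'. is_real x \<and> is_real x' \<and> agree (h x) (h x') (e 1) \<longrightarrow> ap x (e 0) = ap x' (e 0))"
          by (intro definable_intros)
        fix j assume "j \<in> elts m"
        then have j: "j \<in> elts omega" using in_omega_trans m by blast
        obtain t where t: "t \<in> elts omega" "ap idx t = opair j (opair idf zero)"
          using onto j M(2) zero_in_omega by blast
        have "ap x j = ap x' j" if x: "is_real x" "is_real x'" "agree (h x) (h x') (ap p (succ t))" for x x'
        proof (rule ccontr)
          assume "ap x j \<noteq> ap x' j"
          \<comment> \<open>Separation concerns all reals with the given prefixes. If
            \<open>h x\<close> and \<open>h x'\<close> had a common prefix of this length,
            \<open>h x\<close> could stand for both, against the identity mapping it to
            itself.\<close>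
          from sep'[OF t this j x(1,2)] have "\<not> maps_to idf (h x) (h x)"
            unfolding separated_def using hr agree_refl agree_sym[OF x(3)] by blast
          with maps_to_idf[OF hr] show False by blast
        qed
        then show "\<exists>l\<in>elts omega. \<forall>x x'. is_real x \<and> is_real x' \<and> agree (h x) (h x') l \<longrightarrow> ap x j = ap x' j"
          using p[OF succ_in_omega[OF t(1)]] by blast
      qed (use agree_mono in blast)
      then show "\<exists>l\<in>elts omega. \<forall>x x'. is_real x \<and> is_real x' \<and> agree (h x) (h x') l \<longrightarrow> agree x x' m"
        unfolding agree_def[of _ _ m] by blast
    qed
  next
    show "\<forall>F\<in>elts M. \<forall>n\<in>elts omega. \<exists>l\<in>elts omega. \<forall>x. is_real x \<longrightarrow> decided F n (h x) l"
    proof (intro ballI)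
      fix F n assume F: "F \<in> elts M" "n \<in> elts omega"
      obtain t where t: "t \<in> elts omega" "ap idx t = opair zero (opair F n)"
        using onto zero_in_omega F by blast
      have r: "uniform_req (block_req F n) (ap p t) (ap p (succ t)) g0 g1" using bspec[OF req t(1)] t(2) by simp
      have refl: "agree_from (ap p t) (ap p (succ t)) g0 g0" "agree_from (ap p t) (ap p (succ t)) g1 g1"
        by (auto simp: agree_from_def)
      \<comment> \<open>The pair in the requirement is completed by \<open>g1\<close> or by
        \<open>g0\<close>, whichever \<open>h x\<close> does not follow on this block.\<close>
      have "decided F n (h x) (ap p (succ t))" for x
      proof (cases "ap x (i t) = zero")
        case True
        then have "block_req F n (ap p (succ t)) (h x) g1"
          using r h0[OF t(1) True] refl hr g unfolding uniform_req_def by blast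
        then show ?thesis by (simp add: block_req_def)
      next
        case False
        then have "block_req F n (ap p (succ t)) g0 (h x)"
          using r h1[OF t(1) False] refl hr g unfolding uniform_req_def by blast
        then show ?thesis by (simp add: block_req_def)
      qed
      then show "\<exists>l\<in>elts omega. \<forall>x. is_real x \<longrightarrow> decided F n (h x) l"
        using p[OF succ_in_omega[OF t(1)]] by blast
    qed
  qed
qed

end

subsection \<open>Perfect subsets\<close>

text \<open>Here \<open>h\<close> is a function of HOL that stands for a definable class function of
  the model. Fixing it in a locale lets its definability join
  \<open>definable_intros\<close>.\<close>

locale embedding = zf_dc mem for mem :: "'v \<Rightarrow> 'v \<Rightarrow> bool" +
  fixes M :: 'v and h :: "'v \<Rightarrow> 'v"
  assumes enumerable_M: "enumerable M"
    and functional_M: "\<forall>F\<in>elts M. functional F"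
    and idf_M: "idf \<in> elts M"
    and comp_M: "\<forall>F\<in>elts M. \<forall>G\<in>elts M. comp G F \<in> elts M"
    and turing_M: "\<forall>x y. turing_le x y \<longrightarrow> (\<exists>F\<in>elts M. maps_to F y x)"
    and definable_h: "definable_term (\<lambda>e. h (e 0))"
    and real_h: "\<forall>x. is_real x \<longrightarrow> is_real (h x)"
    and incomparable_h: "\<forall>x x'. \<forall>F\<in>elts M. is_real x \<and> is_real x' \<and> maps_to F (h x) (h x') \<longrightarrow> x = x'"
    and continuous_h: "\<forall>l\<in>elts omega. \<exists>m\<in>elts omega.
       \<forall>x x'. is_real x \<and> is_real x' \<and> agree x x' m \<longrightarrow> agree (h x) (h x') l"
    and open_h: "\<forall>m\<in>elts omega. \<exists>l\<in>elts omega.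
       \<forall>x x'. is_real x \<and> is_real x' \<and> agree (h x) (h x') l \<longrightarrow> agree x x' m"
    and decided_h: "\<forall>F\<in>elts M. \<forall>n\<in>elts omega. \<exists>l\<in>elts omega. \<forall>x. is_real x \<longrightarrow> decided F n (h x) l"
begin

lemmas definable_term_h [definable_intros] = definable_term_comp1[OF definable_h]

text \<open>The two functionals are named, rather than quantified, because the category argument has
  to settle on one of countably many pairs.\<close>

definition linked :: "'v \<Rightarrow> 'v \<Rightarrow> 'v \<Rightarrow> 'v \<Rightarrow> bool" where
  "linked F G x y \<longleftrightarrow> is_real x \<and> maps_to F y (h x) \<and> maps_to G (h x) y"

lemma definable_linked0: "definable (\<lambda>e. linked (e 0) (e 1) (e 2) (e 3))"
  unfolding linked_def by (intro definable_intros)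

lemmas definable_linked [definable_intros] = definable_comp4[OF definable_linked0]

section \<open>Closed sets and Baire category\<close>

lemma closed_limit:
  assumes "closed_set c" "is_real x" "\<And>n. n \<in> elts omega \<Longrightarrow> \<exists>y\<in>elts c. agree x y n"
  shows "x \<in> elts c"
proof (rule ccontr)
  assume "x \<notin> elts c"
  then obtain n where n: "n \<in> elts omega" "nbhd x n \<inter> elts c = {}"
    using assms(1,2) unfolding closed_set_def by blast
  obtain y where "y \<in> elts c" "agree x y n" using assms(3)[OF n(1)] by blast
  moreover have "is_real y" using assms(1) \<open>y \<in> elts c\<close> by (auto simp: closed_set_def set_of_reals_def)
  ultimately show False using n nbhd_eq[OF assms(2) n(1)] by blast
qed

lemma closed_setI:
  assumes "set_of_reals c"
    "\<And>x. is_real x \<Longrightarrow> \<forall>n\<in>elts omega. \<exists>y\<in>elts c. agree x y n \<Longrightarrow> x \<in> elts c"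
  shows "closed_set c"
  unfolding closed_set_def
proof (intro conjI allI impI assms(1); elim conjE)
  fix x assume x: "is_real x" "x \<notin> elts c"
  then obtain n where "n \<in> elts omega" "\<forall>y\<in>elts c. \<not> agree x y n" using assms(2) by blast
  then show "\<exists>n\<in>elts omega. nbhd x n \<inter> elts c = {}"
    using nbhd_eq[OF x(1)] by blast
qed

text \<open>If no pair of functionals were linked densely in some open part of \<open>Q\<close>, the
  points linked by each pair would be nowhere dense in \<open>Q\<close>. Dependent choice then
  yields a point of \<open>Q\<close> that escapes all pairs of an enumeration, against the
  covering.\<close>

lemma baire_linked:
  assumes Q: "closed_set Q" "q1 \<in> elts Q"
    and cover: "\<And>y. y \<in> elts Q \<Longrightarrow> \<exists>F\<in>elts M. \<exists>G\<in>elts M. \<exists>x. linked F G x y"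
  shows "\<exists>F\<in>elts M. \<exists>G\<in>elts M. \<exists>q\<in>elts Q. \<exists>m\<in>elts omega. \<forall>q'\<in>elts Q. agree q q' m \<longrightarrow>
     (\<forall>m'\<in>elts omega. \<exists>y\<in>elts Q. agree q' y m' \<and> (\<exists>x. linked F G x y))"
proof (rule ccontr)
  assume "\<not> ?thesis"
  then have nowhere: "\<exists>q'\<in>elts Q. agree q q' m \<and>
      (\<exists>m'\<in>elts omega. \<forall>y\<in>elts Q. agree q' y m' \<longrightarrow> \<not> (\<exists>x. linked F G x y))"
    if "F \<in> elts M" "G \<in> elts M" "q \<in> elts Q" "m \<in> elts omega" for F G q m
    using that by blast
  have Qr: "is_real q" if "q \<in> elts Q" for q using Q(1) that by (auto simp: closed_set_def set_of_reals_def)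
  have "enumerable (times M M)" by (intro enumerable_times enumerable_M)
  moreover have "opair idf idf \<in> elts (times M M)" using idf_M by simp
  ultimately obtain e where e: "func e (elts omega) (elts (times M M))"
    "\<And>z. z \<in> elts (times M M) \<Longrightarrow> \<exists>t\<in>elts omega. ap e t = z"
    using enumeration by blast
  \<comment> \<open>A state is a point of \<open>Q\<close> with a length. Step \<open>t\<close>
    moves to a smaller neighbourhood in which no point of \<open>Q\<close> is linked by pair number
    \<open>t\<close>.\<close>
  define R where "R t z z' \<longleftrightarrow> pr2 z \<in> elts (pr2 z') \<and> agree (pr1 z) (pr1 z') (pr2 z) \<and>
      (\<forall>y\<in>elts Q. agree (pr1 z') y (pr2 z') \<longrightarrow> \<not> (\<exists>x. linked (pr1 (ap e t)) (pr2 (ap e t)) x y))" for t z z'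
  have dR: "definable (\<lambda>e. R (e 0) (e 1) (e 2))" unfolding R_def by (intro definable_intros)
  have start: "opair q1 zero \<in> elts (times Q omega)" using Q(2) by simp
  have total: "\<exists>z'\<in>elts (times Q omega). R t z z'" if t: "t \<in> elts omega" and z: "z \<in> elts (times Q omega)" for t z
  proof -
    obtain q m where q: "z = opair q m" "q \<in> elts Q" "m \<in> elts omega" using z by (rule timesE)
    obtain F G where FG: "ap e t = opair F G" "F \<in> elts M" "G \<in> elts M" using ap_in[OF e(1) t] by (rule timesE)
    obtain q' m' where q': "q' \<in> elts Q" "agree q q' m" "m' \<in> elts omega"
      "\<forall>y\<in>elts Q. agree q' y m' \<longrightarrow> \<not> (\<exists>x. linked F G x y)"
      using nowhere[OF FG(2,3) q(2,3)] by blast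
    obtain l where l: "l \<in> elts omega" "elts m' \<subseteq> elts l" "elts (succ m) \<subseteq> elts l"
      using nat_max[OF q'(3) succ_in_omega[OF q(3)]] by blast
    have "\<forall>y\<in>elts Q. agree q' y l \<longrightarrow> \<not> (\<exists>x. linked F G x y)"
      using q'(4) agree_mono[OF _ l(2)] by blast
    moreover have "m \<in> elts l" using l(3) by (auto simp: elts_succ)
    ultimately have "R t z (opair q' l)" using q q' FG(1) by (simp add: R_def)
    moreover have "opair q' l \<in> elts (times Q omega)" using q' l by simp
    ultimately show ?thesis by blast
  qed
  obtain f where f: "func f (elts omega) (elts (times Q omega))"
    "\<forall>t\<in>elts omega. R t (ap f t) (ap f (succ t))"
    by (rule dc_indexed[where R = R, OF dR start total]) auto
  have fQ: "pr1 (ap f t) \<in> elts Q \<and> pr2 (ap f t) \<in> elts omega" if t: "t \<in> elts omega" for t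
  proof -
    obtain q m where "ap f t = opair q m" "q \<in> elts Q" "m \<in> elts omega" using ap_in[OF f(1) t] by (rule timesE)
    then show ?thesis by simp
  qed
  have fR: "R t (ap f t) (ap f (succ t))" if "t \<in> elts omega" for t using f(2) that by blast
  have inc: "pr2 (ap f t) \<in> elts (pr2 (ap f (succ t)))" if "t \<in> elts omega" for t
    using fR[OF that] by (simp add: R_def)
  have d: "definable_term (\<lambda>e. pr1 (ap f (e 0)))" "definable_term (\<lambda>e. pr2 (ap f (e 0)))"
    by (intro definable_intros)+
  obtain q where q: "is_real q" "\<And>t. t \<in> elts omega \<Longrightarrow> agree (pr1 (ap f t)) q (pr2 (ap f t))"
    by (rule limit_of_reals[OF d]) (use fQ fR Qr in \<open>auto simp: R_def\<close>)
  have "q \<in> elts Q"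
  proof (rule closed_limit[OF Q(1) q(1)])
    fix n assume n: "n \<in> elts omega"
    have "elts n \<subseteq> elts (pr2 (ap f n))"
      by (rule increasing_ge[where m = "\<lambda>n. pr2 (ap f n)", OF d(2) _ _ n]) (use fQ inc in auto)
    then have "agree q (pr1 (ap f n)) n" using q(2)[OF n] agree_mono agree_sym by blast
    then show "\<exists>y\<in>elts Q. agree q y n" using fQ[OF n] by blast
  qed
  then obtain F G x where FG: "F \<in> elts M" "G \<in> elts M" "linked F G x q" using cover by blast
  obtain t where t: "t \<in> elts omega" "ap e t = opair F G" using e(2)[of "opair F G"] FG(1,2) by auto
  show False
    using fR[OF t(1)] q(2)[OF succ_in_omega[OF t(1)]] \<open>q \<in> elts Q\<close> FG(3) t(2) by (auto simp: R_def)
qed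

lemma perfect_subset:
  assumes A: "set_of_reals A" and Q: "perfect_set Q" "elts Q \<noteq> {}"
    and cover: "\<And>y. y \<in> elts Q \<Longrightarrow> \<exists>F\<in>elts M. \<exists>G\<in>elts M. \<exists>a\<in>elts A. linked F G a y"
  shows "\<exists>X. perfect_set X \<and> elts X \<noteq> {} \<and> elts X \<subseteq> elts A"
proof -
  have clQ: "closed_set Q" using Q(1) by (simp add: perfect_set_def)
  have Qr: "is_real q" if "q \<in> elts Q" for q using clQ that by (auto simp: closed_set_def set_of_reals_def)
  obtain q1 where "q1 \<in> elts Q" using Q(2) by blast
  from baire_linked[OF clQ this] cover
  obtain F G q0 m0 where FG: "F \<in> elts M" "G \<in> elts M" and q0: "q0 \<in> elts Q" "m0 \<in> elts omega"
    and dense: "\<forall>q'\<in>elts Q. agree q0 q' m0 \<longrightarrow>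
     (\<forall>m'\<in>elts omega. \<exists>y\<in>elts Q. agree q' y m' \<and> (\<exists>x. linked F G x y))"
    by blast
  have fF: "functional F" and fG: "functional G" using FG functional_M by auto
  have hr: "is_real (h x)" if "is_real x" for x using real_h that by blast
  \<comment> \<open>Membership in \<open>A\<close> is not demanded, since it could be lost in the
    limit; it is recovered from incomparability. The restriction to \<open>q0\<close> and
    \<open>m0\<close> keeps to the part of \<open>Q\<close> where linked points are dense.\<close>
  define X where "X = sep RR (\<lambda>x. \<exists>y\<in>elts Q. agree q0 y m0 \<and> linked F G x y)"
  have X: "x \<in> elts X \<longleftrightarrow> (\<exists>y\<in>elts Q. agree q0 y m0 \<and> linked F G x y)" for x
  proof -
    have "definable (\<lambda>e. \<exists>y\<in>elts Q. agree q0 y m0 \<and> linked F G (e 0) y)" by (intro definable_intros)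
    from elts_sep[where P = "\<lambda>x. \<exists>y\<in>elts Q. agree q0 y m0 \<and> linked F G x y", OF this] show ?thesis
      unfolding X_def by (auto simp: elts_RR linked_def)
  qed
  have Xr: "is_real x" if "x \<in> elts X" for x using that by (auto simp: X linked_def)
  have ne: "elts X \<noteq> {}" using dense q0 agree_refl X by blast
  have sub: "elts X \<subseteq> elts A"
  proof
    fix x assume "x \<in> elts X"
    then obtain y where y: "y \<in> elts Q" "linked F G x y" using X by blast
    obtain F' G' a where a: "F' \<in> elts M" "G' \<in> elts M" "a \<in> elts A" "linked F' G' a y"
      using cover[OF y(1)] by blast
    have fG': "functional G'" using a functional_M by blast
    \<comment> \<open>The functionals that link \<open>a\<close> to \<open>y\<close> may vary with
      \<open>y\<close>: passing through \<open>y\<close>, the composite leads from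
      \<open>h a\<close> to \<open>h x\<close>, and incomparability identifies \<open>a\<close> with
      \<open>x\<close>.\<close>
    have "maps_to (comp F G') (h a) (h x)"
      using maps_to_comp[OF fG' fF] hr Qr[OF y(1)] y(2) a(4) unfolding linked_def by blast
    then have "a = x"
      using incomparable_h comp_M a(2) FG(1) a(4) y(2) unfolding linked_def by blast
    with a(3) show "x \<in> elts A" by simp
  qed
  have closed: "closed_set X"
  proof (rule closed_setI)
    show "set_of_reals X" using Xr by (simp add: set_of_reals_def)
    fix x assume x: "is_real x" and lim: "\<forall>n\<in>elts omega. \<exists>y\<in>elts X. agree x y n"
    have near: "\<exists>x'\<in>elts X. agree (h x) (h x') l" if "l \<in> elts omega" for l
    proof -
      obtain m where "m \<in> elts omega" "\<forall>x x'. is_real x \<and> is_real x' \<and> agree x x' m \<longrightarrow> agree (h x) (h x') l"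
        using continuous_h \<open>l \<in> elts omega\<close> by blast
      then show ?thesis using lim x Xr by blast
    qed
    \<comment> \<open>Convergence survives the limit because a prefix of bounded length decides it,
      and a nearby element of \<open>X\<close> with this prefix excludes divergence.\<close>
    have defined: "\<exists>r. val H (h x) n r" if H: "H \<in> elts M" and n: "n \<in> elts omega"
      and ex: "\<And>x'. x' \<in> elts X \<Longrightarrow> \<exists>r. val H (h x') n r" for H n
    proof -
      obtain l where l: "l \<in> elts omega" "\<forall>x. is_real x \<longrightarrow> decided H n (h x) l" using decided_h H n by blast
      obtain x' where x': "x' \<in> elts X" "agree (h x) (h x') l" using near[OF l(1)] by blast
      have "decided H n (h x) l" using l(2) x by blast
      then show ?thesis
        unfolding decided_def using ex[OF x'(1)] x'(2) hr[OF Xr[OF x'(1)]] hr[OF x] agree_refl by blast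
    qed
    have Gdef: "\<exists>r. val G (h x) n r" if n: "n \<in> elts omega" for n
    proof (rule defined[OF FG(2) n])
      fix x' assume "x' \<in> elts X"
      then show "\<exists>r. val G (h x') n r" unfolding X linked_def maps_to_def using n by blast
    qed
    define y where "y = lam omega (\<lambda>n. if val G (h x) n zero then zero else one)"
    have dy: "definable_term (\<lambda>e. if val G (h x) (e 0) zero then zero else one)" by (intro definable_intros)
    have y: "is_real y" "\<And>n. n \<in> elts omega \<Longrightarrow> ap y n = (if val G (h x) n zero then zero else one)"
      unfolding y_def by (rule real_lam[OF dy]; simp)+
    have Gy: "maps_to G (h x) y"
      unfolding maps_to_def
    proof
      fix n assume n: "n \<in> elts omega"
      obtain r where r: "val G (h x) n r" using Gdef[OF n] by blast
      then have "r = zero \<or> r = one" using val_dom[OF fG r] by (simp add: elts_two)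
      with r y(2)[OF n] show "val G (h x) n (ap y n)" by auto
    qed
    \<comment> \<open>The first \<open>k\<close> bits of the output of \<open>G\<close> on
      \<open>h x\<close> use a prefix of \<open>h x\<close> that it shares with some
      \<open>h x'\<close> for \<open>x'\<close> in \<open>X\<close>; the partner of
      \<open>x'\<close> in \<open>Q\<close> therefore begins with these bits.\<close>
    have approx: "\<exists>y'\<in>elts Q. agree q0 y' m0 \<and> agree y y' k" if k: "k \<in> elts omega" for k
    proof -
      have "val G (h x) i (ap y i)" if "i \<in> elts k" for i
        using Gy in_omega_trans[OF k that] by (simp add: maps_to_def)
      from functional_use_bound[OF fG k this]
      obtain l where l: "l \<in> elts omega"
        "\<And>w i. is_real w \<Longrightarrow> agree (h x) w l \<Longrightarrow> i \<in> elts k \<Longrightarrow> val G w i (ap y i)" by blast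
      obtain x' where x': "x' \<in> elts X" "agree (h x) (h x') l" using near[OF l(1)] by blast
      obtain y' where y': "y' \<in> elts Q" "agree q0 y' m0" "linked F G x' y'" using x'(1) X by blast
      have "agree y y' k"
        unfolding agree_def
      proof
        fix i assume i: "i \<in> elts k"
        have "val G (h x') i (ap y i)" using l(2)[OF hr[OF Xr[OF x'(1)]] x'(2) i] .
        moreover have "val G (h x') i (ap y' i)"
          using y'(3) in_omega_trans[OF k i] by (simp add: linked_def maps_to_def)
        ultimately show "ap y i = ap y' i" by (rule val_unique[OF fG])
      qed
      with y' show ?thesis by blast
    qed
    have yQ: "y \<in> elts Q" using closed_limit[OF clQ y(1)] approx by blast
    have q0y: "agree q0 y m0" using approx[OF q0(2)] agree_sym agree_trans by blast
    have FGM: "comp F G \<in> elts M" using comp_M FG by blast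
    then have fFG: "functional (comp F G)" using functional_M by blast
    have fix': "maps_to (comp F G) (h x') (h x')" if x': "x' \<in> elts X" for x'
    proof -
      obtain y' where y': "y' \<in> elts Q" "linked F G x' y'" using x' X by blast
      note r = hr[OF Xr[OF x']]
      from maps_to_comp[OF fG fF r Qr[OF y'(1)] r] y'(2) show ?thesis unfolding linked_def by blast
    qed
    \<comment> \<open>The composite of \<open>G\<close> and \<open>F\<close> is the identity on the
      reals \<open>h x'\<close> with \<open>x'\<close> in \<open>X\<close>. It converges at
      \<open>h x\<close> by decidedness, and by continuity its output there is
      \<open>h x\<close>.\<close>
    have Fy: "maps_to F y (h x)"
      unfolding maps_to_def
    proof
      fix n assume n: "n \<in> elts omega"
      have "\<exists>r. val (comp F G) (h x) n r"
        by (rule defined[OF FGM n]) (use fix' n in \<open>auto simp: maps_to_def\<close>)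
      then obtain r where r: "val (comp F G) (h x) n r" by blast
      obtain l where l: "l \<in> elts omega" "\<And>w. is_real w \<Longrightarrow> agree (h x) w l \<Longrightarrow> val (comp F G) w n r"
        using val_open[OF fFG r] by blast
      obtain k where k: "k \<in> elts omega" "elts l \<subseteq> elts k" "elts (succ n) \<subseteq> elts k"
        using nat_max[OF l(1) succ_in_omega[OF n]] by blast
      obtain x' where x': "x' \<in> elts X" "agree (h x) (h x') k" using near[OF k(1)] by blast
      have "val (comp F G) (h x') n r" using l(2) hr[OF Xr[OF x'(1)]] agree_mono[OF x'(2) k(2)] by blast
      moreover have "val (comp F G) (h x') n (ap (h x') n)" using fix'[OF x'(1)] n by (simp add: maps_to_def)
      ultimately have "r = ap (h x') n" by (rule val_unique[OF fFG])
      also have "\<dots> = ap (h x) n" using x'(2) k(3) by (auto simp: agree_def elts_succ)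
      finally show "val F y n (ap (h x) n)" using val_comp_maps_to[OF fG y(1) Gy r] by simp
    qed
    show "x \<in> elts X" unfolding X linked_def using yQ q0y x Fy Gy by blast
  qed
  have "\<not> isolated_point x X" for x
  proof
    assume "isolated_point x X"
    then obtain n where xX: "x \<in> elts X" and n: "n \<in> elts omega" and iso: "nbhd x n \<inter> elts X = {x}"
      unfolding isolated_point_def by blast
    note x = Xr[OF xX]
    obtain y where y: "y \<in> elts Q" "agree q0 y m0" "linked F G x y" using xX X by blast
    note yr = Qr[OF y(1)]
    obtain l where l: "l \<in> elts omega"
      "\<forall>x x'. is_real x \<and> is_real x' \<and> agree (h x) (h x') l \<longrightarrow> agree x x' n"
      using open_h n by blast
    have "val F y i (ap (h x) i)" if "i \<in> elts l" for i
      using y(3) in_omega_trans[OF l(1) that] by (simp add: linked_def maps_to_def)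
    from functional_use_bound[OF fF l(1) this]
    obtain k where k: "k \<in> elts omega"
      "\<And>w i. is_real w \<Longrightarrow> agree y w k \<Longrightarrow> i \<in> elts l \<Longrightarrow> val F w i (ap (h x) i)" by blast
    obtain k' where k': "k' \<in> elts omega" "elts k \<subseteq> elts k'" "elts m0 \<subseteq> elts k'"
      using nat_max[OF k(1) q0(2)] by blast
    have "nbhd y k' \<inter> elts Q \<noteq> {y}"
      using Q(1) y(1) k'(1) unfolding perfect_set_def isolated_point_def by blast
    moreover have "y \<in> nbhd y k' \<inter> elts Q" using nbhd_eq[OF yr k'(1)] yr y(1) by simp
    ultimately obtain q where q: "q \<in> elts Q" "q \<noteq> y" "agree y q k'" using nbhd_eq[OF yr k'(1)] by blast
    obtain j where j: "j \<in> elts omega" "ap q j \<noteq> ap y j" using real_eqI[OF Qr[OF q(1)] yr] q(2) by blast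
    \<comment> \<open>The point \<open>q\<close> itself need not be linked. A linked
      \<open>y'\<close> is taken so close to it that it still differs from \<open>y\<close> at bit
      \<open>j\<close>.\<close>
    obtain k2 where k2: "k2 \<in> elts omega" "elts k' \<subseteq> elts k2" "elts (succ j) \<subseteq> elts k2"
      using nat_max[OF k'(1) succ_in_omega[OF j(1)]] by blast
    have "agree q0 q m0" using agree_trans[OF y(2) agree_mono[OF q(3) k'(3)]] .
    then obtain y' x' where y': "y' \<in> elts Q" "agree q y' k2" "linked F G x' y'" using dense q(1) k2(1) by blast
    have yy': "agree y y' k'" using agree_trans[OF q(3) agree_mono[OF y'(2) k2(2)]] .
    have "x' \<in> elts X"
      using y' agree_trans[OF y(2) agree_mono[OF yy' k'(3)]] X by blast
    note x' = Xr[OF this]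
    have "agree (h x) (h x') l"
      unfolding agree_def
    proof
      fix i assume i: "i \<in> elts l"
      have "val F y' i (ap (h x) i)" using k(2)[OF Qr[OF y'(1)] agree_mono[OF yy' k'(2)] i] .
      moreover have "val F y' i (ap (h x') i)"
        using y'(3) in_omega_trans[OF l(1) i] by (simp add: linked_def maps_to_def)
      ultimately show "ap (h x) i = ap (h x') i" by (rule val_unique[OF fF])
    qed
    then have "agree x x' n" using l(2) x x' by blast
    \<comment> \<open>Since \<open>y'\<close> is close to \<open>y\<close>, continuity of
      \<open>F\<close> brings \<open>h x'\<close> close to \<open>h x\<close>, hence
      \<open>x'\<close> into the isolating neighbourhood. But then \<open>G\<close> would produce
      both \<open>y\<close> and \<open>y'\<close> from the same real.\<close>
    then have "x' = x" using iso \<open>x' \<in> elts X\<close> nbhd_eq[OF x n] x' by blast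
    have "ap y' j = ap q j" using y'(2) k2(3) by (auto simp: agree_def elts_succ)
    moreover have "ap y' j = ap y j"
      using y(3) y'(3) j(1) val_unique[OF fG] unfolding linked_def maps_to_def \<open>x' = x\<close> by blast
    ultimately show False using j(2) by simp
  qed
  with closed have "perfect_set X" by (simp add: perfect_set_def)
  with ne sub show ?thesis by blast
qed

text \<open>\<open>B\<close> is closed under the equivalence given by \<open>M\<close>, which may be
  coarser than Turing equivalence. Invariance under the finer relation is all that the hypothesis
  asks for, so the members of \<open>M\<close> need not be computable.\<close>

lemma perfect_set_property_of_invariant:
  assumes inv: "\<And>b. set_of_reals b \<Longrightarrow> turing_invariant b \<Longrightarrow> perfect_set_property b"
    and A: "set_of_reals A"
  shows "perfect_set_property A"
proof -
  define B where "B = sep RR (\<lambda>y. \<exists>F\<in>elts M. \<exists>G\<in>elts M. \<exists>a\<in>elts A. linked F G a y)"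
  have B: "y \<in> elts B \<longleftrightarrow> is_real y \<and> (\<exists>F\<in>elts M. \<exists>G\<in>elts M. \<exists>a\<in>elts A. linked F G a y)" for y
  proof -
    have "definable (\<lambda>e. \<exists>F\<in>elts M. \<exists>G\<in>elts M. \<exists>a\<in>elts A. linked F G a (e 0))" by (intro definable_intros)
    from elts_sep[where P = "\<lambda>y. \<exists>F\<in>elts M. \<exists>G\<in>elts M. \<exists>a\<in>elts A. linked F G a y", OF this] show ?thesis
      unfolding B_def by (simp add: elts_RR)
  qed
  have Ar: "is_real a" if "a \<in> elts A" for a using A that by (simp add: set_of_reals_def)
  have hr: "is_real (h a)" if "a \<in> elts A" for a using real_h Ar[OF that] by blast
  have "set_of_reals B" by (simp add: set_of_reals_def B)
  moreover have "turing_invariant B"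
    unfolding turing_invariant_def
  proof (intro ballI allI impI)
    fix x y assume x: "x \<in> elts B" and "turing_equiv y x"
    then have le: "turing_le y x" "turing_le x y" by (auto simp: turing_equiv_def)
    then have r: "is_real x" "is_real y" by (auto simp: turing_le_def)
    obtain F' where F': "F' \<in> elts M" "maps_to F' x y" using le(1) turing_M by blast
    obtain G' where G': "G' \<in> elts M" "maps_to G' y x" using le(2) turing_M by blast
    obtain F G a where FG: "F \<in> elts M" "G \<in> elts M" "a \<in> elts A" "linked F G a x" using x B by blast
    have f: "functional F" "functional G" "functional F'" "functional G'"
      using FG F' G' functional_M by auto
    \<comment> \<open>The links of \<open>x\<close> are prolonged by the reductions between
      \<open>x\<close> and \<open>y\<close>; closure of \<open>M\<close> under composition keeps the
      new pair in \<open>M\<close>.\<close>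
    have "maps_to (comp F G') y (h a)"
      using maps_to_comp[OF f(4,1) hr[OF FG(3)] r G'(2)] FG(4) by (simp add: linked_def)
    moreover have "maps_to (comp F' G) (h a) y"
      using maps_to_comp[OF f(2,3) r(2,1) hr[OF FG(3)] _ F'(2)] FG(4) by (simp add: linked_def)
    ultimately have "linked (comp F G') (comp F' G) a y" using Ar[OF FG(3)] by (simp add: linked_def)
    moreover have "comp F G' \<in> elts M" "comp F' G \<in> elts M" using comp_M FG F' G' by auto
    ultimately show "y \<in> elts B" unfolding B using r(2) FG(3) by blast
  qed
  ultimately have "perfect_set_property B" by (rule inv)
  then show ?thesis
    unfolding perfect_set_property_def[of B]
  proof (elim disjE exE conjE)
    fix Q assume "perfect_set Q" "elts Q \<noteq> {}" "elts Q \<subseteq> elts B"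
    then have "\<exists>X. perfect_set X \<and> elts X \<noteq> {} \<and> elts X \<subseteq> elts A"
      using B by (intro perfect_subset[OF A, of Q]) auto
    then show ?thesis by (simp add: perfect_set_property_def)
  next
    assume "countable_set B"
    then obtain f where f: "func f (elts B) (elts omega)"
      "\<forall>x\<in>elts B. \<forall>y\<in>elts B. app f x = app f y \<longrightarrow> x = y"
      unfolding countable_set_def by blast
    have hB: "h a \<in> elts B" if "a \<in> elts A" for a
      unfolding B using that Ar hr maps_to_idf idf_M unfolding linked_def by blast
    have d: "definable_term (\<lambda>e. ap f (h (e 0)))" by (intro definable_intros)
    \<comment> \<open>The injection for \<open>A\<close> is the one for \<open>B\<close> preceded by
      \<open>h\<close>, and \<open>h\<close> is injective by incomparability applied to the identity
      functional.\<close>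
    have g: "func (lam A (\<lambda>a. ap f (h a))) (elts A) (elts omega)"
      by (rule func_lam[OF d]) (use ap_in[OF f(1) hB] in blast)
    have "a = a'" if a: "a \<in> elts A" "a' \<in> elts A"
      and eq: "app (lam A (\<lambda>a. ap f (h a))) a = app (lam A (\<lambda>a. ap f (h a))) a'" for a a'
    proof -
      have "ap f (h a) = ap f (h a')"
        using eq app_eq_ap[OF g a(1)] app_eq_ap[OF g a(2)] ap_lam[OF d a(1)] ap_lam[OF d a(2)] by simp
      then have "h a = h a'"
        using f(2) app_eq_ap[OF f(1) hB[OF a(1)]] app_eq_ap[OF f(1) hB[OF a(2)]] hB a by auto
      then have "maps_to idf (h a) (h a')" using maps_to_idf[OF hr[OF a(1)]] by simp
      then show ?thesis using incomparable_h idf_M Ar a by blast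
    qed
    with g have "countable_set A" unfolding countable_set_def by blast
    then show ?thesis by (simp add: perfect_set_property_def)
  qed
qed

end

lemma (in zf_dc) perfect_set_property_if_invariant:
  assumes "\<And>b. set_of_reals b \<Longrightarrow> turing_invariant b \<Longrightarrow> perfect_set_property b" "set_of_reals A"
  shows "perfect_set_property A"
proof -
  obtain M where M: "enumerable M" "\<forall>F\<in>elts M. functional F" "idf \<in> elts M"
    "\<forall>F\<in>elts M. \<forall>G\<in>elts M. comp G F \<in> elts M"
    "\<forall>x y. turing_le x y \<longrightarrow> (\<exists>F\<in>elts M. maps_to F y x)"
    by (rule functional_semigroup)
  obtain h where "definable_term (\<lambda>e. h (e 0))" "\<forall>x. is_real x \<longrightarrow> is_real (h x)"
    "\<forall>x x'. \<forall>F\<in>elts M. is_real x \<and> is_real x' \<and> maps_to F (h x) (h x') \<longrightarrow> x = x'"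
    "\<forall>l\<in>elts omega. \<exists>m\<in>elts omega.
       \<forall>x x'. is_real x \<and> is_real x' \<and> agree x x' m \<longrightarrow> agree (h x) (h x') l"
    "\<forall>m\<in>elts omega. \<exists>l\<in>elts omega.
       \<forall>x x'. is_real x \<and> is_real x' \<and> agree (h x) (h x') l \<longrightarrow> agree x x' m"
    "\<forall>F\<in>elts M. \<forall>n\<in>elts omega. \<exists>l\<in>elts omega. \<forall>x. is_real x \<longrightarrow> decided F n (h x) l"
    using M(1,3,2) by (rule incomparable_embedding)
  with M interpret embedding mem M h by unfold_locales
  show ?thesis using assms by (rule perfect_set_property_of_invariant)
qed

theorem theorem2p1:
  fixes mem :: "'v \<Rightarrow> 'v \<Rightarrow> bool"
  assumes "zf_dc mem"
    and "\<forall>a. membership.set_of_reals mem a \<and> membership.turing_invariant mem a \<longrightarrow>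
             membership.perfect_set_property mem a"
  shows "\<forall>a. membership.set_of_reals mem a \<longrightarrow> membership.perfect_set_property mem a"
  using zf_dc.perfect_set_property_if_invariant[OF assms(1)] assms(2) by blast

end
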